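(* Let $G$ and $H$ be two Polish locally compact groups, each acting in a Borel, measure-preserving, ergodic manner on a standard probability space $(X,\mu)$. Suppose that $\psi:[\mathcal R_G]\to[\mathcal R_H]$ is an abstract group isomorphism. Then there exists an orbit equivalence $S$ between $\mathcal R_G$ and $\mathcal R_H$ such that for all $T\in[\mathcal R_G]$, $$\psi(T)=STS^{-1}.$$
   Context: A standard probability space is a standard Borel space equipped with a non-atomic Borel probability measure. $\mathrm{Aut}(X,\mu)$ is the group of measure-preserving Borel bijections of $(X,\mu)$, identified when equal almost everywhere. A Borel action means that the action map is Borel. $\mathcal R_G$ denotes the orbit equivalence relation of the $G$-action: $(x,y)\in\mathcal R_G$ iff $y\in G\cdot x$; the orbit full group is $[\mathcal R_G]=\{T\in\mathrm{Aut}(X,\mu): T(x)\in G\cdot x\text{ for all (equivalently, almost all) }x\in X\}$; similarly for $H$. An orbit equivalence between equivalence relations $\mathcal R$ and $\mathcal R'$ on $(X,\mu)$ is a Borel measure-preserving bijection $S:A\to A$ of a full measure subset $A\subseteq X$ such that for all $(x,y)\in A^2$, $(x,y)\in\mathcal R$ if and only if $(S(x),S(y))\in\mathcal R'$; such an $S$ defines an element of $\mathrm{Aut}(X,\mu)$. *)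

theory Defs
  imports
    "HOL-Probability.Probability_Measure"
    "HOL-Algebra.Group_Action"
begin

section \<open>Polish locally compact groups and standard probability spaces\<close>

definition polish_topology :: "'a topology \<Rightarrow> bool" where
  "polish_topology \<tau> \<longleftrightarrow> completely_metrizable_space \<tau> \<and> separable_space \<tau>"

definition borel_of :: "'a topology \<Rightarrow> 'a measure" where
  "borel_of \<tau> = sigma (topspace \<tau>) {U. openin \<tau> U}"

locale polish_lc_group = group G for G :: "('g, 'm) monoid_scheme" (structure) +
  fixes \<tau> :: "'g topology"
  assumes topspace_eq: "topspace \<tau> = carrier G"
    and continuous_mult: "continuous_map (prod_topology \<tau> \<tau>) \<tau> (\<lambda>(g, h). g \<otimes> h)"
    and continuous_inv: "continuous_map \<tau> \<tau> (\<lambda>g. inv g)"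
    and polish: "polish_topology \<tau>"
    and locally_compact: "locally_compact_space \<tau>"

text \<open>
  Being standard Borel is a property of the measurable space only: some Polish topology generates
  its \<open>\<sigma>\<close>-algebra.
\<close>

locale standard_probability_space = prob_space M for M :: "'a measure" +
  assumes standard_borel:
      "\<exists>\<tau>. topspace \<tau> = space M \<and> polish_topology \<tau> \<and> sets (borel_of \<tau>) = sets M"
    and non_atomic:
      "\<And>A. A \<in> sets M \<Longrightarrow> 0 < measure M A \<Longrightarrow>
         \<exists>B\<in>sets M. B \<subseteq> A \<and> 0 < measure M B \<and> measure M B < measure M A"

definition mp_map :: "'a measure \<Rightarrow> ('a \<Rightarrow> 'a) \<Rightarrow> bool" where
  "mp_map M T \<longleftrightarrow> T \<in> M \<rightarrow>\<^sub>M M \<and> distr M M T = M"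

text \<open>
  Borel bijections are taken to be Borel isomorphisms; between standard Borel spaces, the inverse
  of a Borel bijection is automatically Borel.
\<close>

definition mp_bijection :: "'a measure \<Rightarrow> ('a \<Rightarrow> 'a) \<Rightarrow> bool" where
  "mp_bijection M T \<longleftrightarrow>
     bij_betw T (space M) (space M) \<and> mp_map M T \<and> inv_into (space M) T \<in> M \<rightarrow>\<^sub>M M"


section \<open>Ergodic actions and orbit equivalence relations\<close>

locale pmp_ergodic_action =
  polish_lc_group G \<tau> + standard_probability_space M + group_action G "space M" \<phi>
  for G :: "('g, 'm) monoid_scheme" (structure) and \<tau> :: "'g topology"
    and M :: "'a measure" and \<phi> :: "'g \<Rightarrow> 'a \<Rightarrow> 'a" +
  assumes borel_action: "(\<lambda>(g, x). \<phi> g x) \<in> (borel_of \<tau> \<Otimes>\<^sub>M M) \<rightarrow>\<^sub>M M"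
    and measure_preserving: "\<And>g. g \<in> carrier G \<Longrightarrow> mp_map M (\<phi> g)"
    and ergodic:
      "\<And>A. A \<in> sets M \<Longrightarrow> (\<And>g. g \<in> carrier G \<Longrightarrow> \<phi> g ` A = A) \<Longrightarrow>
         measure M A = 0 \<or> measure M A = 1"

definition orbit_rel :: "('g, 'm) monoid_scheme \<Rightarrow> 'a measure \<Rightarrow> ('g \<Rightarrow> 'a \<Rightarrow> 'a) \<Rightarrow> ('a \<times> 'a) set"
  where "orbit_rel G M \<phi> = {(x, y). x \<in> space M \<and> y \<in> orbit G \<phi> x}"

definition orbit_equivalence ::
    "'a measure \<Rightarrow> ('a \<times> 'a) set \<Rightarrow> ('a \<times> 'a) set \<Rightarrow> 'a set \<Rightarrow> ('a \<Rightarrow> 'a) \<Rightarrow> bool" where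
  "orbit_equivalence M R R' A S \<longleftrightarrow>
     A \<in> sets M \<and> emeasure M A = emeasure M (space M) \<and>
     mp_bijection (restrict_space M A) S \<and>
     (\<forall>x\<in>A. \<forall>y\<in>A. (x, y) \<in> R \<longleftrightarrow> (S x, S y) \<in> R')"


section \<open>The group of automorphisms modulo null sets\<close>

text \<open>Strict automorphisms, before identification; as in \<^const>\<open>BijGroup\<close>, functions are made
  extensional so that they are determined by their values on the space.\<close>

definition mp_group :: "'a measure \<Rightarrow> ('a \<Rightarrow> 'a) monoid" where
  "mp_group M = BijGroup (space M)\<lparr>carrier := {T \<in> extensional (space M). mp_bijection M T}\<rparr>"

text \<open>\<open>aut_class M S\<close> makes sense for \<open>S\<close> defined almost everywhere only; see
  \<open>orbit_equivalence_aut_class\<close> below.\<close>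

definition aut_class :: "'a measure \<Rightarrow> ('a \<Rightarrow> 'a) \<Rightarrow> ('a \<Rightarrow> 'a) set" where
  "aut_class M S = {T \<in> carrier (mp_group M). AE x in M. T x = S x}"

definition aut_group :: "'a measure \<Rightarrow> ('a \<Rightarrow> 'a) set monoid" where
  "aut_group M = mp_group M Mod aut_class M (\<lambda>x. x)"

definition full_group :: "'a measure \<Rightarrow> ('a \<times> 'a) set \<Rightarrow> ('a \<Rightarrow> 'a) set monoid" where
  "full_group M R = aut_group M
     \<lparr>carrier := {aut_class M T | T. T \<in> carrier (mp_group M) \<and> (AE x in M. (x, T x) \<in> R)}\<rparr>"

lemma mp_map_comp: "mp_map M S \<Longrightarrow> mp_map M T \<Longrightarrow> mp_map M (\<lambda>x. S (T x))"
  unfolding mp_map_def using distr_distr[of S M M T M] by (auto simp: comp_def)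

lemma mp_map_cong: "(\<And>x. x \<in> space M \<Longrightarrow> S x = T x) \<Longrightarrow> mp_map M S \<longleftrightarrow> mp_map M T"
  unfolding mp_map_def using measurable_cong[of M S T M] distr_cong[of M M M M S T] by auto

lemma mp_map_AE: "mp_map M T \<Longrightarrow> AE x in M. P x \<Longrightarrow> AE x in M. P (T x)"
  unfolding mp_map_def by (metis AE_distrD)

lemma mp_bijection_inverse:
  assumes "mp_bijection M T" shows "mp_bijection M (inv_into (space M) T)"
proof -
  let ?I = "inv_into (space M) T"
  have b: "bij_betw T (space M) (space M)" and T: "T \<in> M \<rightarrow>\<^sub>M M" "distr M M T = M" and I: "?I \<in> M \<rightarrow>\<^sub>M M"
    using assms by (auto simp: mp_bijection_def mp_map_def)
  have "distr M M ?I = distr (distr M M T) M ?I" using T by simp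
  also have "\<dots> = distr M M (?I \<circ> T)" using distr_distr[OF I T(1)] .
  also have "\<dots> = distr M M (\<lambda>x. x)"
    by (rule distr_cong) (use b in \<open>auto simp: bij_betw_inv_into_left\<close>)
  finally have "distr M M ?I = M" by simp
  moreover have "inv_into (space M) ?I \<in> M \<rightarrow>\<^sub>M M"
    by (rule measurable_cong[THEN iffD1, OF _ T(1)])
      (use b in \<open>simp add: inv_into_inv_into_eq\<close>)
  ultimately show ?thesis
    using I b by (simp add: mp_bijection_def mp_map_def bij_betw_inv_into)
qed

lemma mp_bijection_cong:
  assumes "\<And>x. x \<in> space M \<Longrightarrow> S x = T x" shows "mp_bijection M S \<longleftrightarrow> mp_bijection M T"
proof -
  have "inv_into (space M) S y = inv_into (space M) T y" for y
    using assms by (auto simp: inv_into_def intro!: arg_cong[where f = Eps])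
  hence "inv_into (space M) S = inv_into (space M) T" by blast
  thus ?thesis
    using assms by (simp add: mp_bijection_def bij_betw_cong[OF assms] mp_map_cong[OF assms])
qed

lemma mp_bijection_comp:
  assumes "mp_bijection M S" "mp_bijection M T" shows "mp_bijection M (\<lambda>x. S (T x))"
proof -
  let ?X = "space M"
  have bS: "bij_betw S ?X ?X" and bT: "bij_betw T ?X ?X" using assms by (auto simp: mp_bijection_def)
  have b: "bij_betw (\<lambda>x. S (T x)) ?X ?X" using bij_betw_trans[OF bT bS] by (simp add: comp_def)
  have m: "(\<lambda>x. inv_into ?X T (inv_into ?X S x)) \<in> M \<rightarrow>\<^sub>M M"
    using assms by (auto simp: mp_bijection_def intro: measurable_compose)
  have "inv_into ?X (\<lambda>x. S (T x)) y = inv_into ?X T (inv_into ?X S y)" if "y \<in> ?X" for y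
  proof (rule inv_into_f_eq)
    show "inj_on (\<lambda>x. S (T x)) ?X" using b by (simp add: bij_betw_def)
    have y: "inv_into ?X S y \<in> ?X" by (meson bS bij_betwE bij_betw_inv_into that)
    thus "inv_into ?X T (inv_into ?X S y) \<in> ?X" by (meson bT bij_betwE bij_betw_inv_into)
    show "S (T (inv_into ?X T (inv_into ?X S y))) = y"
      using y that by (simp add: bij_betw_inv_into_right[OF bS] bij_betw_inv_into_right[OF bT])
  qed
  hence "inv_into ?X (\<lambda>x. S (T x)) \<in> M \<rightarrow>\<^sub>M M" using measurable_cong m by (metis (no_types, lifting))
  thus ?thesis using b assms by (simp add: mp_bijection_def mp_map_comp)
qed

lemma mp_carrier:
  "T \<in> carrier (mp_group M) \<longleftrightarrow> T \<in> extensional (space M) \<and> mp_bijection M T"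
  by (simp add: mp_group_def)

lemma mp_carrier_Bij: "T \<in> carrier (mp_group M) \<Longrightarrow> T \<in> Bij (space M)"
  by (simp add: mp_carrier Bij_def mp_bijection_def)

lemma mp_mult:
  assumes "S \<in> carrier (mp_group M)" "T \<in> carrier (mp_group M)"
  shows "S \<otimes>\<^bsub>mp_group M\<^esub> T = (\<lambda>x\<in>space M. S (T x))"
  using assms[THEN mp_carrier_Bij] by (simp add: mp_group_def BijGroup_def compose_def)

lemma mp_one: "\<one>\<^bsub>mp_group M\<^esub> = (\<lambda>x\<in>space M. x)"
  by (simp add: mp_group_def BijGroup_def)

lemma mp_space: "T \<in> carrier (mp_group M) \<Longrightarrow> x \<in> space M \<Longrightarrow> T x \<in> space M"
  by (auto simp: mp_carrier mp_bijection_def bij_betw_def)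

lemma mp_AE: "T \<in> carrier (mp_group M) \<Longrightarrow> AE x in M. P x \<Longrightarrow> AE x in M. P (T x)"
  using mp_map_AE[of M T P] by (simp add: mp_carrier mp_bijection_def)

lemma group_mp_group: "group (mp_group M)"
proof (rule groupI)
  fix S T assume *: "S \<in> carrier (mp_group M)" "T \<in> carrier (mp_group M)"
  have "mp_bijection M (\<lambda>x\<in>space M. S (T x))"
    using * mp_bijection_comp[of M S T] mp_bijection_cong[of M "\<lambda>x\<in>space M. S (T x)" "\<lambda>x. S (T x)"]
    by (simp add: mp_carrier)
  with * show "S \<otimes>\<^bsub>mp_group M\<^esub> T \<in> carrier (mp_group M)"
    by (simp add: mp_mult) (simp add: mp_carrier)
next
  have "mp_bijection M (\<lambda>x. x)"
    by (auto simp: mp_bijection_def mp_map_def bij_betw_def inj_on_def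
        intro!: measurable_cong[THEN iffD1, OF _ measurable_ident_sets[OF refl]] inv_into_f_eq[symmetric])
  thus "\<one>\<^bsub>mp_group M\<^esub> \<in> carrier (mp_group M)"
    using mp_bijection_cong[of M "\<lambda>x\<in>space M. x" "\<lambda>x. x"] by (simp add: mp_one mp_carrier)
next
  fix S T U
  assume *: "S \<in> carrier (mp_group M)" "T \<in> carrier (mp_group M)" "U \<in> carrier (mp_group M)"
  show "S \<otimes>\<^bsub>mp_group M\<^esub> T \<otimes>\<^bsub>mp_group M\<^esub> U = S \<otimes>\<^bsub>mp_group M\<^esub> (T \<otimes>\<^bsub>mp_group M\<^esub> U)"
    using group.is_monoid[OF group_BijGroup[of "space M"]] *[THEN mp_carrier_Bij]
    by (auto dest!: monoid.m_assoc[of _ S T U] simp: mp_group_def BijGroup_def)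
next
  fix T assume T: "T \<in> carrier (mp_group M)"
  show "\<one>\<^bsub>mp_group M\<^esub> \<otimes>\<^bsub>mp_group M\<^esub> T = T"
    using group.is_monoid[OF group_BijGroup[of "space M"]] T[THEN mp_carrier_Bij]
    by (auto dest!: monoid.l_one[of _ T] simp: mp_group_def BijGroup_def)
next
  fix T assume T: "T \<in> carrier (mp_group M)"
  let ?I = "\<lambda>x\<in>space M. inv_into (space M) T x"
  have I: "?I \<in> carrier (mp_group M)"
    using T mp_bijection_inverse[of M T] mp_bijection_cong[of M ?I "inv_into (space M) T"]
    by (simp add: mp_carrier)
  have "?I \<otimes>\<^bsub>mp_group M\<^esub> T = \<one>\<^bsub>mp_group M\<^esub>"
    unfolding mp_mult[OF I T] mp_one using T
    by (auto simp: mp_carrier mp_bijection_def fun_eq_iff bij_betw_inv_into_left dest: bij_betwE)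
  with I show "\<exists>S\<in>carrier (mp_group M). S \<otimes>\<^bsub>mp_group M\<^esub> T = \<one>\<^bsub>mp_group M\<^esub>" by blast
qed

lemma normal_null: "aut_class M (\<lambda>x. x) \<lhd> mp_group M"
proof -
  interpret group "mp_group M" by (rule group_mp_group)
  let ?G = "mp_group M" and ?N = "aut_class M (\<lambda>x. x)"
  have mult: "S \<otimes>\<^bsub>?G\<^esub> T \<in> ?N" if "S \<in> ?N" "T \<in> ?N" for S T
  proof -
    have *: "S \<in> carrier ?G" "T \<in> carrier ?G" "AE x in M. S x = x" "AE x in M. T x = x"
      using that by (auto simp: aut_class_def)
    have "AE x in M. (S \<otimes>\<^bsub>?G\<^esub> T) x = x"
      using *(3,4) AE_space by eventually_elim (simp add: mp_mult *)
    thus ?thesis using * by (simp add: aut_class_def)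
  qed
  have conj: "x \<otimes>\<^bsub>?G\<^esub> h \<otimes>\<^bsub>?G\<^esub> inv\<^bsub>?G\<^esub> x \<in> ?N" if x: "x \<in> carrier ?G" and h: "h \<in> ?N" for x h
  proof -
    have hc: "h \<in> carrier ?G" and ae: "AE y in M. h y = y" using h by (auto simp: aut_class_def)
    have "AE y in M. h ((inv\<^bsub>?G\<^esub> x) y) = (inv\<^bsub>?G\<^esub> x) y"
      by (rule mp_AE[OF _ ae]) (use x in simp)
    hence "AE y in M. (x \<otimes>\<^bsub>?G\<^esub> h \<otimes>\<^bsub>?G\<^esub> inv\<^bsub>?G\<^esub> x) y = y"
      using AE_space
    proof eventually_elim
      case (elim y)
      have "x ((inv\<^bsub>?G\<^esub> x) y) = y"
        using arg_cong[OF r_inv[OF x], of "\<lambda>f. f y"] elim x by (simp add: mp_mult mp_one)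
      thus ?case
        using x hc elim mp_space[of "inv\<^bsub>?G\<^esub> x" M y]
        by (simp add: mp_mult[of "x \<otimes>\<^bsub>?G\<^esub> h" M "inv\<^bsub>?G\<^esub> x"]) (simp add: mp_mult)
    qed
    thus ?thesis using x hc by (simp add: aut_class_def)
  qed
  have inv: "inv\<^bsub>?G\<^esub> h \<in> ?N" if h: "h \<in> ?N" for h
  proof -
    have hc: "h \<in> carrier ?G" and ae: "AE y in M. h y = y" using h by (auto simp: aut_class_def)
    have "AE y in M. (inv\<^bsub>?G\<^esub> h) y = y"
    proof -
      have "AE y in M. h ((inv\<^bsub>?G\<^esub> h) y) = (inv\<^bsub>?G\<^esub> h) y"
        by (rule mp_AE[OF _ ae]) (use hc in simp)
      moreover have "AE y in M. h ((inv\<^bsub>?G\<^esub> h) y) = y"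
        using AE_space
      proof eventually_elim
        case (elim y)
        thus ?case
          using arg_cong[OF r_inv[OF hc], of "\<lambda>f. f y"] hc by (simp add: mp_mult mp_one)
      qed
      ultimately show ?thesis by eventually_elim simp
    qed
    thus ?thesis using hc by (simp add: aut_class_def)
  qed
  have one: "\<one>\<^bsub>?G\<^esub> \<in> ?N"
  proof -
    have "AE x in M. \<one>\<^bsub>?G\<^esub> x = x" using AE_space by eventually_elim (simp add: mp_one)
    thus ?thesis by (simp add: aut_class_def)
  qed
  have "subgroup ?N ?G"
    by (rule subgroupI) (use one inv mult in \<open>auto simp: aut_class_def\<close>)
  thus ?thesis using conj by (simp add: normal_inv_iff)
qed

theorem group_aut_group: "group (aut_group M)"
  unfolding aut_group_def by (rule normal.factorgroup_is_group[OF normal_null])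

text \<open>The elements of \<open>aut_group M\<close> are exactly the classes modulo almost everywhere equality.\<close>

theorem aut_class_coset:
  assumes T: "T \<in> carrier (mp_group M)"
  shows "aut_class M (\<lambda>x. x) #>\<^bsub>mp_group M\<^esub> T = aut_class M T"
proof -
  interpret group "mp_group M" by (rule group_mp_group)
  let ?G = "mp_group M"
  show ?thesis
  proof (intro Set.set_eqI iffI)
    fix U assume "U \<in> aut_class M (\<lambda>x. x) #>\<^bsub>?G\<^esub> T"
    then obtain n where n: "n \<in> carrier ?G" "AE x in M. n x = x" "U = n \<otimes>\<^bsub>?G\<^esub> T"
      by (auto simp: r_coset_def aut_class_def)
    have "AE x in M. n (T x) = T x" by (rule mp_AE[OF T n(2)])
    hence "AE x in M. U x = T x" using AE_space
      by eventually_elim (simp add: n mp_mult[OF n(1) T])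
    thus "U \<in> aut_class M T" using n T by (simp add: aut_class_def)
  next
    fix U assume "U \<in> aut_class M T"
    hence U: "U \<in> carrier ?G" "AE x in M. U x = T x" by (auto simp: aut_class_def)
    let ?n = "U \<otimes>\<^bsub>?G\<^esub> inv\<^bsub>?G\<^esub> T"
    have "AE x in M. U ((inv\<^bsub>?G\<^esub> T) x) = T ((inv\<^bsub>?G\<^esub> T) x)"
      by (rule mp_AE[OF _ U(2)]) (use T in simp)
    hence "AE x in M. ?n x = x" using AE_space
    proof eventually_elim
      case (elim y)
      thus ?case
        using arg_cong[OF r_inv[OF T], of "\<lambda>f. f y"] T U by (simp add: mp_mult mp_one)
    qed
    hence "?n \<in> aut_class M (\<lambda>x. x)" using T U by (simp add: aut_class_def)
    moreover have "U = ?n \<otimes>\<^bsub>?G\<^esub> T" using T U by (simp add: m_assoc)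
    ultimately show "U \<in> aut_class M (\<lambda>x. x) #>\<^bsub>?G\<^esub> T" by (auto simp: r_coset_def)
  qed
qed

lemma aut_group_carrier: "carrier (aut_group M) = aut_class M ` carrier (mp_group M)"
  unfolding aut_group_def carrier_FactGroup by (rule image_cong) (auto simp: aut_class_coset)

lemma aut_class_eq_iff:
  assumes "S \<in> carrier (mp_group M)" "T \<in> carrier (mp_group M)"
  shows "aut_class M S = aut_class M T \<longleftrightarrow> (AE x in M. S x = T x)"
proof
  assume "aut_class M S = aut_class M T"
  moreover have "S \<in> aut_class M S" using assms by (simp add: aut_class_def)
  ultimately show "AE x in M. S x = T x" by (simp add: aut_class_def)
next
  assume *: "AE x in M. S x = T x"
  have "(AE x in M. U x = S x) \<longleftrightarrow> (AE x in M. U x = T x)" for U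
    by (rule AE_cong_simp[THEN iffD1, OF refl] | use * in \<open>auto elim: AE_mp\<close>)+
  thus "aut_class M S = aut_class M T" by (simp add: aut_class_def)
qed

lemma aut_class_mult:
  assumes S: "S \<in> carrier (mp_group M)" and T: "T \<in> carrier (mp_group M)"
  shows "aut_class M S \<otimes>\<^bsub>aut_group M\<^esub> aut_class M T = aut_class M (\<lambda>x\<in>space M. S (T x))"
proof -
  interpret group "mp_group M" by (rule group_mp_group)
  have "(\<lambda>x\<in>space M. S (T x)) \<in> carrier (mp_group M)"
    using m_closed[OF S T] by (simp add: mp_mult S T)
  thus ?thesis
    using normal.rcos_sum[OF normal_null S T]
    by (simp add: aut_group_def aut_class_coset S T mp_mult)
qed

lemma mp_bijection_extend:
  assumes A: "A \<in> sets M" "AE x in M. x \<in> A" and S: "mp_bijection (restrict_space M A) S"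
  shows "mp_bijection M (\<lambda>x. if x \<in> A then S x else x)"
proof -
  let ?X = "space M" and ?S = "\<lambda>x. if x \<in> A then S x else x"
  let ?I = "\<lambda>x. if x \<in> A then inv_into A S x else x"
  have AX: "A \<subseteq> ?X" using A(1) by (rule sets.sets_into_space)
  hence sp: "space (restrict_space M A) = A" by (auto simp: space_restrict_space)
  have b: "bij_betw S A A" and Sm: "S \<in> restrict_space M A \<rightarrow>\<^sub>M restrict_space M A"
    and Sd: "distr (restrict_space M A) (restrict_space M A) S = restrict_space M A"
    and Im: "inv_into A S \<in> restrict_space M A \<rightarrow>\<^sub>M restrict_space M A"
    using S by (auto simp: mp_bijection_def mp_map_def sp)
  have ext: "(\<lambda>x. if x \<in> A then f x else x) \<in> M \<rightarrow>\<^sub>M M"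
    if "f \<in> restrict_space M A \<rightarrow>\<^sub>M restrict_space M A" for f
  proof -
    have "f \<in> restrict_space M A \<rightarrow>\<^sub>M M"
      using that measurable_restrict_space2_iff by blast
    moreover have "(\<lambda>x. x) \<in> restrict_space M {x. x \<notin> A} \<rightarrow>\<^sub>M M"
      by (rule measurable_restrict_space1) simp
    moreover have "{x \<in> ?X. x \<in> A} \<in> sets M"
      using A(1) AX by (simp add: Int_absorb1 flip: Int_def)
    ultimately show ?thesis by (simp add: measurable_If_restrict_space_iff)
  qed
  have bS: "bij_betw ?S ?X ?X"
  proof -
    have "bij_betw ?S A A" using b by (simp cong: bij_betw_cong)
    moreover have "bij_betw ?S (?X - A) (?X - A)" by (auto simp: bij_betw_def inj_on_def)
    ultimately have "bij_betw ?S (A \<union> (?X - A)) (A \<union> (?X - A))"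
      by (rule bij_betw_combine) auto
    thus ?thesis using AX by (simp add: Un_absorb1)
  qed
  have "distr M M ?S = M"
  proof (rule measure_eqI)
    fix B assume "B \<in> sets (distr M M ?S)"
    hence B: "B \<in> sets M" by simp
    have "emeasure (distr M M ?S) B = emeasure M (?S -` B \<inter> ?X)"
      using B ext[OF Sm] by (simp add: emeasure_distr)
    also have "\<dots> = emeasure M (S -` (B \<inter> A) \<inter> A)"
    proof (rule emeasure_eq_AE)
      show "AE x in M. x \<in> ?S -` B \<inter> ?X \<longleftrightarrow> x \<in> S -` (B \<inter> A) \<inter> A"
        using A(2) AX b by (auto elim!: eventually_mono dest: bij_betwE)
      show "?S -` B \<inter> ?X \<in> sets M" using ext[OF Sm] B by (rule measurable_sets)
      have "S -` (B \<inter> A) \<inter> space (restrict_space M A) \<in> sets (restrict_space M A)"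
        by (rule measurable_sets[OF Sm]) (use A B in \<open>auto simp: sets_restrict_space\<close>)
      thus "S -` (B \<inter> A) \<inter> A \<in> sets M"
        using A by (simp add: sp sets_restrict_space_iff)
    qed
    also have "\<dots> = emeasure (restrict_space M A) (S -` (B \<inter> A) \<inter> space (restrict_space M A))"
      using A by (subst emeasure_restrict_space) (auto simp: sp)
    also have "\<dots> = emeasure (distr (restrict_space M A) (restrict_space M A) S) (B \<inter> A)"
      by (rule emeasure_distr[symmetric, OF Sm]) (use A B in \<open>auto simp: sets_restrict_space\<close>)
    also have "\<dots> = emeasure M (B \<inter> A)"
      unfolding Sd using A by (subst emeasure_restrict_space) auto
    also have "\<dots> = emeasure M B"
      by (rule emeasure_eq_AE) (use A B in auto)
    finally show "emeasure (distr M M ?S) B = emeasure M B" .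
  qed simp
  moreover have "inv_into ?X ?S \<in> M \<rightarrow>\<^sub>M M"
  proof (rule measurable_cong[THEN iffD1, OF _ ext[OF Im]])
    fix y assume y: "y \<in> ?X"
    have "?S (?I y) = y \<and> ?I y \<in> ?X"
      using y AX b bij_betw_inv_into[OF b] by (auto simp: bij_betw_inv_into_right dest: bij_betwE)
    thus "?I y = inv_into ?X ?S y"
      using bij_betw_imp_inj_on[OF bS] by (intro inv_into_f_eq[symmetric]) auto
  qed
  ultimately show ?thesis using bS ext[OF Sm] by (simp add: mp_bijection_def mp_map_def)
qed

lemma orbit_equivalence_aut_class:
  assumes "prob_space M" and oe: "orbit_equivalence M R R' A S"
  shows "aut_class M S \<in> carrier (aut_group M)"
proof -
  interpret prob_space M by fact
  have A: "A \<in> sets M" "AE x in M. x \<in> A"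
    using oe AE_in_set_eq_1 by (auto simp: orbit_equivalence_def emeasure_space_1 emeasure_eq_measure)
  let ?S = "\<lambda>x. if x \<in> A then S x else x" and ?T = "\<lambda>x\<in>space M. if x \<in> A then S x else x"
  have "mp_bijection M ?S"
    by (rule mp_bijection_extend) (use A oe in \<open>auto simp: orbit_equivalence_def\<close>)
  hence T: "?T \<in> carrier (mp_group M)"
    using mp_bijection_cong[of M ?T ?S] by (simp add: mp_carrier)
  have ae: "AE x in M. ?T x = S x" using A(2) AE_space by eventually_elim simp
  have "(AE x in M. U x = S x) \<longleftrightarrow> (AE x in M. U x = ?T x)" for U
    using ae by (auto elim: AE_mp)
  hence "aut_class M S = aut_class M ?T" by (simp add: aut_class_def)
  thus ?thesis using T by (simp add: aut_group_carrier)
qed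

text \<open>In particular, the carrier of \<open>full_group\<close> is a subgroup for orbit equivalence relations.\<close>

lemma subgroup_full_group:
  assumes "equiv (space M) R"
  shows "subgroup (carrier (full_group M R)) (aut_group M)"
proof -
  interpret group "mp_group M" by (rule group_mp_group)
  interpret Aut: group "aut_group M" by (rule group_aut_group)
  let ?G = "mp_group M"
  have sym: "(x, y) \<in> R \<Longrightarrow> (y, x) \<in> R"
    and trans: "(x, y) \<in> R \<Longrightarrow> (y, z) \<in> R \<Longrightarrow> (x, z) \<in> R"
    and refl: "x \<in> space M \<Longrightarrow> (x, x) \<in> R" for x y z
    using assms by (auto simp: equiv_def refl_on_def dest: symD transD)
  have car: "carrier (full_group M R) =
      {aut_class M T | T. T \<in> carrier ?G \<and> (AE x in M. (x, T x) \<in> R)}"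
    by (simp add: full_group_def)
  show ?thesis
  proof (rule Aut.subgroupI)
    show "carrier (full_group M R) \<subseteq> carrier (aut_group M)"
      by (auto simp: car aut_group_carrier)
    have "AE x in M. (x, \<one>\<^bsub>?G\<^esub> x) \<in> R"
      using AE_space by eventually_elim (simp add: mp_one refl)
    thus "carrier (full_group M R) \<noteq> {}" unfolding car using one_closed by blast
  next
    fix a assume "a \<in> carrier (full_group M R)"
    then obtain T where T: "T \<in> carrier ?G" "AE x in M. (x, T x) \<in> R" "a = aut_class M T"
      by (auto simp: car)
    let ?I = "inv\<^bsub>?G\<^esub> T"
    have I: "?I \<in> carrier ?G" using T by simp
    have "aut_class M ?I \<otimes>\<^bsub>aut_group M\<^esub> aut_class M T = aut_class M \<one>\<^bsub>?G\<^esub>"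
      using l_inv[OF T(1)] by (simp add: aut_class_mult[OF I T(1)] mp_mult[OF I T(1)])
    also have "\<dots> = \<one>\<^bsub>aut_group M\<^esub>"
      using normal_null[of M, THEN normal_imp_subgroup] aut_class_coset[OF one_closed, symmetric]
      by (simp add: aut_group_def subgroup.subset coset_mult_one)
    finally have "inv\<^bsub>aut_group M\<^esub> a = aut_class M ?I"
      using T I by (intro Aut.inv_equality) (auto simp: aut_group_carrier)
    moreover have "AE x in M. (x, ?I x) \<in> R"
      using mp_AE[OF I T(2)] AE_space
    proof eventually_elim
      case (elim x)
      have "T (?I x) = x"
        using arg_cong[OF r_inv[OF T(1)], of "\<lambda>f. f x"] elim T by (simp add: mp_mult mp_one)
      thus ?case using elim by (simp add: sym)
    qed
    ultimately show "inv\<^bsub>aut_group M\<^esub> a \<in> carrier (full_group M R)" using I by (auto simp: car)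
  next
    fix a b assume "a \<in> carrier (full_group M R)" "b \<in> carrier (full_group M R)"
    then obtain S T where S: "S \<in> carrier ?G" "AE x in M. (x, S x) \<in> R" "a = aut_class M S"
      and T: "T \<in> carrier ?G" "AE x in M. (x, T x) \<in> R" "b = aut_class M T"
      by (auto simp: car)
    have "AE x in M. (x, (S \<otimes>\<^bsub>?G\<^esub> T) x) \<in> R"
      using mp_AE[OF T(1) S(2)] T(2) AE_space
      by eventually_elim (auto simp: mp_mult[OF S(1) T(1)] intro: trans)
    moreover have "a \<otimes>\<^bsub>aut_group M\<^esub> b = aut_class M (S \<otimes>\<^bsub>?G\<^esub> T)"
      by (simp add: S T aut_class_mult mp_mult)
    ultimately show "a \<otimes>\<^bsub>aut_group M\<^esub> b \<in> carrier (full_group M R)"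
      using m_closed[OF S(1) T(1)] by (auto simp: car)
  qed
qed

lemma (in group_action) equiv_orbit_rel:
  assumes "space M = E" shows "equiv (space M) (orbit_rel G M \<phi>)"
proof (rule equivI)
  show "orbit_rel G M \<phi> \<subseteq> space M \<times> space M"
    using assms element_image by (auto simp: orbit_rel_def orbit_def)
  show "refl_on (space M) (orbit_rel G M \<phi>)"
    using assms by (auto simp: refl_on_def orbit_rel_def orbit_refl)
  have orb: "y \<in> E" if "x \<in> E" "y \<in> orbit G \<phi> x" for x y
    using that element_image by (auto simp: orbit_def)
  show "sym (orbit_rel G M \<phi>)"
  proof (rule symI)
    fix x y assume "(x, y) \<in> orbit_rel G M \<phi>"
    hence "x \<in> E" "y \<in> orbit G \<phi> x" by (simp_all add: orbit_rel_def assms)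
    thus "(y, x) \<in> orbit_rel G M \<phi>"
      using orb[of x y] orbit_sym[of x y] by (simp add: orbit_rel_def assms)
  qed
  show "trans (orbit_rel G M \<phi>)"
  proof (rule transI)
    fix x y z assume "(x, y) \<in> orbit_rel G M \<phi>" "(y, z) \<in> orbit_rel G M \<phi>"
    hence "x \<in> E" "y \<in> orbit G \<phi> x" "y \<in> E" "z \<in> orbit G \<phi> y"
      by (simp_all add: orbit_rel_def assms)
    thus "(x, z) \<in> orbit_rel G M \<phi>"
      using orb[of y z] orbit_trans[of x y z] by (simp add: orbit_rel_def assms)
  qed
qed

end

theory Submission
  imports Defs
begin

text \<open>
  Write \<open>G\<^sub>a\<close> for the subgroup of the elements of a full group that are supported in \<open>a\<close>. By
  ergodicity every measurable set is the support of an involution \<open>\<pi>\<close>, and the group structure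
  determines \<open>G\<^sub>a\<close> from \<open>\<pi>\<close> (Fremlin): let \<open>U\<close> consist of the involutions in the centralizer \<open>C\<close> of
  \<open>\<pi>\<close> that commute with their conjugates by elements of \<open>C\<close>; they are supported in \<open>a\<close> and include
  the restrictions of \<open>\<pi>\<close> to invariant sets. Hence the squares of the elements of the centralizer of
  \<open>U\<close> live off \<open>a\<close>, and \<open>G\<^sub>a\<close> is the centralizer of these squares. So an isomorphism of full groups
  induces an equivariant automorphism of the measure algebra, realized by a point map \<open>S\<close>, whose
  image measure is invariant and therefore equal to the measure.

  Thus for every group element \<open>g\<close> almost every \<open>x\<close> satisfies \<open>S (g x) \<in> H (S x)\<close>. Fubini's theorem
  with respect to Haar measure, for which the orbit relation of \<open>H\<close> must be measurable, exchanges
  the quantifiers, and translation of the exceptional null sets yields a conull set on which \<open>S\<close>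
  maps orbits into orbits.
\<close>

section \<open>Measures from contents\<close>

text \<open>Squares enter because \<open>\<pi>\<close> itself centralizes \<open>U\<close>: inside
  the support, an element of the centralizer of \<open>U\<close> can only send \<open>x\<close> to
  \<open>x\<close> or to \<open>\<pi> x\<close>, and this ambiguity disappears on squaring. Off the
  support, all elements supported there lie in the centralizer of \<open>U\<close>, and their
  squares detect every displacement because each set of positive measure carries a product of two
  involutions whose square is not the identity.

  The obstacle in the second half is that the group may be uncountable, so the null sets belonging
  to the individual \<open>g\<close> cannot simply be collected. Haar measure serves as a
  \<sigma>-finite measure whose null sets are stable under right translation; right invariance fits
  the left action, since the orbit map of \<open>h x\<close> at \<open>g\<close> is that of
  \<open>x\<close> at \<open>g h\<close>. It is built from ratios of covering numbers. For
  measurability of the orbit relation, points are described by the Haar time that their orbits spend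
  in countably many sets; these coordinates are Borel, separate points and are continuous along
  orbits.\<close>

lemma sets_borel_of: "sets (borel_of X) = sigma_sets (topspace X) {U. openin X U}"
  unfolding borel_of_def by (rule sets_measure_of) (auto dest: openin_subset)

lemma space_borel_of [simp]: "space (borel_of X) = topspace X"
  unfolding borel_of_def by (rule space_measure_of) (auto dest: openin_subset)

lemma openin_borel_of: "openin X U \<Longrightarrow> U \<in> sets (borel_of X)"
  by (auto simp: sets_borel_of)

lemma closedin_borel_of: "closedin X U \<Longrightarrow> U \<in> sets (borel_of X)"
  using sets.compl_sets[OF openin_borel_of[of X "topspace X - U"]]
  by (simp add: closedin_def double_diff)

lemma measurable_borel_of:
  assumes "f \<in> space N \<rightarrow> topspace X" "\<And>U. openin X U \<Longrightarrow> f -` U \<inter> space N \<in> sets N"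
  shows "f \<in> N \<rightarrow>\<^sub>M borel_of X"
  unfolding borel_of_def
  by (rule measurable_measure_of) (use assms in \<open>auto dest: openin_subset\<close>)

lemma continuous_map_borel_of:
  assumes "continuous_map X Y f" shows "f \<in> borel_of X \<rightarrow>\<^sub>M borel_of Y"
proof (rule measurable_borel_of)
  show "f \<in> space (borel_of X) \<rightarrow> topspace Y" using assms by (auto simp: continuous_map_def)
  fix U assume "openin Y U"
  hence "openin X {x \<in> topspace X. f x \<in> U}" using assms by (auto simp: continuous_map_def)
  thus "f -` U \<inter> space (borel_of X) \<in> sets (borel_of X)"
    by (auto dest!: openin_borel_of simp: vimage_def Int_def conj_commute)
qed

text \<open>Inner approximation by compact sets fixes the values on open sets, outer approximation
  by open sets then extends them to all sets. The content is not assumed regular, so on a compact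
  set the outer value may differ from \<open>c\<close>.\<close>

definition content_open :: "'a topology \<Rightarrow> ('a set \<Rightarrow> ennreal) \<Rightarrow> 'a set \<Rightarrow> ennreal" where
  "content_open X c U = (SUP K\<in>{K. compactin X K \<and> K \<subseteq> U}. c K)"

definition content_outer :: "'a topology \<Rightarrow> ('a set \<Rightarrow> ennreal) \<Rightarrow> 'a set \<Rightarrow> ennreal" where
  "content_outer X c E = (INF U\<in>{U. openin X U \<and> E \<subseteq> U}. content_open X c U)"

lemma content_open_upper: "compactin X K \<Longrightarrow> K \<subseteq> U \<Longrightarrow> c K \<le> content_open X c U"
  unfolding content_open_def by (rule SUP_upper) auto

lemma content_open_mono: "U \<subseteq> V \<Longrightarrow> content_open X c U \<le> content_open X c V"
  unfolding content_open_def by (rule SUP_subset_mono) auto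

lemma content_outer_lower: "openin X U \<Longrightarrow> E \<subseteq> U \<Longrightarrow> content_outer X c E \<le> content_open X c U"
  unfolding content_outer_def by (rule INF_lower) auto

lemma content_outer_mono: "E \<subseteq> F \<Longrightarrow> content_outer X c E \<le> content_outer X c F"
  unfolding content_outer_def by (rule INF_superset_mono) auto

lemma content_outer_open: "openin X U \<Longrightarrow> content_outer X c U = content_open X c U"
  by (intro antisym content_outer_lower)
    (auto simp: content_outer_def intro!: INF_greatest content_open_mono)

text \<open>\<open>K - U\<close> and \<open>K - V\<close> are disjoint compact sets; removing from
  \<open>K\<close> disjoint open neighbourhoods of them leaves two compact pieces that together
  still make up \<open>K\<close>.\<close>

lemma compactin_split:
  assumes X: "Hausdorff_space X" and K: "compactin X K" "K \<subseteq> U \<union> V" and o: "openin X U" "openin X V"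
  obtains K1 K2 where "compactin X K1" "compactin X K2" "K = K1 \<union> K2" "K1 \<subseteq> U" "K2 \<subseteq> V"
proof -
  have diff: "compactin X (K - W)" if "openin X W" for W
  proof -
    have "K \<inter> (topspace X - W) = K - W" using compactin_subset_topspace[OF K(1)] by auto
    thus ?thesis
      using compact_Int_closedin[OF K(1) closedin_diff[OF closedin_topspace that]] by simp
  qed
  have "disjnt (K - U) (K - V)" using K(2) by (auto simp: disjnt_def)
  then obtain P Q where PQ: "openin X P" "openin X Q" "K - U \<subseteq> P" "K - V \<subseteq> Q" "disjnt P Q"
    using X diff o unfolding Hausdorff_space_compact_sets by metis
  show thesis
    by (rule that[of "K - P" "K - Q"]) (use PQ diff in \<open>auto simp: disjnt_def\<close>)
qed

text \<open>Repeated splitting writes \<open>K\<close> as a union of compact pieces, one inside each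
  open set; this transfers subadditivity from \<open>c\<close> to
  \<open>content_open\<close>.\<close>

lemma content_compact_Un:
  assumes X: "Hausdorff_space X"
    and sub: "\<And>K L. compactin X K \<Longrightarrow> compactin X L \<Longrightarrow> c (K \<union> L) \<le> c K + (c L :: ennreal)"
    and empty: "c {} = 0" and F: "finite F"
    and o: "\<And>n. n \<in> F \<Longrightarrow> openin X (U n)"
    and K: "compactin X K" "K \<subseteq> (\<Union>n\<in>F. U n)"
  shows "c K \<le> (\<Sum>n\<in>F. content_open X c (U n))"
  using F o K
proof (induction F arbitrary: K rule: finite_induct)
  case empty thus ?case using assms(3) by simp
next
  case (insert n F)
  obtain K1 K2 where K12: "compactin X K1" "compactin X K2" "K = K1 \<union> K2"
      "K1 \<subseteq> U n" "K2 \<subseteq> (\<Union>n\<in>F. U n)"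
  proof (rule compactin_split[OF X, of K "U n" "\<Union>n\<in>F. U n"])
    show "openin X (\<Union>n\<in>F. U n)" by (rule openin_Union) (use insert in auto)
  qed (use insert in auto)
  have "c K \<le> c K1 + c K2" using sub K12 by simp
  also have "\<dots> \<le> content_open X c (U n) + (\<Sum>n\<in>F. content_open X c (U n))"
    by (intro add_mono content_open_upper insert.IH) (use K12 insert in auto)
  finally show ?case using insert by simp
qed

text \<open>Caratheodory's construction. Compactness turns a countable open cover into a finite one,
  so subadditivity of \<open>c\<close> yields a countably subadditive outer measure; superadditivity
  on disjoint compact sets makes open sets, and hence all Borel sets, measurable for it.\<close>

theorem content_extension:
  assumes X: "Hausdorff_space X"
    and sub: "\<And>K L. compactin X K \<Longrightarrow> compactin X L \<Longrightarrow> c (K \<union> L) \<le> c K + (c L :: ennreal)"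
    and add: "\<And>K L. compactin X K \<Longrightarrow> compactin X L \<Longrightarrow> K \<inter> L = {} \<Longrightarrow> c K + c L \<le> c (K \<union> L)"
    and empty: "c {} = 0"
  shows "\<exists>\<nu>. sets \<nu> = sets (borel_of X) \<and> (\<forall>B\<in>sets (borel_of X). emeasure \<nu> B = content_outer X c B)"
proof -
  let ?O = "topspace X" and ?m = "content_outer X c" and ?l = "content_open X c"
  interpret P: sigma_algebra ?O "Pow ?O" by (rule sigma_algebra_Pow)
  have l_empty: "?l {} = 0" using empty by (auto simp: content_open_def)
  have pos: "positive (Pow ?O) ?m"
    using content_outer_open[of X "{}"] by (simp add: positive_def l_empty)
  have inc: "increasing (Pow ?O) ?m" by (auto simp: increasing_def content_outer_mono)
  have l_csub: "?l (\<Union>n. U n) \<le> (\<Sum>n. ?l (U n))" if o: "\<And>n::nat. openin X (U n)" for U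
    unfolding content_open_def[of X c "\<Union>n. U n"]
  proof (rule SUP_least, clarify)
    fix K assume K: "compactin X K" "K \<subseteq> (\<Union>n. U n)"
    obtain \<F> where F: "finite \<F>" "\<F> \<subseteq> range U" "K \<subseteq> \<Union>\<F>"
      using K o unfolding compactin_def by (metis (no_types, lifting) imageE)
    then obtain F where F: "finite F" "K \<subseteq> (\<Union>n\<in>F. U n)"
      by (metis finite_subset_image)
    have "c K \<le> (\<Sum>n\<in>F. ?l (U n))"
      by (rule content_compact_Un[OF X sub empty F(1) o K(1) F(2)])
    also have "\<dots> \<le> (\<Sum>n. ?l (U n))" by (rule sum_le_suminf) (auto simp: F)
    finally show "c K \<le> (\<Sum>n. ?l (U n))" .
  qed
  have "countably_subadditive (Pow ?O) ?m"
    unfolding countably_subadditive_def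
  proof (intro allI impI)
    fix A :: "nat \<Rightarrow> 'a set" assume A: "range A \<subseteq> Pow ?O"
    show "?m (\<Union>i. A i) \<le> (\<Sum>i. ?m (A i))"
    proof (cases "\<exists>i. ?m (A i) = \<infinity>")
      case True
      then obtain i where i: "?m (A i) = \<infinity>" by blast
      have "?m (A i) \<le> (\<Sum>i. ?m (A i))" using sum_le_suminf[of "\<lambda>i. ?m (A i)" "{i}"] by auto
      thus ?thesis using i by (simp add: top_unique)
    next
      case False
      show ?thesis
      proof (rule ennreal_le_epsilon)
        fix e :: real assume e: "0 < e"
        have "\<exists>U. openin X U \<and> A i \<subseteq> U \<and> ?l U \<le> ?m (A i) + ennreal (e * (1/2)^Suc i)" for i
        proof -
          have "?m (A i) < ?m (A i) + ennreal (e * (1/2)^Suc i)"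
            using False e ennreal_add_left_cancel_less[of "?m (A i)" 0 "ennreal (e * (1/2)^Suc i)"]
            by (auto simp: less_top)
          then obtain U where "U \<in> {U. openin X U \<and> A i \<subseteq> U}"
              "?l U < ?m (A i) + ennreal (e * (1/2)^Suc i)"
            unfolding content_outer_def INF_less_iff by blast
          thus ?thesis by (auto intro: less_imp_le)
        qed
        then obtain U where U: "\<And>i. openin X (U i)" "\<And>i. A i \<subseteq> U i"
            "\<And>i. ?l (U i) \<le> ?m (A i) + ennreal (e * (1/2)^Suc i)" by metis
        have "?m (\<Union>i. A i) \<le> ?l (\<Union>i. U i)"
          by (rule content_outer_lower) (use U in auto)
        also have "\<dots> \<le> (\<Sum>i. ?l (U i))" by (rule l_csub) (rule U)
        also have "\<dots> \<le> (\<Sum>i. ?m (A i) + ennreal (e * (1/2)^Suc i))"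
          by (rule suminf_le) (use U in auto)
        also have "\<dots> = (\<Sum>i. ?m (A i)) + (\<Sum>i. ennreal (e * (1/2)^Suc i))"
          by (rule suminf_add[symmetric]) auto
        also have "(\<Sum>i. ennreal (e * (1/2)^Suc i)) = ennreal e"
          using sums_mult[OF power_half_series, of e] e
          by (intro suminf_ennreal_eq) auto
        finally show "?m (\<Union>i. A i) \<le> (\<Sum>i. ?m (A i)) + ennreal e" .
      qed
    qed
  qed
  hence om: "outer_measure_space (Pow ?O) ?m" using pos inc by (simp add: outer_measure_space_def)
  let ?L = "lambda_system ?O (Pow ?O) ?m"
  have ms: "measure_space ?O ?L ?m" by (rule P.caratheodory_lemma[OF om])
  have openL: "U \<in> ?L" if U: "openin X U" for U
  proof -
    \<comment> \<open>A compact \<open>K\<close> inside \<open>A \<inter> U\<close> leaves the open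
      set \<open>A - K\<close>, which contains \<open>A - U\<close>; compact subsets of
      \<open>A - K\<close> are disjoint from \<open>K\<close>, so superadditivity applies to pairs
      \<open>K\<close>, \<open>L\<close> inside \<open>A\<close>.\<close>
    have l_split: "?l (A \<inter> U) + ?m (A - U) \<le> ?l A" if A: "openin X A" for A
      unfolding content_open_def[of X c "A \<inter> U"]
    proof (subst ennreal_SUP_add_left[symmetric])
      show "{K. compactin X K \<and> K \<subseteq> A \<inter> U} \<noteq> {}" by auto
      show "(SUP K\<in>{K. compactin X K \<and> K \<subseteq> A \<inter> U}. c K + ?m (A - U)) \<le> ?l A"
      proof (rule SUP_least, clarify)
        fix K assume K: "compactin X K" "K \<subseteq> A \<inter> U"
        have "openin X (A - K)"
          using A K compactin_imp_closedin[OF X] by blast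
        hence "?m (A - U) \<le> ?l (A - K)" by (rule content_outer_lower) (use K in auto)
        hence "c K + ?m (A - U) \<le> c K + ?l (A - K)" by (rule add_left_mono)
        also have "\<dots> = (SUP L\<in>{L. compactin X L \<and> L \<subseteq> A - K}. c K + c L)"
          unfolding content_open_def by (rule ennreal_SUP_add_right) auto
        also have "\<dots> \<le> ?l A"
        proof (rule SUP_least, clarify)
          fix L assume L: "compactin X L" "L \<subseteq> A - K"
          have "c K + c L \<le> c (K \<union> L)" by (rule add) (use K L in auto)
          also have "\<dots> \<le> ?l A"
            by (rule content_open_upper) (use K L in \<open>auto intro: compactin_Un\<close>)
          finally show "c K + c L \<le> ?l A" .
        qed
        finally show "c K + ?m (A - U) \<le> ?l A" .
      qed
    qed
    have "?m (E \<inter> U) + ?m (E - U) \<le> ?m E" for E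
      unfolding content_outer_def[of X c E]
    proof (rule INF_greatest, clarify)
      fix A assume A: "openin X A" "E \<subseteq> A"
      have "?m (E \<inter> U) + ?m (E - U) \<le> ?l (A \<inter> U) + ?m (A - U)"
        by (intro add_mono content_outer_lower content_outer_mono) (use A U in auto)
      also note l_split[OF A(1)]
      finally show "?m (E \<inter> U) + ?m (E - U) \<le> ?l A" .
    qed
    moreover have "?m E \<le> ?m (E \<inter> U) + ?m (E - U)" if "E \<subseteq> ?O" for E
    proof -
      have "subadditive (Pow ?O) ?m"
        using om P.countably_subadditive_subadditive pos by (auto simp: outer_measure_space_def)
      from subadditiveD[OF this, of "E \<inter> U" "E - U"] that show ?thesis
        by (metis Int_Diff_Un Int_Diff_disjoint PowI Diff_subset dual_order.trans inf_le1)
    qed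
    ultimately show ?thesis
      using openin_subset[OF U]
      by (auto simp: P.lambda_system_eq intro!: antisym)
  qed
  have "sigma_algebra ?O ?L" using ms by (simp add: measure_space_def)
  hence "sigma_sets ?O {U. openin X U} \<subseteq> ?L"
    by (rule sigma_algebra.sigma_sets_subset) (use openL in auto)
  hence sub: "sets (borel_of X) \<subseteq> ?L" by (simp add: sets_borel_of)
  have ms': "measure_space ?O (sets (borel_of X)) ?m"
    by (rule measure_down[OF ms _ sub]) (metis sets.sigma_algebra_axioms space_borel_of)
  let ?\<nu> = "measure_of ?O (sets (borel_of X)) ?m"
  have s: "sets ?\<nu> = sets (borel_of X)" using sets.sigma_sets_eq[of "borel_of X"] sets.space_closed[of "borel_of X"] by simp
  moreover have "emeasure ?\<nu> B = ?m B" if "B \<in> sets (borel_of X)" for B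
    by (rule emeasure_measure_of_sigma) (use ms' that in \<open>auto simp: measure_space_def\<close>)
  ultimately show ?thesis by blast
qed

section \<open>Haar measure on Polish locally compact groups\<close>

lemma polish_metric:
  assumes "polish_topology X"
  obtains d C where "Metric_space (topspace X) d" "Metric_space.mtopology (topspace X) d = X"
    "Metric_space.mcomplete (topspace X) d" "countable C" "C \<subseteq> topspace X"
    "\<And>x r. x \<in> topspace X \<Longrightarrow> 0 < r \<Longrightarrow> \<exists>q\<in>C. d x q < r"
proof -
  obtain S d where S: "Metric_space S d" "Metric_space.mcomplete S d" "X = Metric_space.mtopology S d"
    using assms by (auto simp: polish_topology_def completely_metrizable_space_def)
  have SX: "S = topspace X" using Metric_space.topspace_mtopology[OF S(1)] S(3) by simp
  obtain C where C: "countable C" "C \<subseteq> topspace X" "X closure_of C = topspace X"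
    using assms by (auto simp: polish_topology_def separable_space_def)
  interpret Metric_space "topspace X" d using S(1) unfolding SX .
  have X: "mtopology = X" using S(3)[symmetric] unfolding SX .
  have "\<exists>q\<in>C. d x q < r" if "x \<in> topspace X" "0 < r" for x r
  proof -
    have "x \<in> mtopology closure_of C" using that(1) C(3) X by simp
    hence "\<exists>y\<in>C. y \<in> mball x r" using that(2) unfolding metric_closure_of by blast
    thus ?thesis by auto
  qed
  thus thesis using that[OF Metric_space_axioms X _ C(1,2)] S(2) unfolding SX by blast
qed

lemma (in Metric_space) limitin_if_in_balls:
  assumes l: "l \<in> M" and s: "\<And>n. s n \<in> mball l (inverse (Suc n))"
  shows "limitin mtopology s l sequentially"
  unfolding limit_metric_sequentially
proof (intro conjI allI impI)
  fix e :: real assume "0 < e"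
  then obtain N where N: "inverse (Suc N) < e" using reals_Archimedean by blast
  have "s n \<in> M \<and> d (s n) l < e" if "N \<le> n" for n
  proof -
    have "inverse (real (Suc n)) \<le> inverse (Suc N)" using that by (simp add: field_simps)
    moreover have "s n \<in> M" "d l (s n) < inverse (Suc n)"
      using s[of n] by (simp_all del: of_nat_Suc)
    ultimately show ?thesis using N commute[of "s n" l] by linarith
  qed
  thus "\<exists>N. \<forall>n\<ge>N. s n \<in> M \<and> d (s n) l < e" by blast
qed (rule l)

text \<open>Tychonoff's theorem in the form of a limit: the sequence stays in a product of compact
  intervals and has a cluster point there. Convergence is along a filter finer than
  \<open>sequentially\<close> and not along a subsequence, because the index type (later the sets of
  group elements) is uncountable in general.\<close>

lemma product_cluster_filter:
  fixes a :: "nat \<Rightarrow> 'i \<Rightarrow> real"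
  assumes "\<And>n i. 0 \<le> a n i" "\<And>n i. a n i \<le> c i"
  shows "\<exists>F L. F \<noteq> bot \<and> F \<le> sequentially \<and> (\<forall>i. ((\<lambda>n. a n i) \<longlongrightarrow> L i) F)"
proof -
  let ?C = "Pi\<^sub>E UNIV (\<lambda>i. {0..c i})"
  have "compactin (product_topology (\<lambda>i. euclidean) UNIV) ?C"
    by (subst compactin_PiE) (simp add: compactin_euclidean_iff)
  hence C: "compact ?C" by (simp add: euclidean_product_topology compactin_euclidean_iff)
  have "filtermap a sequentially \<noteq> bot" by (simp add: filtermap_bot_iff)
  moreover have "\<forall>\<^sub>F y in filtermap a sequentially. y \<in> ?C"
    using assms by (simp add: eventually_filtermap PiE_UNIV_domain)
  ultimately obtain x where x: "inf (nhds x) (filtermap a sequentially) \<noteq> bot"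
    using C unfolding compact_filter by blast
  \<comment> \<open>Preimages of neighbourhoods of the cluster point, intersected with tails; that
    \<open>x\<close> is a cluster point says that these sets are nonempty.\<close>
  let ?F = "inf (filtercomap a (nhds x)) sequentially"
  have "?F \<noteq> bot"
  proof
    assume "?F = bot"
    hence "eventually (\<lambda>_. False) ?F" by simp
    then obtain P Q where PQ: "eventually P (filtercomap a (nhds x))" "eventually Q sequentially"
        "\<And>n. P n \<Longrightarrow> Q n \<Longrightarrow> False" unfolding eventually_inf by blast
    obtain P' where P': "eventually P' (nhds x)" "\<And>n. P' (a n) \<Longrightarrow> P n"
      using PQ(1) unfolding eventually_filtercomap by blast
    have "eventually (\<lambda>y. \<not> P' y) (filtermap a sequentially)"
      unfolding eventually_filtermap using PQ(2) by eventually_elim (use PQ P' in blast)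
    hence "eventually (\<lambda>_. False) (inf (nhds x) (filtermap a sequentially))"
      using P'(1) unfolding eventually_inf by blast
    thus False using x by (simp add: trivial_limit_def)
  qed
  moreover have "((\<lambda>n. a n i) \<longlongrightarrow> x i) ?F" for i
  proof -
    have "filterlim a (nhds x) (filtercomap a (nhds x))" by (rule filterlim_filtercomap)
    hence "filterlim a (nhds x) ?F" by (rule filterlim_mono) auto
    hence "eventually (\<lambda>n. a n \<in> (\<lambda>f. f i) -` S) ?F" if "open S" "x i \<in> S" for S
      by (rule topological_tendstoD)
        (use that in \<open>auto intro!: open_vimage continuous_on_product_coordinates\<close>)
    thus ?thesis by (intro topological_tendstoI) (simp add: vimage_def)
  qed
  ultimately show ?thesis by (intro exI[of _ ?F] exI[of _ x]) auto
qed

section \<open>Sequences and right translates in a Polish locally compact group\<close>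

context polish_lc_group
begin

lemma metric: obtains d where "Metric_space (carrier G) d" "Metric_space.mtopology (carrier G) d = \<tau>"
  by (rule polish_metric[OF polish], unfold topspace_eq) (rule that)

lemma Hausdorff: "Hausdorff_space \<tau>"
  using polish by (auto simp: polish_topology_def
      intro: completely_metrizable_imp_metrizable_space metrizable_imp_Hausdorff_space)

lemma limitin_mult:
  assumes "limitin \<tau> f a F" "limitin \<tau> g b F"
  shows "limitin \<tau> (\<lambda>n. f n \<otimes> g n) (a \<otimes> b) F"
proof -
  have "limitin (prod_topology \<tau> \<tau>) (\<lambda>n. (f n, g n)) (a, b) F"
    using assms by (simp add: limitin_pairwise o_def)
  from continuous_map_limit[OF continuous_mult this] show ?thesis by (simp add: o_def)
qed

lemma limitin_inv: "limitin \<tau> f a F \<Longrightarrow> limitin \<tau> (\<lambda>n. inv (f n)) (inv a) F"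
  using continuous_map_limit[OF continuous_inv, of f a F] by (simp add: o_def)

lemma compact_subsequence:
  assumes "compactin \<tau> K" "\<And>n::nat. s n \<in> K"
  obtains l r where "l \<in> K" "strict_mono r" "limitin \<tau> (s \<circ> r) l sequentially"
proof -
  obtain d where d: "Metric_space (carrier G) d" "Metric_space.mtopology (carrier G) d = \<tau>"
    by (rule metric)
  show thesis
    using Metric_space.compactin_sequentially[OF d(1), of K] assms that unfolding d(2) by blast
qed

lemma closed_sequentially:
  assumes "closedin \<tau> C" "limitin \<tau> s l sequentially" "\<And>n. s n \<in> C" shows "l \<in> C"
  using limitin_closedin[OF assms(2,1)] assms(3) by simp

text \<open>The last property is the form in which shrinking to the identity is used later:
  arbitrary choices of points from \<open>U n\<close> converge to it.\<close>

lemma neighbourhood_sequence: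
  obtains U where "\<And>n::nat. openin \<tau> (U n)" "\<And>n. \<one> \<in> U n" "\<And>m n. m \<le> n \<Longrightarrow> U n \<subseteq> U m"
    "\<And>s. (\<And>n. s n \<in> U n) \<Longrightarrow> limitin \<tau> s \<one> sequentially"
proof -
  obtain d where d: "Metric_space (carrier G) d" "Metric_space.mtopology (carrier G) d = \<tau>"
    by (rule metric)
  interpret d: Metric_space "carrier G" d by (rule d)
  show thesis
  proof (rule that[of "\<lambda>n. d.mball \<one> (inverse (Suc n))"])
    fix m n :: nat assume "m \<le> n"
    hence "inverse (real (Suc n)) \<le> inverse (Suc m)" by (simp add: field_simps)
    thus "d.mball \<one> (inverse (Suc n)) \<subseteq> d.mball \<one> (inverse (Suc m))"
      by (rule d.mball_subset_concentric)
  next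
    fix s assume "\<And>n. s n \<in> d.mball \<one> (inverse (Suc n))"
    thus "limitin \<tau> s \<one> sequentially" using d.limitin_if_in_balls[OF one_closed] d(2) by simp
  qed (use d in auto)
qed

lemma continuous_right_mult: "x \<in> carrier G \<Longrightarrow> continuous_map \<tau> \<tau> (\<lambda>g. g \<otimes> x)"
  using continuous_map_compose[of \<tau> "prod_topology \<tau> \<tau>" "\<lambda>g. (g, x)", OF _ continuous_mult]
  by (simp add: o_def continuous_map_pairedI topspace_eq)

lemma r_coset_eq_image: "U #> x = (\<lambda>g. g \<otimes> x) ` U"
  by (auto simp: r_coset_def)

lemma r_coset_eq_preimage:
  assumes "U \<subseteq> carrier G" "x \<in> carrier G" shows "U #> x = {g \<in> carrier G. g \<otimes> inv x \<in> U}"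
proof safe
  fix g assume "g \<in> carrier G" "g \<otimes> inv x \<in> U"
  thus "g \<in> U #> x" unfolding r_coset_eq_image
    using assms by (intro image_eqI[of _ _ "g \<otimes> inv x"]) (auto simp: m_assoc)
qed (use assms in \<open>auto simp: r_coset_eq_image m_assoc subset_iff\<close>)

lemma openin_carrier: "openin \<tau> U \<Longrightarrow> U \<subseteq> carrier G"
  using openin_subset topspace_eq by blast

lemma compactin_carrier: "compactin \<tau> U \<Longrightarrow> U \<subseteq> carrier G"
  using compactin_subset_topspace topspace_eq by blast

lemma openin_r_coset: "openin \<tau> U \<Longrightarrow> x \<in> carrier G \<Longrightarrow> openin \<tau> (U #> x)"
  using continuous_right_mult[of "inv x"]
  by (simp add: r_coset_eq_preimage openin_carrier continuous_map_def topspace_eq)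

lemma compactin_r_coset: "compactin \<tau> K \<Longrightarrow> x \<in> carrier G \<Longrightarrow> compactin \<tau> (K #> x)"
  unfolding r_coset_eq_image by (rule image_compactin[OF _ continuous_right_mult])

lemma r_coset_cancel: "U \<subseteq> carrier G \<Longrightarrow> x \<in> carrier G \<Longrightarrow> U #> x #> inv x = U"
  by (simp add: coset_mult_assoc coset_mult_one)

lemma r_coset_cancel': "U \<subseteq> carrier G \<Longrightarrow> x \<in> carrier G \<Longrightarrow> U #> inv x #> x = U"
  by (simp add: coset_mult_assoc coset_mult_one)

section \<open>Covering numbers by right translates\<close>

definition covered_by :: "'g set \<Rightarrow> 'g set \<Rightarrow> 'g set \<Rightarrow> bool" where
  "covered_by U K F \<longleftrightarrow> finite F \<and> F \<subseteq> carrier G \<and> K \<subseteq> (\<Union>x\<in>F. U #> x)"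

text \<open>Haar's index of \<open>K\<close> with respect to \<open>U\<close>. Covering by right
  translates makes it invariant under right translation of \<open>K\<close>. For compact
  \<open>K\<close> and open \<open>U\<close> containing the identity a finite cover exists, so that
  the minimum is attained; see \<open>ncov_witness\<close>.\<close>

definition ncov :: "'g set \<Rightarrow> 'g set \<Rightarrow> nat" where
  "ncov U K = (LEAST n. \<exists>F. covered_by U K F \<and> card F = n)"

lemma ncov_le: "covered_by U K F \<Longrightarrow> ncov U K \<le> card F"
  unfolding ncov_def by (rule Least_le) blast

lemma ncov_witness:
  assumes "compactin \<tau> K" "openin \<tau> U" "\<one> \<in> U"
  obtains F where "covered_by U K F" "card F = ncov U K"
proof -
  have KG: "K \<subseteq> carrier G" using compactin_carrier[OF assms(1)] .
  have "\<exists>\<F>. finite \<F> \<and> \<F> \<subseteq> (\<lambda>x. U #> x) ` K \<and> K \<subseteq> \<Union>\<F>"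
  proof (rule assms(1)[unfolded compactin_def, THEN conjunct2, rule_format], intro conjI ballI)
    fix V assume "V \<in> (\<lambda>x. U #> x) ` K" thus "openin \<tau> V" using openin_r_coset assms KG by auto
  next
    have "x \<in> U #> x" if "x \<in> K" for x
      using that assms(3) KG by (auto simp: r_coset_eq_image intro!: image_eqI[of _ _ \<one>])
    thus "K \<subseteq> \<Union> ((\<lambda>x. U #> x) ` K)" by blast
  qed
  then obtain F where "finite F" "F \<subseteq> K" "K \<subseteq> (\<Union>x\<in>F. U #> x)"
    by (metis finite_subset_image)
  hence "covered_by U K F" using KG by (auto simp: covered_by_def)
  hence "\<exists>F'. covered_by U K F' \<and> card F' = card F" by blast
  hence "\<exists>F'. covered_by U K F' \<and> card F' = ncov U K" unfolding ncov_def by (rule LeastI)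
  thus thesis using that by blast
qed

lemma ncov_mono:
  assumes "compactin \<tau> L" "openin \<tau> U" "\<one> \<in> U" "K \<subseteq> L" shows "ncov U K \<le> ncov U L"
proof -
  obtain F where "covered_by U L F" "card F = ncov U L" by (rule ncov_witness[OF assms(1-3)])
  thus ?thesis using ncov_le[of U K F] assms(4) by (auto simp: covered_by_def)
qed

lemma ncov_Un_le:
  assumes K: "compactin \<tau> K" "compactin \<tau> L" and U: "openin \<tau> U" "\<one> \<in> U"
  shows "ncov U (K \<union> L) \<le> ncov U K + ncov U L"
proof -
  obtain F where F: "covered_by U K F" "card F = ncov U K" by (rule ncov_witness[OF K(1) U])
  obtain E where E: "covered_by U L E" "card E = ncov U L" by (rule ncov_witness[OF K(2) U])
  have "covered_by U (K \<union> L) (F \<union> E)" using E(1) F(1) unfolding covered_by_def by blast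
  from ncov_le[OF this] show ?thesis using card_Un_le[of F E] E F by linarith
qed

text \<open>No translate used in an optimal cover of the union meets both sets, so the translates
  that meet \<open>K\<close> and those that meet \<open>L\<close> form disjoint subfamilies, each
  covering its own set.\<close>

lemma ncov_Un_ge:
  assumes K: "compactin \<tau> K" "compactin \<tau> L" and U: "openin \<tau> U" "\<one> \<in> U"
    and sep: "\<And>x. x \<in> carrier G \<Longrightarrow> (U #> x) \<inter> K = {} \<or> (U #> x) \<inter> L = {}"
  shows "ncov U K + ncov U L \<le> ncov U (K \<union> L)"
proof -
  obtain F where F: "covered_by U (K \<union> L) F" "card F = ncov U (K \<union> L)"
    by (rule ncov_witness[OF compactin_Un[OF K] U])
  let ?A = "{x \<in> F. (U #> x) \<inter> K \<noteq> {}}" and ?B = "{x \<in> F. (U #> x) \<inter> L \<noteq> {}}"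
  have F': "finite F" "F \<subseteq> carrier G" "K \<union> L \<subseteq> (\<Union>x\<in>F. U #> x)"
    using F(1) by (auto simp: covered_by_def)
  have "K \<subseteq> (\<Union>x\<in>?A. U #> x)" "L \<subseteq> (\<Union>x\<in>?B. U #> x)" using F'(3) by blast+
  hence "covered_by U K ?A" "covered_by U L ?B" using F'(1,2) unfolding covered_by_def by auto
  hence "ncov U K + ncov U L \<le> card ?A + card ?B" by (intro add_mono ncov_le)
  also have "\<dots> = card (?A \<union> ?B)"
  proof (rule card_Un_disjoint[symmetric])
    show "?A \<inter> ?B = {}" using F sep unfolding covered_by_def by blast
  qed (use F in \<open>auto simp: covered_by_def\<close>)
  also have "\<dots> \<le> card F" using F by (intro card_mono) (auto simp: covered_by_def)
  finally show ?thesis using F by simp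
qed

text \<open>Multiplying the centres of a cover by \<open>x\<close> covers \<open>K #> x\<close>; the
  reverse inequality is the same statement for \<open>inv x\<close>.\<close>

lemma ncov_r_coset:
  assumes K: "compactin \<tau> K" and U: "openin \<tau> U" "\<one> \<in> U" and x: "x \<in> carrier G"
  shows "ncov U (K #> x) = ncov U K"
proof -
  have *: "ncov U (K #> x) \<le> ncov U K" if K: "compactin \<tau> K" and x: "x \<in> carrier G" for K x
  proof -
    obtain F where F: "covered_by U K F" "card F = ncov U K" by (rule ncov_witness[OF K U])
    have "covered_by U (K #> x) ((\<lambda>g. g \<otimes> x) ` F)"
      unfolding covered_by_def
    proof (intro conjI subsetI)
      fix y assume "y \<in> K #> x"
      then obtain k where k: "k \<in> K" "y = k \<otimes> x" by (auto simp: r_coset_eq_image)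
      then obtain f where f: "f \<in> F" "k \<in> U #> f" using F(1) by (auto simp: covered_by_def)
      then obtain u where u: "u \<in> U" "k = u \<otimes> f" by (auto simp: r_coset_eq_image)
      have "u \<in> carrier G" "f \<in> carrier G"
        using u f F(1) openin_carrier[OF U(1)] by (auto simp: covered_by_def)
      hence "y = u \<otimes> (f \<otimes> x)" using k u x by (simp add: m_assoc)
      thus "y \<in> (\<Union>g\<in>(\<lambda>g. g \<otimes> x) ` F. U #> g)" using u f by (auto simp: r_coset_eq_image)
    qed (use F x in \<open>auto simp: covered_by_def\<close>)
    from ncov_le[OF this] F show ?thesis
      using card_image_le[of F "\<lambda>g. g \<otimes> x"] by (auto simp: covered_by_def)
  qed
  have "ncov U (K #> x #> inv x) \<le> ncov U (K #> x)"
    using * compactin_r_coset[OF K x] x by blast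
  thus ?thesis using *[OF K x] compactin_carrier[OF K] x by (simp add: r_coset_cancel)
qed

text \<open>Each of the \<open>ncov V K\<close> translates of \<open>V\<close> is contained in a
  translate of \<open>L\<close>, which \<open>ncov U L\<close> translates of \<open>U\<close> cover.
  After division by \<open>ncov U L\<close> this bounds the normalized index independently of
  \<open>U\<close>.\<close>

lemma ncov_le_mult:
  assumes K: "compactin \<tau> K" "compactin \<tau> L" and U: "openin \<tau> U" "\<one> \<in> U"
    and V: "openin \<tau> V" "\<one> \<in> V" "V \<subseteq> L"
  shows "ncov U K \<le> ncov V K * ncov U L"
proof -
  obtain F where F: "covered_by V K F" "card F = ncov V K" by (rule ncov_witness[OF K(1) V(1,2)])
  obtain E where E: "covered_by U L E" "card E = ncov U L" by (rule ncov_witness[OF K(2) U])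
  let ?H = "(\<lambda>(y, x). x \<otimes> y) ` (F \<times> E)"
  have "covered_by U K ?H"
    unfolding covered_by_def
  proof (intro conjI subsetI)
    fix k assume "k \<in> K"
    then obtain y v where y: "y \<in> F" "v \<in> V" "k = v \<otimes> y"
      using F(1) by (auto simp: covered_by_def r_coset_eq_image)
    have "v \<in> L" using y V(3) by blast
    hence "v \<in> (\<Union>x\<in>E. U #> x)" using E(1) unfolding covered_by_def by blast
    then obtain x u where x: "x \<in> E" "u \<in> U" "v = u \<otimes> x" unfolding r_coset_eq_image by blast
    have "x \<in> carrier G" "u \<in> carrier G" "y \<in> carrier G"
      using x y E(1) F(1) openin_carrier[OF U(1)] unfolding covered_by_def by blast+
    hence "k = u \<otimes> (x \<otimes> y)"
      using x(3) y(3) by (simp add: m_assoc)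
    hence "k \<in> U #> (x \<otimes> y)" using x(2) by (auto simp: r_coset_eq_image)
    thus "k \<in> (\<Union>g\<in>?H. U #> g)" using x(1) y(1) by blast
  qed (use E F in \<open>auto simp: covered_by_def\<close>)
  hence "ncov U K \<le> card ?H" by (rule ncov_le)
  also have "\<dots> \<le> card (F \<times> E)" using E F by (intro card_image_le) (auto simp: covered_by_def)
  finally show ?thesis using E F by (simp add: card_cartesian_product)
qed

lemma ncov_pos:
  assumes "compactin \<tau> K" "openin \<tau> U" "\<one> \<in> U" "K \<noteq> {}" shows "0 < ncov U K"
proof -
  obtain F where "covered_by U K F" "card F = ncov U K" by (rule ncov_witness[OF assms(1-3)])
  thus ?thesis using assms(4) by (cases "F = {}") (auto simp: covered_by_def card_gt_0_iff)
qed

text \<open>Otherwise there are \<open>x n\<close> and \<open>u n\<close>, \<open>v n\<close>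
  tending to the identity with \<open>u n \<otimes> x n \<in> K\<close> and
  \<open>v n \<otimes> x n \<in> L\<close>. Along a subsequence the former converge to some
  \<open>l \<in> K\<close>; then \<open>x n\<close> and \<open>v n \<otimes> x n\<close> tend to
  \<open>l\<close> too, so \<open>l\<close> lies in the closed set \<open>L\<close>.\<close>

lemma separating_neighbourhood:
  assumes K: "compactin \<tau> K" "compactin \<tau> L" "K \<inter> L = {}"
    and U: "\<And>n::nat. openin \<tau> (U n)" "\<And>m n. m \<le> n \<Longrightarrow> U n \<subseteq> U m"
      "\<And>s. (\<And>n. s n \<in> U n) \<Longrightarrow> limitin \<tau> s \<one> sequentially"
  shows "\<exists>N. \<forall>n\<ge>N. \<forall>x\<in>carrier G. (U n #> x) \<inter> K = {} \<or> (U n #> x) \<inter> L = {}"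
proof (rule ccontr)
  assume "\<not> ?thesis"
  hence bad: "\<exists>n\<ge>N. \<exists>x\<in>carrier G. (U n #> x) \<inter> K \<noteq> {} \<and> (U n #> x) \<inter> L \<noteq> {}" for N by blast
  have "\<exists>z. fst z \<in> carrier G \<and> fst (snd z) \<in> U N \<and> snd (snd z) \<in> U N \<and>
      fst (snd z) \<otimes> fst z \<in> K \<and> snd (snd z) \<otimes> fst z \<in> L" for N
  proof -
    obtain n x where nx: "N \<le> n" "x \<in> carrier G" "(U n #> x) \<inter> K \<noteq> {}" "(U n #> x) \<inter> L \<noteq> {}"
      using bad by blast
    then obtain u v where "u \<in> U n" "v \<in> U n" "u \<otimes> x \<in> K" "v \<otimes> x \<in> L"
      unfolding r_coset_eq_image by blast
    thus ?thesis using nx U(2)[of N n] by (intro exI[of _ "(x, u, v)"]) auto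
  qed
  then obtain z where z: "\<And>N. fst (z N) \<in> carrier G \<and> fst (snd (z N)) \<in> U N \<and> snd (snd (z N)) \<in> U N \<and>
      fst (snd (z N)) \<otimes> fst (z N) \<in> K \<and> snd (snd (z N)) \<otimes> fst (z N) \<in> L" by metis
  define x u v where "x = (\<lambda>n. fst (z n))" and "u = (\<lambda>n. fst (snd (z n)))" and "v = (\<lambda>n. snd (snd (z n)))"
  have xuv: "\<And>n. x n \<in> carrier G" "\<And>n. u n \<in> U n" "\<And>n. v n \<in> U n"
      "\<And>n. u n \<otimes> x n \<in> K" "\<And>n. v n \<otimes> x n \<in> L"
    using z by (auto simp: x_def u_def v_def)
  have uv: "u n \<in> carrier G" "v n \<in> carrier G" for n using xuv U(1) openin_carrier by blast+
  obtain l r where l: "l \<in> K" "strict_mono r" "limitin \<tau> ((\<lambda>n. u n \<otimes> x n) \<circ> r) l sequentially"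
    by (rule compact_subsequence[OF K(1), of "\<lambda>n. u n \<otimes> x n"]) (use xuv in auto)
  have u1: "limitin \<tau> (u \<circ> r) \<one> sequentially" and v1: "limitin \<tau> (v \<circ> r) \<one> sequentially"
    using limitin_subsequence[OF l(2) U(3)[OF xuv(2)]] limitin_subsequence[OF l(2) U(3)[OF xuv(3)]] .
  have "limitin \<tau> (\<lambda>n. v (r n) \<otimes> (inv (u (r n)) \<otimes> (u (r n) \<otimes> x (r n)))) (\<one> \<otimes> (inv \<one> \<otimes> l)) sequentially"
    using u1 v1 l(3) by (intro limitin_mult limitin_inv) (auto simp: o_def)
  moreover have "inv (u (r n)) \<otimes> (u (r n) \<otimes> x (r n)) = x (r n)" for n
    using uv xuv(1) by (simp flip: m_assoc)
  moreover have "l \<in> carrier G" using l(1) compactin_carrier[OF K(1)] by blast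
  ultimately have "limitin \<tau> (\<lambda>n. v (r n) \<otimes> x (r n)) l sequentially" by simp
  hence "l \<in> L"
    by (rule closed_sequentially[OF compactin_imp_closedin[OF Hausdorff K(2)]]) (rule xuv)
  thus False using l(1) K(3) by blast
qed

text \<open>Limit of the normalized indices \<open>ncov (U n) K / ncov (U n) K0\<close> for
  neighbourhoods shrinking to the identity. The bound by \<open>ncov V K\<close>, with
  \<open>V\<close> an open neighbourhood of the identity inside \<open>K0\<close>, makes a cluster
  limit available. Monotonicity, subadditivity and invariance hold for every \<open>n\<close> and
  pass to the limit; superadditivity on disjoint compact sets is available once \<open>U n\<close>
  is small enough to separate them.\<close>

lemma invariant_content:
  obtains c :: "'g set \<Rightarrow> real" and K0 where "compactin \<tau> K0" "c K0 = 1" "c {} = 0" "\<And>K. 0 \<le> c K"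
    "\<And>K L. compactin \<tau> K \<Longrightarrow> compactin \<tau> L \<Longrightarrow> K \<subseteq> L \<Longrightarrow> c K \<le> c L"
    "\<And>K L. compactin \<tau> K \<Longrightarrow> compactin \<tau> L \<Longrightarrow> c (K \<union> L) \<le> c K + c L"
    "\<And>K L. compactin \<tau> K \<Longrightarrow> compactin \<tau> L \<Longrightarrow> K \<inter> L = {} \<Longrightarrow> c K + c L \<le> c (K \<union> L)"
    "\<And>K x. compactin \<tau> K \<Longrightarrow> x \<in> carrier G \<Longrightarrow> c (K #> x) = c K"
proof -
  obtain V K0 where V: "openin \<tau> V" "compactin \<tau> K0" "\<one> \<in> V" "V \<subseteq> K0"
    using locally_compact one_closed unfolding locally_compact_space_def topspace_eq by blast
  obtain U where U: "\<And>n::nat. openin \<tau> (U n)" "\<And>n. \<one> \<in> U n" "\<And>m n. m \<le> n \<Longrightarrow> U n \<subseteq> U m"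
    "\<And>s. (\<And>n. s n \<in> U n) \<Longrightarrow> limitin \<tau> s \<one> sequentially" using neighbourhood_sequence by blast
  define q where "q n K = (if compactin \<tau> K then real (ncov (U n) K) / real (ncov (U n) K0) else 0)" for n K
  define b where "b K = (if compactin \<tau> K then real (ncov V K) else 0)" for K
  have pos: "0 < ncov (U n) K0" for n using V by (intro ncov_pos U) auto
  have q: "q n K = real (ncov (U n) K) / real (ncov (U n) K0)" if "compactin \<tau> K" for n K
    using that by (simp add: q_def)
  have "q n K \<le> b K" for n K
  proof (cases "compactin \<tau> K")
    case True
    have "ncov (U n) K \<le> ncov V K * ncov (U n) K0"
      by (rule ncov_le_mult[OF True V(2) U(1,2) V(1,3,4)])
    hence "real (ncov (U n) K) \<le> real (ncov V K) * real (ncov (U n) K0)"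
      by (metis of_nat_le_iff of_nat_mult)
    thus ?thesis using True pos[of n] by (simp add: q_def b_def divide_le_eq)
  qed (simp add: q_def b_def)
  moreover have q0: "0 \<le> q n K" for n K by (simp add: q_def)
  ultimately obtain F c where F: "F \<noteq> bot" "F \<le> sequentially" and c: "\<And>K. ((\<lambda>n. q n K) \<longlongrightarrow> c K) F"
    using product_cluster_filter[of q b] by blast
  have ev: "eventually P F" if "eventually P sequentially" for P
    using F(2) that filter_leD by blast
  have c1: "c K0 = 1"
  proof -
    have "q n K0 = 1" for n using pos[of n] V by (simp add: q)
    thus ?thesis using tendsto_unique[OF F(1) c[of K0], of 1] by simp
  qed
  have "ncov (U n) {} = 0" for n
    using ncov_le[of "U n" "{}" "{}"] by (simp add: covered_by_def)
  hence cempty: "c {} = 0" using tendsto_unique[OF F(1) c[of "{}"], of 0] by (simp add: q)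
  have c0: "0 \<le> c K" for K
    by (rule tendsto_lowerbound[OF c _ F(1)]) (simp add: q0)
  have cmono: "c K \<le> c L" if "compactin \<tau> K" "compactin \<tau> L" "K \<subseteq> L" for K L
    by (rule tendsto_le[OF F(1) c c]) (use that pos U in \<open>simp add: q divide_right_mono ncov_mono\<close>)
  have csub: "c (K \<union> L) \<le> c K + c L" if KL: "compactin \<tau> K" "compactin \<tau> L" for K L
  proof (rule tendsto_le[OF F(1) tendsto_add[OF c c] c], intro always_eventually allI)
    fix n
    have "real (ncov (U n) (K \<union> L)) \<le> real (ncov (U n) K) + real (ncov (U n) L)"
      using ncov_Un_le[OF KL U(1,2)[of n]] by linarith
    thus "q n (K \<union> L) \<le> q n K + q n L"
      using KL by (simp add: q compactin_Un divide_right_mono flip: add_divide_distrib)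
  qed
  have cadd: "c K + c L \<le> c (K \<union> L)" if KL: "compactin \<tau> K" "compactin \<tau> L" "K \<inter> L = {}" for K L
  proof (rule tendsto_le[OF F(1) c tendsto_add[OF c c]], rule ev)
    obtain N where N: "\<forall>n\<ge>N. \<forall>x\<in>carrier G. (U n #> x) \<inter> K = {} \<or> (U n #> x) \<inter> L = {}"
      using separating_neighbourhood[OF KL, of U] U by blast
    have "q n K + q n L \<le> q n (K \<union> L)" if "N \<le> n" for n
    proof -
      have "real (ncov (U n) K) + real (ncov (U n) L) \<le> real (ncov (U n) (K \<union> L))"
        using ncov_Un_ge[OF KL(1,2) U(1,2)[of n]] N that by (metis of_nat_add of_nat_le_iff)
      thus ?thesis using KL by (simp add: q compactin_Un divide_right_mono flip: add_divide_distrib)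
    qed
    thus "\<forall>\<^sub>F n in sequentially. q n K + q n L \<le> q n (K \<union> L)" by (auto simp: eventually_sequentially)
  qed
  have cinv: "c (K #> x) = c K" if "compactin \<tau> K" "x \<in> carrier G" for K x
    using tendsto_unique[OF F(1) c[of "K #> x"], of "c K"] c[of K] that U
    by (simp add: q compactin_r_coset ncov_r_coset)
  show thesis by (rule that[OF V(2) c1 cempty c0 cmono csub cadd cinv])
qed

theorem haar_measure_exists:
  "\<exists>\<nu>. sets \<nu> = sets (borel_of \<tau>) \<and> (\<forall>K. compactin \<tau> K \<longrightarrow> emeasure \<nu> K < \<infinity>) \<and>
     emeasure \<nu> (carrier G) \<noteq> 0 \<and> (\<forall>x\<in>carrier G. distr \<nu> \<nu> (\<lambda>g. g \<otimes> x) = \<nu>)"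
proof -
  obtain c :: "'g set \<Rightarrow> real" and K0 where K0: "compactin \<tau> K0" "c K0 = 1" and empty: "c {} = 0"
    and c0: "\<And>K. 0 \<le> c K"
    and mono: "\<And>K L. compactin \<tau> K \<Longrightarrow> compactin \<tau> L \<Longrightarrow> K \<subseteq> L \<Longrightarrow> c K \<le> c L"
    and sub: "\<And>K L. compactin \<tau> K \<Longrightarrow> compactin \<tau> L \<Longrightarrow> c (K \<union> L) \<le> c K + c L"
    and add: "\<And>K L. compactin \<tau> K \<Longrightarrow> compactin \<tau> L \<Longrightarrow> K \<inter> L = {} \<Longrightarrow> c K + c L \<le> c (K \<union> L)"
    and inv: "\<And>K x. compactin \<tau> K \<Longrightarrow> x \<in> carrier G \<Longrightarrow> c (K #> x) = c K"
    by (rule invariant_content) (rule that)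
  let ?c = "\<lambda>K. ennreal (c K)"
  have "\<exists>\<nu>. sets \<nu> = sets (borel_of \<tau>) \<and>
      (\<forall>B\<in>sets (borel_of \<tau>). emeasure \<nu> B = content_outer \<tau> ?c B)"
    by (rule content_extension[OF Hausdorff])
      (use c0 sub add empty in \<open>auto simp flip: ennreal_plus intro!: ennreal_leI\<close>)
  then obtain \<nu> where sets: "sets \<nu> = sets (borel_of \<tau>)"
    and \<nu>: "\<And>B. B \<in> sets (borel_of \<tau>) \<Longrightarrow> emeasure \<nu> B = content_outer \<tau> ?c B" by blast
  have sp: "space \<nu> = carrier G" using sets_eq_imp_space_eq[OF sets] by (simp add: topspace_eq)
  have open_le: "content_open \<tau> ?c U \<le> ennreal (c L)" if "compactin \<tau> L" "U \<subseteq> L" for U L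
    unfolding content_open_def by (rule SUP_least) (use that mono in \<open>auto intro!: ennreal_leI\<close>)
  \<comment> \<open>The measure of a compact set is not known to be \<open>c K\<close>, so a finite
    bound comes from an open superset contained in a compact set, assembled from finitely many open
    sets with compact supersets.\<close>
  have fin: "emeasure \<nu> K < \<infinity>" if K: "compactin \<tau> K" for K
  proof -
    have "\<forall>x\<in>K. \<exists>U C. openin \<tau> U \<and> compactin \<tau> C \<and> x \<in> U \<and> U \<subseteq> C"
      using compactin_subset_topspace[OF K] locally_compact unfolding locally_compact_space_def by blast
    then obtain U C where UC: "\<And>x. x \<in> K \<Longrightarrow> openin \<tau> (U x) \<and> compactin \<tau> (C x) \<and> x \<in> U x \<and> U x \<subseteq> C x"
      by metis
    have "\<exists>\<F>. finite \<F> \<and> \<F> \<subseteq> U ` K \<and> K \<subseteq> \<Union>\<F>"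
      by (rule K[unfolded compactin_def, THEN conjunct2, rule_format]) (use UC in auto)
    then obtain F where F: "finite F" "F \<subseteq> K" "K \<subseteq> (\<Union>x\<in>F. U x)"
      by (metis finite_subset_image)
    have "compactin \<tau> (\<Union>x\<in>F. C x)" by (rule compactin_Union) (use F UC in auto)
    moreover have "(\<Union>x\<in>F. U x) \<subseteq> (\<Union>x\<in>F. C x)" using F UC by blast
    ultimately have "content_open \<tau> ?c (\<Union>x\<in>F. U x) \<le> ennreal (c (\<Union>x\<in>F. C x))" by (rule open_le)
    moreover have "openin \<tau> (\<Union>x\<in>F. U x)" by (rule openin_Union) (use F UC in auto)
    hence "content_outer \<tau> ?c K \<le> content_open \<tau> ?c (\<Union>x\<in>F. U x)"
      using F(3) by (rule content_outer_lower)
    ultimately have "content_outer \<tau> ?c K \<le> ennreal (c (\<Union>x\<in>F. C x))" by (rule order_trans[rotated])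
    moreover have "K \<in> sets (borel_of \<tau>)"
      by (rule closedin_borel_of[OF compactin_imp_closedin[OF Hausdorff K]])
    ultimately show ?thesis by (simp add: \<nu> ennreal_less_top le_less_trans less_top)
  qed
  have "ennreal 1 \<le> content_open \<tau> ?c (carrier G)"
    using content_open_upper[of \<tau> K0 "carrier G" ?c] K0 compactin_carrier by simp
  hence nz: "emeasure \<nu> (carrier G) \<noteq> 0"
    using \<nu>[of "carrier G"] content_outer_open[of \<tau> "carrier G" ?c] openin_topspace[of \<tau>]
      openin_borel_of[of \<tau> "carrier G"] by (auto simp: topspace_eq)
  \<comment> \<open>One inequality for all \<open>x\<close> suffices: applied to
    \<open>inv x\<close> it gives the reverse one.\<close>
  have le: "content_outer \<tau> ?c (E #> x) \<le> content_outer \<tau> ?c E" if x: "x \<in> carrier G" for E x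
    unfolding content_outer_def[of \<tau> ?c E]
  proof (rule INF_greatest, clarify)
    fix U assume U: "openin \<tau> U" "E \<subseteq> U"
    have "content_outer \<tau> ?c (E #> x) \<le> content_open \<tau> ?c (U #> x)"
      by (rule content_outer_lower[OF openin_r_coset]) (use U x in \<open>auto simp: r_coset_eq_image\<close>)
    also have "\<dots> \<le> content_open \<tau> ?c U"
      unfolding content_open_def[of \<tau> ?c "U #> x"]
    proof (rule SUP_least, clarify)
      fix K assume K: "compactin \<tau> K" "K \<subseteq> U #> x"
      have "K #> inv x \<subseteq> U #> x #> inv x" using K(2) by (auto simp: r_coset_eq_image)
      hence "K #> inv x \<subseteq> U" using r_coset_cancel openin_carrier U x by simp
      hence "?c (K #> inv x) \<le> content_open \<tau> ?c U"
        using K x by (intro content_open_upper compactin_r_coset) auto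
      thus "?c K \<le> content_open \<tau> ?c U" using inv K x by simp
    qed
    finally show "content_outer \<tau> ?c (E #> x) \<le> content_open \<tau> ?c U" .
  qed
  have "distr \<nu> \<nu> (\<lambda>g. g \<otimes> x) = \<nu>" if x: "x \<in> carrier G" for x
  proof (rule measure_eqI)
    have m: "(\<lambda>g. g \<otimes> x) \<in> \<nu> \<rightarrow>\<^sub>M \<nu>"
      using continuous_map_borel_of[OF continuous_right_mult[OF x]]
        measurable_cong_sets[OF sets sets] by blast
    fix B assume "B \<in> sets (distr \<nu> \<nu> (\<lambda>g. g \<otimes> x))"
    hence B: "B \<in> sets \<nu>" by simp
    hence BG: "B \<subseteq> carrier G" using sets.sets_into_space sp by blast
    have pre: "(\<lambda>g. g \<otimes> x) -` B \<inter> space \<nu> = B #> inv x"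
      using r_coset_eq_preimage[of B "inv x"] BG x by (auto simp: sp)
    have "content_outer \<tau> ?c B \<le> content_outer \<tau> ?c (B #> inv x)"
      using le[OF x, of "B #> inv x"] BG x by (simp add: r_coset_cancel')
    hence "content_outer \<tau> ?c (B #> inv x) = content_outer \<tau> ?c B"
      using le[of "inv x" B] x by (intro antisym) auto
    thus "emeasure (distr \<nu> \<nu> (\<lambda>g. g \<otimes> x)) B = emeasure \<nu> B"
      using B m measurable_sets[OF m B] by (simp add: emeasure_distr pre \<nu> sets)
  qed simp
  thus ?thesis using sets fin nz by blast
qed

end

section \<open>Compact exhaustions\<close>

lemma polish_second_countable:
  assumes "polish_topology X" shows "second_countable X"
proof -
  obtain d C where d: "Metric_space (topspace X) d" "Metric_space.mtopology (topspace X) d = X"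
    and C: "countable C" "C \<subseteq> topspace X" "\<And>x r. x \<in> topspace X \<Longrightarrow> 0 < r \<Longrightarrow> \<exists>q\<in>C. d x q < r"
    using polish_metric[OF assms] by metis
  interpret Metric_space "topspace X" d by (rule d)
  let ?B = "(\<lambda>(q, n). mball q (inverse (Suc n))) ` (C \<times> UNIV)"
  have base: "\<exists>V\<in>?B. x \<in> V \<and> V \<subseteq> U" if U: "openin X U" "x \<in> U" for U x
  proof -
    obtain r where r: "0 < r" "mball x r \<subseteq> U" using U by (metis d(2) openin_mtopology)
    obtain n where n: "inverse (real (Suc n)) < r / 2" using r reals_Archimedean[of "r / 2"] by auto
    have x: "x \<in> topspace X" using U openin_subset by blast
    obtain q where q: "q \<in> C" "d x q < inverse (Suc n)"
      using C(3)[OF x, of "inverse (Suc n)"] by auto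
    have qX: "q \<in> topspace X" using q C by blast
    have "x \<in> mball q (inverse (Suc n))" using q qX x commute[of x q] by (simp del: of_nat_Suc)
    moreover have "mball q (inverse (Suc n)) \<subseteq> mball x r"
    proof
      fix y assume "y \<in> mball q (inverse (Suc n))"
      hence y: "y \<in> topspace X" "d q y < inverse (Suc n)" by (simp_all del: of_nat_Suc)
      have "d x y \<le> d x q + d q y" by (rule triangle) (use x y qX in auto)
      thus "y \<in> mball x r" using y x q(2) n by simp
    qed
    ultimately show ?thesis using r(2) q(1) by (intro bexI[of _ "mball q (inverse (Suc n))"]) auto
  qed
  have "countable ?B" using C by auto
  moreover have "\<forall>V\<in>?B. openin X V" using openin_mball unfolding d(2) by fast
  moreover have "\<forall>U x. openin X U \<and> x \<in> U \<longrightarrow> (\<exists>V\<in>?B. x \<in> V \<and> V \<subseteq> U)" using base by blast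
  ultimately show ?thesis unfolding second_countable_def by (intro exI[of _ ?B] conjI)
qed

context polish_lc_group
begin

lemma compact_exhaustion:
  obtains K :: "nat \<Rightarrow> 'g set" where "\<And>n. compactin \<tau> (K n)" "incseq K" "(\<Union>n. K n) = carrier G"
proof -
  let ?U = "{U. openin \<tau> U \<and> (\<exists>K. compactin \<tau> K \<and> U \<subseteq> K)}"
  have "\<Union>?U = topspace \<tau>"
    using locally_compact openin_subset unfolding locally_compact_space_def by fast
  then obtain \<V> where V: "countable \<V>" "\<V> \<subseteq> ?U" "\<Union>\<V> = topspace \<tau>"
    using Lindelof_spaceD[OF second_countable_imp_Lindelof_space[OF polish_second_countable[OF polish]], of ?U]
    by auto
  have ne: "\<V> \<noteq> {}" using V(3) topspace_eq one_closed by auto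
  have "\<forall>U\<in>\<V>. \<exists>K. compactin \<tau> K \<and> U \<subseteq> K" using V(2) by auto
  then obtain C where C: "\<And>U. U \<in> \<V> \<Longrightarrow> compactin \<tau> (C U)" "\<And>U. U \<in> \<V> \<Longrightarrow> U \<subseteq> C U" by metis
  define K where "K n = (\<Union>i\<le>n. C (from_nat_into \<V> i))" for n
  have mem: "from_nat_into \<V> i \<in> \<V>" for i by (rule from_nat_into[OF ne])
  show thesis
  proof (rule that)
    show "compactin \<tau> (K n)" for n unfolding K_def by (rule compactin_Union) (use C mem in auto)
    show "incseq K" unfolding K_def incseq_def by (auto intro: order_trans)
    show "(\<Union>n. K n) = carrier G"
    proof
      show "(\<Union>n. K n) \<subseteq> carrier G" using C mem compactin_carrier by (fastforce simp: K_def)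
      show "carrier G \<subseteq> (\<Union>n. K n)"
      proof
        fix x assume "x \<in> carrier G"
        then obtain U where U: "U \<in> \<V>" "x \<in> U" using V(3) topspace_eq by auto
        obtain i where "from_nat_into \<V> i = U" using from_nat_into_surj[OF V(1) U(1)] by blast
        hence "x \<in> K i" using C U unfolding K_def by blast
        thus "x \<in> (\<Union>n. K n)" by blast
      qed
    qed
  qed
qed

lemma dense_sequence:
  assumes K: "compactin \<tau> K"
  obtains D where "countable D" "D \<subseteq> K"
    "\<And>h. h \<in> K \<Longrightarrow> \<exists>s. (\<forall>n::nat. s n \<in> D) \<and> limitin \<tau> s h sequentially"
proof -
  obtain d where d: "Metric_space (carrier G) d" "Metric_space.mtopology (carrier G) d = \<tau>"
    by (rule metric)
  interpret d: Metric_space "carrier G" d by (rule d)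
  have KG: "K \<subseteq> carrier G" by (rule compactin_carrier[OF K])
  have "separable_space (subtopology \<tau> K)"
    by (intro second_countable_imp_separable_space second_countable_subtopology
        polish_second_countable polish)
  then obtain D where D: "countable D" "D \<subseteq> topspace (subtopology \<tau> K)"
      "subtopology \<tau> K closure_of D = topspace (subtopology \<tau> K)" unfolding separable_space_def by blast
  have DK: "D \<subseteq> K" using D(2) by auto
  have "K \<subseteq> \<tau> closure_of D"
    using D(3) KG DK by (auto simp: topspace_eq closure_of_subtopology Int_absorb1)
  show thesis
  proof (rule that[OF D(1) DK])
    fix h assume h: "h \<in> K"
    hence hd: "\<forall>r>0. \<exists>y\<in>D. y \<in> d.mball h r" using \<open>K \<subseteq> \<tau> closure_of D\<close> d.metric_closure_of[of D] d(2) by auto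
    have "\<forall>n. \<exists>y\<in>D. y \<in> d.mball h (inverse (Suc n))"
      using hd by (metis inverse_positive_iff_positive of_nat_0_less_iff zero_less_Suc)
    then obtain s where s: "\<And>n. s n \<in> D" "\<And>n. s n \<in> d.mball h (inverse (Suc n))" by metis
    have "limitin \<tau> s h sequentially"
      using d.limitin_if_in_balls[OF _ s(2)] h KG unfolding d(2) by blast
    thus "\<exists>s. (\<forall>n::nat. s n \<in> D) \<and> limitin \<tau> s h sequentially" using s by blast
  qed
qed

text \<open>Uniqueness of measures is applied to this generator: its members are compact, hence of
  finite Haar measure, it is closed under intersection, and it contains a sequence exhausting the
  group. Unions of finitely many basic open sets are removed from the \<open>K n\<close>, because
  two such differences intersect in a set of the same form. Countability leaves countably many
  visiting times.\<close>

lemma compact_generator: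
  fixes K :: "nat \<Rightarrow> 'g set"
  assumes K: "\<And>n. compactin \<tau> (K n)" "incseq K" "(\<Union>n. K n) = carrier G"
  obtains \<C> where "countable \<C>" "\<And>C. C \<in> \<C> \<Longrightarrow> compactin \<tau> C" "Int_stable \<C>" "range K \<subseteq> \<C>"
    "sigma_sets (carrier G) \<C> = sets (borel_of \<tau>)"
proof -
  obtain \<B> where B: "countable \<B>" "\<And>V. V \<in> \<B> \<Longrightarrow> openin \<tau> V"
      "\<And>U x. openin \<tau> U \<Longrightarrow> x \<in> U \<Longrightarrow> \<exists>V\<in>\<B>. x \<in> V \<and> V \<subseteq> U"
    using polish_second_countable[OF polish] unfolding second_countable_def by metis
  let ?F = "{F. finite F \<and> F \<subseteq> \<B>}"
  let ?C = "(\<lambda>(n, F). K n - \<Union>F) ` (UNIV \<times> ?F)"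
  have comp: "compactin \<tau> C" if C: "C \<in> ?C" for C
  proof -
    obtain n F where nF: "C = K n - \<Union>F" "F \<subseteq> \<B>" using C by auto
    have "closedin \<tau> (topspace \<tau> - \<Union>F)"
      by (intro closedin_diff closedin_topspace openin_Union) (use nF B in auto)
    moreover have "K n \<inter> (topspace \<tau> - \<Union>F) = K n - \<Union>F"
      using compactin_subset_topspace[OF K(1)[of n]] by auto
    ultimately show ?thesis using compact_Int_closedin[OF K(1)[of n]] nF by metis
  qed
  have KC: "K n - \<Union>F \<in> ?C" if "finite F" "F \<subseteq> \<B>" for n F using that by auto
  show thesis
  proof (rule that[of ?C])
    show "countable ?C" using B(1) countable_Collect_finite_subset[of \<B>] by auto
    show "Int_stable ?C"
    proof (rule Int_stableI)
      fix C D assume "C \<in> ?C" "D \<in> ?C"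
      then obtain m E n F where *: "C = K m - \<Union>E" "D = K n - \<Union>F" "E \<in> ?F" "F \<in> ?F" by auto
      have "K m \<inter> K n = K (min m n)" using incseqD[OF K(2), of m n] incseqD[OF K(2), of n m]
        by (cases "m \<le> n") (auto simp: min_def)
      hence "C \<inter> D = K (min m n) - \<Union>(E \<union> F)" using * by auto
      thus "C \<inter> D \<in> ?C" using KC[of "E \<union> F"] * by simp
    qed
    show "range K \<subseteq> ?C" using KC[of "{}"] by auto
    show "sigma_sets (carrier G) ?C = sets (borel_of \<tau>)"
    proof
      have "?C \<subseteq> sets (borel_of \<tau>)"
        using closedin_borel_of compactin_imp_closedin[OF Hausdorff comp] by blast
      thus "sigma_sets (carrier G) ?C \<subseteq> sets (borel_of \<tau>)"
        using sets.sigma_sets_subset[of ?C "borel_of \<tau>"] by (simp add: topspace_eq)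
    next
      have sub: "?C \<subseteq> Pow (carrier G)" using compactin_carrier[OF comp] by blast
      interpret S: sigma_algebra "carrier G" "sigma_sets (carrier G) ?C"
        by (rule sigma_algebra_sigma_sets[OF sub])
      have base: "V \<in> sigma_sets (carrier G) ?C" if "V \<in> \<B>" for V
      proof -
        \<comment> \<open>The traces of \<open>V\<close> on the sets \<open>K n\<close> are double
          differences of members of the generator.\<close>
        have "V = (\<Union>n. K n - (K n - \<Union>{V}))"
          using K(3) openin_carrier[OF B(2)[OF that]] by auto
        moreover have "K n \<in> ?C" "K n - \<Union>{V} \<in> ?C" for n
          using KC[of "{}" n] KC[of "{V}" n] that by auto
        hence "K n - (K n - \<Union>{V}) \<in> sigma_sets (carrier G) ?C" for n
          by (intro S.Diff sigma_sets.Basic)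
        hence "(\<Union>n. K n - (K n - \<Union>{V})) \<in> sigma_sets (carrier G) ?C" by (intro S.countable_UN) blast
        ultimately show ?thesis by simp
      qed
      have "U \<in> sigma_sets (carrier G) ?C" if U: "openin \<tau> U" for U
      proof -
        have "U = \<Union>{V \<in> \<B>. V \<subseteq> U}" using B(3)[OF U] by blast
        moreover have "\<Union>{V \<in> \<B>. V \<subseteq> U} \<in> sigma_sets (carrier G) ?C"
          by (rule S.countable_Union) (use B(1) base in auto)
        ultimately show ?thesis by simp
      qed
      thus "sets (borel_of \<tau>) \<subseteq> sigma_sets (carrier G) ?C"
        unfolding sets_borel_of topspace_eq by (intro S.sigma_sets_subset) auto
    qed
  qed (rule comp)
qed

lemma haar_measure:
  obtains \<nu> where "sets \<nu> = sets (borel_of \<tau>)" "space \<nu> = carrier G" "sigma_finite_measure \<nu>"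
    "\<And>K. compactin \<tau> K \<Longrightarrow> emeasure \<nu> K < \<infinity>" "emeasure \<nu> (carrier G) \<noteq> 0"
    "\<And>x. x \<in> carrier G \<Longrightarrow> (\<lambda>g. g \<otimes> x) \<in> \<nu> \<rightarrow>\<^sub>M \<nu>"
    "\<And>x. x \<in> carrier G \<Longrightarrow> distr \<nu> \<nu> (\<lambda>g. g \<otimes> x) = \<nu>"
proof -
  obtain \<nu> where \<nu>: "sets \<nu> = sets (borel_of \<tau>)" "\<forall>K. compactin \<tau> K \<longrightarrow> emeasure \<nu> K < \<infinity>"
      "emeasure \<nu> (carrier G) \<noteq> 0" "\<forall>x\<in>carrier G. distr \<nu> \<nu> (\<lambda>g. g \<otimes> x) = \<nu>"
    using haar_measure_exists by blast
  have sp: "space \<nu> = carrier G" using sets_eq_imp_space_eq[OF \<nu>(1)] by (simp add: topspace_eq)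
  obtain K :: "nat \<Rightarrow> 'g set" where K: "\<And>n. compactin \<tau> (K n)" "(\<Union>n. K n) = carrier G"
    using compact_exhaustion by metis
  have "sigma_finite_measure \<nu>"
  proof
    show "\<exists>A. countable A \<and> A \<subseteq> sets \<nu> \<and> \<Union>A = space \<nu> \<and> (\<forall>a\<in>A. emeasure \<nu> a \<noteq> \<infinity>)"
      using K \<nu>(1,2) closedin_borel_of[OF compactin_imp_closedin[OF Hausdorff K(1)]]
      by (intro exI[of _ "range K"]) (auto simp: sp less_top)
  qed
  moreover have "(\<lambda>g. g \<otimes> x) \<in> \<nu> \<rightarrow>\<^sub>M \<nu>" if "x \<in> carrier G" for x
    using continuous_map_borel_of[OF continuous_right_mult[OF that]]
      measurable_cong_sets[OF \<nu>(1) \<nu>(1)] by blast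
  ultimately show thesis using that[OF \<nu>(1) sp] \<nu> by blast
qed

end

section \<open>Haar measure along orbits\<close>

context standard_probability_space
begin

lemma separating_sequence:
  "\<exists>B :: nat \<Rightarrow> 'a set. (\<forall>n. B n \<in> sets M) \<and>
    (\<forall>x y. x \<in> space M \<longrightarrow> y \<in> space M \<longrightarrow> x \<noteq> y \<longrightarrow> (\<exists>n. x \<in> B n \<and> y \<notin> B n))"
proof -
  obtain X where X: "topspace X = space M" "polish_topology X" "sets (borel_of X) = sets M"
    using standard_borel by blast
  obtain \<B> where B: "countable \<B>" "\<And>V. V \<in> \<B> \<Longrightarrow> openin X V"
      "\<And>U x. openin X U \<Longrightarrow> x \<in> U \<Longrightarrow> \<exists>V\<in>\<B>. x \<in> V \<and> V \<subseteq> U"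
    using polish_second_countable[OF X(2)] unfolding second_countable_def by metis
  have H: "Hausdorff_space X" using X(2)
    by (auto simp: polish_topology_def intro: completely_metrizable_imp_metrizable_space
        metrizable_imp_Hausdorff_space)
  let ?B = "from_nat_into (insert {} \<B>)"
  have mem: "?B n \<in> insert {} \<B>" for n by (rule from_nat_into) simp
  show ?thesis
  proof (intro exI[of _ ?B] conjI allI impI)
    show "?B n \<in> sets M" for n using mem[of n] B(2) openin_borel_of X(3) by auto
    fix x y assume "x \<in> space M" "y \<in> space M" "x \<noteq> y"
    then obtain U V where UV: "openin X U" "openin X V" "x \<in> U" "y \<in> V" "disjnt U V"
      using H X(1) unfolding Hausdorff_space_def by metis
    then obtain W where W: "W \<in> \<B>" "x \<in> W" "W \<subseteq> U" using B(3) by blast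
    moreover obtain n where "?B n = W"
      using from_nat_into_surj[of "insert {} \<B>" W] W(1) B(1) by auto
    ultimately show "\<exists>n. x \<in> ?B n \<and> y \<notin> ?B n" using UV by (intro exI[of _ n]) (auto simp: disjnt_def)
  qed
qed

text \<open>One fixed countable family, so that equality of point maps reduces to countably many
  statements about measurable sets. Separation is for ordered pairs: if \<open>x \<in> sep n\<close>
  implies \<open>y \<in> sep n\<close> for all \<open>n\<close>, then already \<open>x = y\<close>
  for points of the space.\<close>

definition sep :: "nat \<Rightarrow> 'a set" where
  "sep = (SOME B. (\<forall>n. B n \<in> sets M) \<and>
    (\<forall>x y. x \<in> space M \<longrightarrow> y \<in> space M \<longrightarrow> x \<noteq> y \<longrightarrow> (\<exists>n. x \<in> B n \<and> y \<notin> B n)))"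

lemma sep_sets: "sep n \<in> sets M"
  and sep: "x \<in> space M \<Longrightarrow> y \<in> space M \<Longrightarrow> x \<noteq> y \<Longrightarrow> \<exists>n. x \<in> sep n \<and> y \<notin> sep n"
  using someI_ex[OF separating_sequence] unfolding sep_def[symmetric] by blast+

lemma AE_equal_if_sep:
  assumes f: "AE x in M. f x \<in> space M" "AE x in M. g x \<in> space M"
    and ae: "\<And>n. AE x in M. f x \<in> sep n \<longleftrightarrow> g x \<in> sep n"
  shows "AE x in M. f x = g x"
proof -
  have "AE x in M. \<forall>n. f x \<in> sep n \<longleftrightarrow> g x \<in> sep n" using ae by (simp add: AE_all_countable)
  thus ?thesis using f by eventually_elim (use sep in blast)
qed

end

text \<open>The action together with one right Haar measure. Right invariance fits
  \<open>\<phi> g (\<phi> h x) = \<phi> (g \<otimes> h) x\<close>: moving the base point along its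
  orbit translates the group variable on the right.\<close>

locale haar_action = pmp_ergodic_action G \<tau> M \<phi> + haar: sigma_finite_measure \<nu>
  for G :: "('g, 'm) monoid_scheme" (structure) and \<tau> and M :: "'a measure" and \<phi>
    and \<nu> :: "'g measure" +
  assumes haar_sets: "sets \<nu> = sets (borel_of \<tau>)"
    and haar_space: "space \<nu> = carrier G"
    and haar_compact: "\<And>K. compactin \<tau> K \<Longrightarrow> emeasure \<nu> K < \<infinity>"
    and haar_nonzero: "emeasure \<nu> (carrier G) \<noteq> 0"
    and haar_right_mult: "\<And>x. x \<in> carrier G \<Longrightarrow> (\<lambda>g. g \<otimes> x) \<in> \<nu> \<rightarrow>\<^sub>M \<nu>"
    and haar_invariant: "\<And>x. x \<in> carrier G \<Longrightarrow> distr \<nu> \<nu> (\<lambda>g. g \<otimes> x) = \<nu>"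
begin

sublocale pair: pair_sigma_finite \<nu> M ..

lemma haar_action_measurable: "(\<lambda>z. \<phi> (fst z) (snd z)) \<in> \<nu> \<Otimes>\<^sub>M M \<rightarrow>\<^sub>M M"
proof -
  have "sets (\<nu> \<Otimes>\<^sub>M M) = sets (borel_of \<tau> \<Otimes>\<^sub>M M)"
    by (rule sets_pair_measure_cong[OF haar_sets refl])
  thus ?thesis using borel_action by (simp add: case_prod_unfold cong: measurable_cong_sets)
qed

lemma orbit_map_measurable: "x \<in> space M \<Longrightarrow> (\<lambda>g. \<phi> g x) \<in> \<nu> \<rightarrow>\<^sub>M M"
  using measurable_compose[OF measurable_Pair2' haar_action_measurable] by simp

lemma action_in: "g \<in> carrier G \<Longrightarrow> x \<in> space M \<Longrightarrow> \<phi> g x \<in> space M"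
  using element_image by blast

lemma visits_sets:
  assumes "x \<in> space M" "B \<in> sets M" shows "{g \<in> carrier G. \<phi> g x \<in> B} \<in> sets \<nu>"
  using measurable_sets[OF orbit_map_measurable[OF assms(1)] assms(2)] haar_space
  by (simp add: vimage_def Int_def conj_commute)

lemma haar_AE_translate:
  assumes "h \<in> carrier G" "AE g in \<nu>. P g" shows "AE g in \<nu>. P (g \<otimes> h)"
  using AE_distrD[OF haar_right_mult[OF assms(1)]] assms(2) haar_invariant[OF assms(1)] by metis

lemma haar_emeasure_translate:
  assumes "h \<in> carrier G" "A \<in> sets \<nu>"
  shows "emeasure \<nu> {g \<in> carrier G. g \<otimes> h \<in> A} = emeasure \<nu> A"
  using emeasure_distr[OF haar_right_mult[OF assms(1)] assms(2)] haar_invariant[OF assms(1)] haar_space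
  by (simp add: vimage_def Int_def conj_commute)

lemma haar_compact_sets: "compactin \<tau> C \<Longrightarrow> C \<in> sets \<nu>"
  using closedin_borel_of[OF compactin_imp_closedin[OF Hausdorff]] haar_sets by blast

text \<open>Fubini arguments end with a property of almost every \<open>g\<close>; nontriviality of
  the measure turns this into an actual group element.\<close>

lemma AE_haar_ex:
  assumes "AE g in \<nu>. P g" shows "\<exists>g\<in>carrier G. P g"
proof (rule ccontr)
  assume "\<not> ?thesis"
  hence "AE g in \<nu>. \<not> P g" by (intro AE_I2) (auto simp: haar_space)
  with assms have "AE g in \<nu>. False" by eventually_elim simp
  then obtain N where "{g \<in> space \<nu>. \<not> False} \<subseteq> N" "emeasure \<nu> N = 0" "N \<in> sets \<nu>" by (rule AE_E)
  thus False using haar_nonzero emeasure_mono[of "carrier G" N \<nu>] by (simp add: haar_space)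
qed

text \<open>The Haar time that the orbit of \<open>x\<close> spends in \<open>B\<close> while the
  group variable runs through the window \<open>C\<close>; finite for compact \<open>C\<close>. For
  countably many \<open>C\<close> and \<open>B\<close> these numbers serve as Borel coordinates on
  the space that vary continuously along orbits.\<close>

definition visit_time :: "'g set \<Rightarrow> 'a set \<Rightarrow> 'a \<Rightarrow> real" where
  "visit_time C B x = measure \<nu> {g \<in> C. \<phi> g x \<in> B}"

lemma visits_measurable:
  assumes "C \<in> sets \<nu>" "B \<in> sets M"
  shows "(\<lambda>x. emeasure \<nu> {g \<in> C. \<phi> g x \<in> B}) \<in> borel_measurable M"
proof -
  let ?Q = "{z \<in> space (\<nu> \<Otimes>\<^sub>M M). fst z \<in> C \<and> \<phi> (fst z) (snd z) \<in> B}"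
  have "?Q \<in> sets (\<nu> \<Otimes>\<^sub>M M)"
    using assms haar_action_measurable by measurable
  hence "(\<lambda>x. emeasure \<nu> ((\<lambda>g. (g, x)) -` ?Q)) \<in> borel_measurable M"
    by (rule pair.measurable_emeasure_Pair2)
  moreover have "(\<lambda>g. (g, x)) -` ?Q = {g \<in> C. \<phi> g x \<in> B}" if "x \<in> space M" for x
    using that sets.sets_into_space[OF assms(1)] by (auto simp: space_pair_measure)
  ultimately show ?thesis by (simp cong: measurable_cong)
qed

lemma visit_time_measurable:
  "C \<in> sets \<nu> \<Longrightarrow> B \<in> sets M \<Longrightarrow> visit_time C B \<in> borel_measurable M"
  using visits_measurable[of C B] unfolding visit_time_def measure_def by measurable

text \<open>Moving the base point by \<open>h\<close> amounts to translating the window: right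
  invariance replaces \<open>C\<close> by \<open>C #> h\<close> and leaves the set of visits of
  \<open>x\<close> fixed.\<close>

lemma visit_time_translate:
  assumes C: "compactin \<tau> C" and B: "B \<in> sets M" and x: "x \<in> space M" and h: "h \<in> carrier G"
  shows "visit_time C B (\<phi> h x) = measure \<nu> ((C #> h) \<inter> {g \<in> carrier G. \<phi> g x \<in> B})"
proof -
  have CG: "C \<subseteq> carrier G" by (rule compactin_carrier[OF C])
  have "{g \<in> carrier G. g \<otimes> h \<in> (C #> h) \<inter> {g \<in> carrier G. \<phi> g x \<in> B}} = {g \<in> C. \<phi> g (\<phi> h x) \<in> B}"
    using CG h x by (auto simp: r_coset_eq_image composition_rule right_cancel subset_iff)
  moreover have "(C #> h) \<inter> {g \<in> carrier G. \<phi> g x \<in> B} \<in> sets \<nu>"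
    by (intro sets.Int haar_compact_sets compactin_r_coset visits_sets C B x h)
  ultimately show ?thesis
    using haar_emeasure_translate[OF h, of "(C #> h) \<inter> {g \<in> carrier G. \<phi> g x \<in> B}"]
    by (simp add: visit_time_def measure_def)
qed

lemma compactin_mult:
  assumes "compactin \<tau> C" "compactin \<tau> L" shows "compactin \<tau> ((\<lambda>(g, h). g \<otimes> h) ` (C \<times> L))"
  by (rule image_compactin[OF _ continuous_mult]) (simp add: compactin_Times assms)

text \<open>Upper semicontinuity of \<open>h \<mapsto> C h\<close> gives \<open>\<nu> (C h\<^sub>n - C h) \<longlonglongrightarrow> 0\<close>; as \<open>C h\<^sub>n\<close> and \<open>C h\<close> have
  the same finite measure, so do the symmetric differences.\<close>

lemma visit_time_continuous:
  assumes C: "compactin \<tau> C" and B: "B \<in> sets M" and x: "x \<in> space M"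
    and s: "limitin \<tau> s h sequentially" "\<And>n::nat. s n \<in> carrier G"
  shows "(\<lambda>n. visit_time C B (\<phi> (s n) x)) \<longlonglongrightarrow> visit_time C B (\<phi> h x)"
proof -
  have h: "h \<in> carrier G" using s(1) by (simp add: limitin_def topspace_eq)
  have CG: "C \<subseteq> carrier G" by (rule compactin_carrier[OF C])
  let ?L = "insert h (range s)" and ?E = "{g \<in> carrier G. \<phi> g x \<in> B}"
  \<comment> \<open>A convergent sequence together with its limit is compact, so \<open>?D\<close>
    is a compact set containing all translates \<open>C #> s n\<close>; its indicator dominates the
    indicators below.\<close>
  let ?D = "(\<lambda>(g, h). g \<otimes> h) ` (C \<times> ?L)"
  have D: "compactin \<tau> ?D"
    by (intro compactin_mult C compactin_sequence_with_limit[OF s(1)]) (use s topspace_eq in auto)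
  have cos: "compactin \<tau> (C #> k)" "(C #> k) \<in> sets \<nu>" if "k \<in> carrier G" for k
    using that compactin_r_coset[OF C] haar_compact_sets by blast+
  have fin: "emeasure \<nu> A \<noteq> \<infinity>" if "compactin \<tau> K" "A \<subseteq> K" for A K
    using emeasure_mono[OF that(2) haar_compact_sets[OF that(1)]] haar_compact[OF that(1)]
    by (metis infinity_ennreal_def le_less_trans less_irrefl)
  have E: "?E \<in> sets \<nu>" by (rule visits_sets[OF x B])
  have meas_eq: "measure \<nu> (C #> k) = measure \<nu> C" if k: "k \<in> carrier G" for k
  proof -
    have "{g \<in> carrier G. g \<otimes> k \<in> C #> k} = C"
      using CG k by (auto simp: r_coset_eq_image right_cancel subset_iff)
    thus ?thesis using haar_emeasure_translate[OF k cos(2)[OF k]] by (simp add: measure_def)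
  qed
  have bound: "\<bar>measure \<nu> ((C #> k) \<inter> ?E) - measure \<nu> ((C #> h) \<inter> ?E)\<bar> \<le> measure \<nu> ((C #> k) - (C #> h))"
    if k: "k \<in> carrier G" for k
  proof -
    let ?K = "C #> k" and ?H = "C #> h"
    have m: "measure \<nu> (A \<inter> A') = measure \<nu> A - measure \<nu> (A - A')"
      if "A \<in> sets \<nu>" "A' \<in> sets \<nu>" "emeasure \<nu> A \<noteq> \<infinity>" for A A'
    proof -
      have "A - A \<inter> A' = A - A'" by blast
      thus ?thesis using measure_Diff[of \<nu> A "A \<inter> A'"] that by simp
    qed
    have one: "measure \<nu> (A \<inter> ?E) \<le> measure \<nu> (A' \<inter> ?E) + measure \<nu> (A - A')"
      if A: "A \<in> sets \<nu>" "A' \<in> sets \<nu>" "emeasure \<nu> A \<noteq> \<infinity>" "emeasure \<nu> A' \<noteq> \<infinity>" for A A'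
    proof -
      have f: "A \<in> fmeasurable \<nu>" "A' \<in> fmeasurable \<nu>" using A by (auto simp: fmeasurable_def less_top)
      have "measure \<nu> (A \<inter> ?E) \<le> measure \<nu> ((A' \<inter> ?E) \<union> (A - A'))"
        by (rule measure_mono_fmeasurable)
          (use A E f in \<open>auto intro!: fmeasurable.Un fmeasurable_Diff fmeasurable_Int_fmeasurable\<close>)
      also have "\<dots> \<le> measure \<nu> (A' \<inter> ?E) + measure \<nu> (A - A')"
        by (rule measure_Un_le) (use A E in auto)
      finally show ?thesis .
    qed
    have fK: "emeasure \<nu> ?K \<noteq> \<infinity>" "emeasure \<nu> ?H \<noteq> \<infinity>" using fin cos k h by blast+
    have "measure \<nu> ?K = measure \<nu> ?H" using meas_eq k h by simp
    moreover have "measure \<nu> (?K \<inter> ?H) = measure \<nu> ?K - measure \<nu> (?K - ?H)"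
      "measure \<nu> (?H \<inter> ?K) = measure \<nu> ?H - measure \<nu> (?H - ?K)"
      by (intro m cos k h fK)+
    ultimately have "measure \<nu> (?H - ?K) = measure \<nu> (?K - ?H)" by (simp add: Int_commute)
    thus ?thesis
      using one[of ?K ?H] one[of ?H ?K] cos k h fK by (auto simp: abs_le_iff)
  qed
  have lim0: "(\<lambda>n. measure \<nu> ((C #> s n) - (C #> h))) \<longlonglongrightarrow> 0"
  proof -
    let ?f = "\<lambda>n. indicator ((C #> s n) - (C #> h)) :: 'g \<Rightarrow> real"
    have "(\<lambda>n. integral\<^sup>L \<nu> (?f n)) \<longlonglongrightarrow> integral\<^sup>L \<nu> (\<lambda>g. 0)"
    proof (rule integral_dominated_convergence[where w = "indicator ?D"])
      show "integrable \<nu> (indicator ?D :: 'g \<Rightarrow> real)"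
        using haar_compact_sets[OF D] haar_compact[OF D] by (simp add: less_top)
      show "?f n \<in> borel_measurable \<nu>" for n using cos s(2) h by auto
      show "AE g in \<nu>. (\<lambda>n. ?f n g) \<longlonglongrightarrow> 0"
      proof (rule AE_I2)
        fix g assume g: "g \<in> space \<nu>"
        show "(\<lambda>n. ?f n g) \<longlonglongrightarrow> 0"
        proof (cases "g \<in> C #> h")
          \<comment> \<open>Off \<open>C #> h\<close> the point \<open>g \<otimes> inv h\<close>
            lies in the open complement of \<open>C\<close>, and so does
            \<open>g \<otimes> inv (s n)\<close> for large \<open>n\<close>. On
            \<open>C #> h\<close> the indicator vanishes identically.\<close>
          case False
          have gG: "g \<in> carrier G" using g haar_space by simp
          have "g \<otimes> inv h \<notin> C" using False r_coset_eq_preimage[OF CG h] gG by auto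
          moreover have lim: "limitin \<tau> (\<lambda>n. g \<otimes> inv (s n)) (g \<otimes> inv h) sequentially"
            by (intro limitin_mult limitin_inv s) (simp add: gG topspace_eq)
          moreover have "openin \<tau> (topspace \<tau> - C)"
            using compactin_imp_closedin[OF Hausdorff C] by (simp add: closedin_def)
          ultimately have "\<forall>\<^sub>F n in sequentially. g \<otimes> inv (s n) \<in> topspace \<tau> - C"
            unfolding limitin_def by blast
          hence "\<forall>\<^sub>F n in sequentially. ?f n g = 0"
            by eventually_elim (use r_coset_eq_preimage[OF CG] s(2) in \<open>auto simp: indicator_def\<close>)
          thus ?thesis by (rule tendsto_eventually)
        qed simp
      qed
      show "AE g in \<nu>. norm (?f n g) \<le> indicator ?D g" for n
      proof -
        have "(C #> s n) - (C #> h) \<subseteq> ?D" by (force simp: r_coset_eq_image)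
        thus ?thesis by (auto simp: indicator_def)
      qed
    qed simp
    moreover have "integral\<^sup>L \<nu> (?f n) = measure \<nu> ((C #> s n) - (C #> h))" for n
    proof -
      have "((C #> s n) - (C #> h)) \<inter> space \<nu> = (C #> s n) - (C #> h)"
        using sets.sets_into_space[OF cos(2)[OF s(2)]] by blast
      thus ?thesis by simp
    qed
    ultimately show ?thesis by simp
  qed
  have "(\<lambda>n. visit_time C B (\<phi> (s n) x) - visit_time C B (\<phi> h x)) \<longlonglongrightarrow> 0"
  proof (rule Lim_null_comparison[OF always_eventually lim0], intro allI)
    fix n
    show "norm (visit_time C B (\<phi> (s n) x) - visit_time C B (\<phi> h x)) \<le> measure \<nu> ((C #> s n) - (C #> h))"
      using bound[OF s(2)[of n]] by (simp add: visit_time_translate[OF C B x] s(2) h)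
  qed
  thus ?thesis by (rule Lim_transform_within_set_eq[THEN iffD1] | simp add: LIM_zero_iff)+
qed

end

context haar_action
begin

text \<open>Equal times on the generator make the restrictions of Haar measure to the two sets of
  visits coincide, for each \<open>sep n\<close>. Hence for almost every \<open>g\<close>,
  \<open>\<phi> g z \<in> sep n\<close> implies \<open>\<phi> g y \<in> sep n\<close> for all
  \<open>n\<close>, so \<open>\<phi> g z = \<phi> g y\<close>, and \<open>\<phi> g\<close> is
  injective.\<close>

lemma visit_times_separate:
  fixes K :: "nat \<Rightarrow> 'g set"
  assumes \<C>: "\<And>C. C \<in> \<C> \<Longrightarrow> compactin \<tau> C" "Int_stable \<C>" "sigma_sets (carrier G) \<C> = sets (borel_of \<tau>)"
    and K: "range K \<subseteq> \<C>" "(\<Union>n. K n) = carrier G"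
    and zy: "z \<in> space M" "y \<in> space M"
    and eq: "\<And>C n. C \<in> \<C> \<Longrightarrow> visit_time C (sep n) z = visit_time C (sep n) y"
  shows "z = y"
proof -
  have "AE g in \<nu>. \<phi> g z \<in> sep n \<longrightarrow> \<phi> g y \<in> sep n" for n
  proof -
    let ?E = "\<lambda>x. {g \<in> carrier G. \<phi> g x \<in> sep n}" and ?d = "\<lambda>A. density \<nu> (indicator A)"
    have E: "?E z \<in> sets \<nu>" "?E y \<in> sets \<nu>" by (intro visits_sets zy sep_sets)+
    have d: "emeasure (?d (?E x)) C = ennreal (visit_time C (sep n) x)" if "x \<in> space M" "C \<in> \<C>" for x C
    proof -
      have C: "C \<in> sets \<nu>" "C \<subseteq> carrier G" "emeasure \<nu> C < \<infinity>"
        using that \<C>(1) haar_compact_sets compactin_carrier haar_compact by blast+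
      have "?E x \<inter> C = {g \<in> C. \<phi> g x \<in> sep n}" using C by auto
      moreover have "emeasure \<nu> (?E x \<inter> C) \<noteq> \<infinity>"
        using emeasure_mono[of "?E x \<inter> C" C \<nu>] C by (auto simp: top_unique)
      ultimately show ?thesis
        using emeasure_restricted[OF visits_sets[OF that(1) sep_sets] C(1)]
        by (simp add: visit_time_def emeasure_eq_ennreal_measure)
    qed
    have "?d (?E z) = ?d (?E y)"
    proof (rule measure_eqI_generator_eq[OF \<C>(2), of "carrier G" _ _ K])
      show "\<C> \<subseteq> Pow (carrier G)" using \<C>(1) compactin_carrier by blast
      show "emeasure (?d (?E z)) C = emeasure (?d (?E y)) C" if "C \<in> \<C>" for C
        using d[OF zy(1) that] d[OF zy(2) that] eq[OF that] by simp
      show "emeasure (?d (?E z)) (K i) \<noteq> \<infinity>" for i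
        using d[OF zy(1), of "K i"] K(1) by (simp add: image_subset_iff)
    qed (use \<C> K haar_sets in auto)
    hence "emeasure (?d (?E z)) (?E z - ?E y) = emeasure (?d (?E y)) (?E z - ?E y)" by simp
    moreover have "?E z \<inter> (?E z - ?E y) = ?E z - ?E y" "?E y \<inter> (?E z - ?E y) = {}" by blast+
    ultimately have "emeasure \<nu> (?E z - ?E y) = 0"
      unfolding emeasure_restricted[OF E(1) sets.Diff[OF E]] emeasure_restricted[OF E(2) sets.Diff[OF E]]
      by (simp only: emeasure_empty)
    hence "?E z - ?E y \<in> null_sets \<nu>" using E by (auto simp: null_sets_def)
    thus ?thesis by (rule AE_I') (auto simp: haar_space)
  qed
  hence "AE g in \<nu>. \<forall>n. \<phi> g z \<in> sep n \<longrightarrow> \<phi> g y \<in> sep n" by (simp add: AE_all_countable)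
  then obtain g where g: "g \<in> carrier G" "\<forall>n. \<phi> g z \<in> sep n \<longrightarrow> \<phi> g y \<in> sep n" using AE_haar_ex by blast
  have "\<phi> g z = \<phi> g y" using sep[of "\<phi> g z" "\<phi> g y"] g action_in zy by blast
  thus "z = y" using inj_prop[OF g(1)] zy by (auto dest: inj_onD)
qed

text \<open>Membership in one orbit, witnessed by a compact set of group elements, is a closed condition
  on the countably many visiting times, which are continuous along orbits; so the witness may be
  sought, approximately, in a countable dense set.\<close>

theorem orbit_rel_sets: "orbit_rel G M \<phi> \<in> sets (M \<Otimes>\<^sub>M M)"
proof -
  obtain K :: "nat \<Rightarrow> 'g set" where K: "\<And>n. compactin \<tau> (K n)" "incseq K" "(\<Union>n. K n) = carrier G"
    using compact_exhaustion by blast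
  obtain \<C> where C: "countable \<C>" "\<And>C. C \<in> \<C> \<Longrightarrow> compactin \<tau> C" "Int_stable \<C>" "range K \<subseteq> \<C>"
      "sigma_sets (carrier G) \<C> = sets (borel_of \<tau>)"
    using compact_generator[OF K] by blast
  define c where "c = from_nat_into \<C>"
  have ne: "\<C> \<noteq> {}" using C(4) by auto
  have c: "c i \<in> \<C>" for i unfolding c_def by (rule from_nat_into[OF ne])
  have c_surj: "\<exists>i. c i = A" if "A \<in> \<C>" for A
    unfolding c_def using from_nat_into_surj[OF C(1) that] by blast
  define F where "F i = visit_time (c (fst (prod_decode i))) (sep (snd (prod_decode i)))" for i
  have F_cong: "F (prod_encode (i, n)) = visit_time (c i) (sep n)" for i n by (simp add: F_def)
  have Fm: "F i \<in> borel_measurable M" for i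
    unfolding F_def by (intro visit_time_measurable haar_compact_sets C c sep_sets)
  have Fc: "(\<lambda>n. F i (\<phi> (s n) x)) \<longlonglongrightarrow> F i (\<phi> h x)"
    if "x \<in> space M" "limitin \<tau> s h sequentially" "\<And>n::nat. s n \<in> carrier G" for i x s h
    unfolding F_def by (intro visit_time_continuous C c sep_sets that)
  have sep: "z = y" if "z \<in> space M" "y \<in> space M" "\<And>i. F i z = F i y" for z y
  proof (rule visit_times_separate[OF C(2,3,5) C(4) K(3) that(1,2)])
    fix A n assume "A \<in> \<C>"
    then obtain i where "c i = A" using c_surj by blast
    thus "visit_time A (sep n) z = visit_time A (sep n) y" using that(3)[of "prod_encode (i, n)"] F_cong by simp
  qed
  have "\<exists>D. countable D \<and> D \<subseteq> K m \<and>
      (\<forall>h\<in>K m. \<exists>s. (\<forall>n::nat. s n \<in> D) \<and> limitin \<tau> s h sequentially)" for m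
    using dense_sequence[OF K(1)[of m]] by metis
  then obtain D where D: "\<And>m. countable (D m)" "\<And>m. D m \<subseteq> K m"
      "\<And>m h. h \<in> K m \<Longrightarrow> \<exists>s. (\<forall>n::nat. s n \<in> D m) \<and> limitin \<tau> s h sequentially" by metis
  have KG: "K m \<subseteq> carrier G" for m by (rule compactin_carrier[OF K(1)])
  define Q where "Q m = {p \<in> space (M \<Otimes>\<^sub>M M). \<forall>N. \<exists>h\<in>D m. \<forall>i\<in>{..N}.
      \<bar>F i (\<phi> h (fst p)) - F i (snd p)\<bar> < inverse (Suc N)}" for m
  have Qm: "Q m \<in> sets (M \<Otimes>\<^sub>M M)" for m
    unfolding Q_def
  proof (intro sets.sets_Collect_countable_All sets.sets_Collect_countable_Ex' sets.sets_Collect_finite_All D)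
    fix N h i assume "h \<in> D m"
    hence "h \<in> carrier G" using D(2) KG by blast
    hence "\<phi> h \<in> M \<rightarrow>\<^sub>M M" using measure_preserving by (simp add: mp_map_def)
    hence "(\<lambda>p. F i (\<phi> h (fst p)) - F i (snd p)) \<in> borel_measurable (M \<Otimes>\<^sub>M M)"
      using Fm by measurable
    thus "{p \<in> space (M \<Otimes>\<^sub>M M). \<bar>F i (\<phi> h (fst p)) - F i (snd p)\<bar> < inverse (Suc N)} \<in> sets (M \<Otimes>\<^sub>M M)"
      by measurable
  qed auto
  have "orbit_rel G M \<phi> = (\<Union>m. Q m)"
  proof (intro equalityI subsetI)
    fix p assume "p \<in> orbit_rel G M \<phi>"
    then obtain x h where p: "p = (x, \<phi> h x)" "x \<in> space M" "h \<in> carrier G"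
      by (auto simp: orbit_rel_def orbit_def)
    obtain m where m: "h \<in> K m" using K(3) p(3) by blast
    obtain s where s: "\<And>n::nat. s n \<in> D m" "limitin \<tau> s h sequentially" using D(3)[OF m] by blast
    have sG: "s n \<in> carrier G" for n using s D KG by blast
    have "\<exists>h'\<in>D m. \<forall>i\<in>{..N}. \<bar>F i (\<phi> h' x) - F i (\<phi> h x)\<bar> < inverse (Suc N)" for N
    proof -
      have "\<forall>\<^sub>F n in sequentially. \<bar>F i (\<phi> (s n) x) - F i (\<phi> h x)\<bar> < inverse (Suc N)" for i
        using tendstoD[OF Fc[OF p(2) s(2) sG], of "inverse (Suc N)" i] by (simp add: dist_real_def)
      hence "\<forall>\<^sub>F n in sequentially. \<forall>i\<in>{..N}. \<bar>F i (\<phi> (s n) x) - F i (\<phi> h x)\<bar> < inverse (Suc N)"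
        by (intro eventually_ball_finite) auto
      then obtain n where "\<forall>i\<in>{..N}. \<bar>F i (\<phi> (s n) x) - F i (\<phi> h x)\<bar> < inverse (Suc N)"
        by (auto simp: eventually_sequentially)
      thus ?thesis using s(1) by blast
    qed
    hence "p \<in> Q m" using p action_in by (simp add: Q_def space_pair_measure)
    thus "p \<in> (\<Union>m. Q m)" by blast
  next
    fix p assume "p \<in> (\<Union>m. Q m)"
    then obtain m where "p \<in> Q m" by blast
    then obtain x y where p: "p = (x, y)" "x \<in> space M" "y \<in> space M"
      "\<forall>N. \<exists>h\<in>D m. \<forall>i\<in>{..N}. \<bar>F i (\<phi> h x) - F i y\<bar> < inverse (Suc N)"
      by (auto simp: Q_def space_pair_measure simp del: of_nat_Suc)
    \<comment> \<open>The \<open>N\<close>-th witness is accurate to \<open>1/(N+1)\<close> on all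
      coordinates up to \<open>N\<close>, so each fixed coordinate converges along the whole
      sequence; compactness of \<open>K m\<close> supplies a limit of a subsequence of the
      witnesses.\<close>
    then obtain s where s: "\<And>N. s N \<in> D m"
      "\<And>N i. i \<le> N \<Longrightarrow> \<bar>F i (\<phi> (s N) x) - F i y\<bar> < inverse (Suc N)" by (metis atMost_iff)
    obtain h r where h: "h \<in> K m" "strict_mono r" "limitin \<tau> (s \<circ> r) h sequentially"
      using compact_subsequence[OF K(1)[of m], of s] s(1) D(2) by blast
    have hG: "h \<in> carrier G" using h KG by blast
    have "F i (\<phi> h x) = F i y" for i
    proof (rule LIMSEQ_unique)
      show "(\<lambda>n. F i (\<phi> ((s \<circ> r) n) x)) \<longlonglongrightarrow> F i (\<phi> h x)"
      proof (rule Fc[OF p(2) h(3)])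
        show "(s \<circ> r) n \<in> carrier G" for n using s(1)[of "r n"] D(2) KG by auto
      qed
      have "(\<lambda>n. F i (\<phi> (s n) x) - F i y) \<longlonglongrightarrow> 0"
      proof (rule Lim_null_comparison[OF _ LIMSEQ_inverse_real_of_nat])
        show "\<forall>\<^sub>F n in sequentially. norm (F i (\<phi> (s n) x) - F i y) \<le> inverse (real (Suc n))"
          using eventually_ge_at_top[of i] by eventually_elim (use s(2) less_imp_le in fastforce)
      qed
      hence "(\<lambda>n. F i (\<phi> (s n) x)) \<longlonglongrightarrow> F i y" by (simp add: LIM_zero_iff)
      from LIMSEQ_subseq_LIMSEQ[OF this h(2)] show "(\<lambda>n. F i (\<phi> ((s \<circ> r) n) x)) \<longlonglongrightarrow> F i y"
        by (simp add: o_def)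
    qed
    hence "\<phi> h x = y" using sep action_in hG p by blast
    thus "p \<in> orbit_rel G M \<phi>" using p hG by (auto simp: orbit_rel_def orbit_def)
  qed
  thus ?thesis using Qm by auto
qed

text \<open>If no \<open>g\<close> moved a part of \<open>a2\<close> of positive measure into
  \<open>a1\<close>, then by Fubini almost every point of \<open>a2\<close> would spend no Haar time
  in \<open>a1\<close>. The set of points spending positive time there is invariant, so by
  ergodicity it is null or conull: conull forces \<open>a2\<close> to be null, and null forces
  \<open>a1\<close> to be null.\<close>

lemma moving_element:
  assumes a: "a1 \<in> sets M" "a2 \<in> sets M" "0 < measure M a1" "0 < measure M a2"
  shows "\<exists>g\<in>carrier G. 0 < measure M {x \<in> a2. \<phi> g x \<in> a1}"
proof (rule ccontr)
  assume "\<not> ?thesis"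
  hence z: "measure M {x \<in> a2. \<phi> g x \<in> a1} = 0" if "g \<in> carrier G" for g
    using that measure_nonneg[of M] by (meson not_less order_antisym)
  have a2M: "a2 \<subseteq> space M" using a sets.sets_into_space by blast
  have act: "\<phi> g \<in> M \<rightarrow>\<^sub>M M" if "g \<in> carrier G" for g
    using measure_preserving that by (simp add: mp_map_def)
  have pre: "{x \<in> space M. \<phi> g x \<in> a1} \<in> sets M" if "g \<in> carrier G" for g
    using measurable_sets[OF act[OF that] a(1)] by (simp add: vimage_def Int_def conj_commute)
  have "AE g in \<nu>. AE x in M. \<not> (x \<in> a2 \<and> \<phi> g x \<in> a1)"
  proof (rule AE_I2)
    fix g assume "g \<in> space \<nu>"
    hence g: "g \<in> carrier G" by (simp add: haar_space)
    have "{x \<in> a2. \<phi> g x \<in> a1} = a2 \<inter> {x \<in> space M. \<phi> g x \<in> a1}" using a2M by auto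
    hence "{x \<in> a2. \<phi> g x \<in> a1} \<in> sets M" using a pre[OF g] by simp
    hence "{x \<in> a2. \<phi> g x \<in> a1} \<in> null_sets M" using z[OF g] by (simp add: null_sets_def emeasure_eq_measure)
    thus "AE x in M. \<not> (x \<in> a2 \<and> \<phi> g x \<in> a1)" by (rule AE_I') auto
  qed
  hence ae: "AE x in M. AE g in \<nu>. \<not> (x \<in> a2 \<and> \<phi> g x \<in> a1)"
    by (subst (asm) pair.AE_commute) (use haar_action_measurable a in measurable)
  \<comment> \<open>Positive Haar time replaces the mere existence of a visit: this makes the set
    Borel, and right translation of null sets makes it invariant.\<close>
  define E where "E = {x \<in> space M. \<not> (AE g in \<nu>. \<phi> g x \<notin> a1)}"
  have E_iff: "x \<in> E \<longleftrightarrow> emeasure \<nu> {g \<in> carrier G. \<phi> g x \<in> a1} \<noteq> 0" if "x \<in> space M" for x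
    using that AE_iff_measurable[OF visits_sets[OF that a(1)], of "\<lambda>g. \<phi> g x \<notin> a1"]
    by (simp add: E_def haar_space)
  have E: "E \<in> sets M"
  proof -
    have [measurable]: "(\<lambda>x. emeasure \<nu> {g \<in> carrier G. \<phi> g x \<in> a1}) \<in> borel_measurable M"
      using visits_measurable[OF sets.top a(1)] by (simp add: haar_space)
    have "{x \<in> space M. emeasure \<nu> {g \<in> carrier G. \<phi> g x \<in> a1} \<noteq> 0} \<in> sets M" by measurable
    moreover have "{x \<in> space M. emeasure \<nu> {g \<in> carrier G. \<phi> g x \<in> a1} \<noteq> 0} = E"
      using E_iff by (auto simp: E_def)
    ultimately show ?thesis by simp
  qed
  have E_inv: "\<phi> h x \<in> E" if "x \<in> E" "h \<in> carrier G" for x h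
  proof -
    have x: "x \<in> space M" "\<not> (AE g in \<nu>. \<phi> g x \<notin> a1)" using that by (auto simp: E_def)
    have "\<not> (AE g in \<nu>. \<phi> g (\<phi> h x) \<notin> a1)"
    proof
      assume "AE g in \<nu>. \<phi> g (\<phi> h x) \<notin> a1"
      hence "AE g in \<nu>. \<phi> (g \<otimes> inv h) (\<phi> h x) \<notin> a1" by (intro haar_AE_translate) (use that in auto)
      hence "AE g in \<nu>. \<phi> g x \<notin> a1"
      proof (rule AE_mp, intro AE_I2 impI)
        fix g assume "g \<in> space \<nu>" and n: "\<phi> (g \<otimes> inv h) (\<phi> h x) \<notin> a1"
        hence g: "g \<in> carrier G" by (simp add: haar_space)
        have "\<phi> (g \<otimes> inv h) (\<phi> h x) = \<phi> (g \<otimes> inv h \<otimes> h) x"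
          using composition_rule[OF x(1), of "g \<otimes> inv h" h] g that(2) by simp
        also have "g \<otimes> inv h \<otimes> h = g" using g that(2) by (simp add: m_assoc)
        finally show "\<phi> g x \<notin> a1" using n by simp
      qed
      thus False using x by blast
    qed
    thus ?thesis using action_in x that by (simp add: E_def)
  qed
  have "\<phi> h ` E = E" if h: "h \<in> carrier G" for h
  proof
    show "\<phi> h ` E \<subseteq> E" using E_inv h by blast
    show "E \<subseteq> \<phi> h ` E"
    proof
      fix x assume x: "x \<in> E"
      hence xM: "x \<in> space M" by (simp add: E_def)
      have "x = \<phi> h (\<phi> (inv h) x)"
        using composition_rule[OF xM h, of "inv h"] h xM fun_cong[OF id_eq_one, of x] by simp
      thus "x \<in> \<phi> h ` E" using E_inv[OF x, of "inv h"] h by blast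
    qed
  qed
  from ergodic[OF E this] show False
  proof
    assume "measure M E = 1"
    hence "AE x in M. x \<in> E" using E by (simp add: prob_eq_1)
    hence "AE x in M. x \<notin> a2" using ae by eventually_elim (auto simp: E_def)
    hence "measure M a2 = 0" using AE_iff_null_sets[OF a(2)] by (simp add: null_sets_def measure_def)
    thus False using a by simp
  next
    assume "measure M E = 0"
    hence "E \<in> null_sets M" using E by (simp add: null_sets_def emeasure_eq_measure)
    hence "AE x in M. AE g in \<nu>. \<phi> g x \<notin> a1" by (rule AE_I') (auto simp: E_def)
    hence "AE g in \<nu>. AE x in M. \<phi> g x \<notin> a1"
      by (subst pair.AE_commute) (use haar_action_measurable a in measurable)
    then obtain g where g: "g \<in> carrier G" "AE x in M. \<phi> g x \<notin> a1" using AE_haar_ex by blast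
    have "emeasure M a1 = emeasure M {x \<in> space M. \<phi> g x \<in> a1}"
      using emeasure_distr[OF act[OF g(1)] a(1)] measure_preserving[OF g(1)]
      by (simp add: mp_map_def vimage_def Int_def conj_commute)
    also have "\<dots> = 0" using g(2) AE_iff_measurable[OF pre[OF g(1)], of "\<lambda>x. \<phi> g x \<notin> a1"] by simp
    finally show False using a by (simp add: emeasure_eq_measure)
  qed
qed

text \<open>If two points \<open>x\<close> and \<open>g\<^sub>0 x\<close> both are typical, a common translate shows that their images are
  related, so a condition that holds for each \<open>g\<close> almost everywhere holds everywhere on a conull
  set.\<close>

lemma AE_uniform_on_orbits:
  assumes R: "R \<in> sets (M \<Otimes>\<^sub>M M)" "equiv (space M) R" and S: "S \<in> M \<rightarrow>\<^sub>M M"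
    and ae: "\<And>g. g \<in> carrier G \<Longrightarrow> AE x in M. (S x, S (\<phi> g x)) \<in> R"
  shows "\<exists>A. (AE x in M. x \<in> A) \<and> (\<forall>x\<in>A. \<forall>y\<in>A. (x, y) \<in> orbit_rel G M \<phi> \<longrightarrow> (S x, S y) \<in> R)"
proof -
  let ?A = "{x \<in> space M. AE g in \<nu>. (S x, S (\<phi> g x)) \<in> R}"
  have "AE g in \<nu>. AE x in M. (S x, S (\<phi> g x)) \<in> R"
    by (rule AE_I2) (use ae haar_space in auto)
  moreover have "{z \<in> space (\<nu> \<Otimes>\<^sub>M M). (S (snd z), S (\<phi> (fst z) (snd z))) \<in> R} \<in> sets (\<nu> \<Otimes>\<^sub>M M)"
    using haar_action_measurable S R(1) by measurable
  ultimately have "AE x in M. AE g in \<nu>. (S x, S (\<phi> g x)) \<in> R"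
    by (subst (asm) pair.AE_commute) auto
  hence "AE x in M. x \<in> ?A" using AE_space by eventually_elim simp
  moreover have "(S x, S y) \<in> R" if A: "x \<in> ?A" "y \<in> ?A" and xy: "(x, y) \<in> orbit_rel G M \<phi>" for x y
  proof -
    obtain h where h: "h \<in> carrier G" "y = \<phi> h x" using xy by (auto simp: orbit_rel_def orbit_def)
    have "AE g in \<nu>. (S x, S (\<phi> (g \<otimes> h) x)) \<in> R"
      by (rule haar_AE_translate[OF h(1)]) (use A in auto)
    moreover have "AE g in \<nu>. (S y, S (\<phi> g y)) \<in> R" using A by auto
    ultimately have "AE g in \<nu>. (S x, S (\<phi> (g \<otimes> h) x)) \<in> R \<and> (S y, S (\<phi> g y)) \<in> R"
      by eventually_elim simp
    then obtain g where g: "g \<in> carrier G" "(S x, S (\<phi> (g \<otimes> h) x)) \<in> R" "(S y, S (\<phi> g y)) \<in> R"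
      using AE_haar_ex by blast
    have "\<phi> g y = \<phi> (g \<otimes> h) x" using composition_rule[of x g h] A g h by simp
    thus ?thesis using g R(2) by (metis equiv_def symD transD)
  qed
  ultimately show ?thesis by blast
qed

end

lemma (in pmp_ergodic_action) haar_action_exists: "\<exists>\<nu>. haar_action G \<tau> M \<phi> \<nu>"
proof -
  obtain \<nu> where \<nu>: "sets \<nu> = sets (borel_of \<tau>)" "space \<nu> = carrier G" "sigma_finite_measure \<nu>"
    "\<And>K. compactin \<tau> K \<Longrightarrow> emeasure \<nu> K < \<infinity>" "emeasure \<nu> (carrier G) \<noteq> 0"
    "\<And>x. x \<in> carrier G \<Longrightarrow> (\<lambda>g. g \<otimes> x) \<in> \<nu> \<rightarrow>\<^sub>M \<nu>"
    "\<And>x. x \<in> carrier G \<Longrightarrow> distr \<nu> \<nu> (\<lambda>g. g \<otimes> x) = \<nu>"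
    using haar_measure by blast
  interpret sigma_finite_measure \<nu> by (rule \<nu>)
  have "haar_action G \<tau> M \<phi> \<nu>"
    by (intro haar_action.intro haar_action_axioms.intro pmp_ergodic_action_axioms
        sigma_finite_measure_axioms \<nu>)
  thus ?thesis by blast
qed

section \<open>Full groups\<close>

lemma mp_bij: "T \<in> carrier (mp_group M) \<Longrightarrow> bij_betw T (space M) (space M)"
  by (simp add: mp_carrier mp_bijection_def)

lemma mp_inj: "T \<in> carrier (mp_group M) \<Longrightarrow> x \<in> space M \<Longrightarrow> y \<in> space M \<Longrightarrow> T x = T y \<longleftrightarrow> x = y"
  using mp_bij[of T M] by (auto simp: bij_betw_def dest: inj_onD)

lemma mp_measurable: "T \<in> carrier (mp_group M) \<Longrightarrow> T \<in> M \<rightarrow>\<^sub>M M"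
  by (simp add: mp_carrier mp_bijection_def mp_map_def)

lemma mp_emeasure_preimage:
  assumes "T \<in> carrier (mp_group M)" "B \<in> sets M"
  shows "emeasure M (T -` B \<inter> space M) = emeasure M B"
  using emeasure_distr[OF mp_measurable[OF assms(1)] assms(2)] assms(1)
  by (simp add: mp_carrier mp_bijection_def mp_map_def)

lemma mp_image_sets:
  assumes T: "T \<in> carrier (mp_group M)" and B: "B \<in> sets M" shows "T ` B \<in> sets M"
proof -
  have b: "bij_betw T (space M) (space M)" by (rule mp_bij[OF T])
  have "T ` B = inv_into (space M) T -` B \<inter> space M"
    using b sets.sets_into_space[OF B] bij_betw_inv_into_left[OF b] bij_betw_inv_into_right[OF b]
    by (auto simp: bij_betw_def image_iff) (metis subsetD)+
  thus ?thesis using T B by (auto simp: mp_carrier mp_bijection_def intro: measurable_sets)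
qed

lemma mp_emeasure_image:
  assumes T: "T \<in> carrier (mp_group M)" and B: "B \<in> sets M"
  shows "emeasure M (T ` B) = emeasure M B"
proof -
  have "T -` (T ` B) \<inter> space M = B" using mp_inj[OF T] sets.sets_into_space[OF B] by blast
  thus ?thesis using mp_emeasure_preimage[OF T mp_image_sets[OF T B]] by simp
qed

lemma mp_inverse:
  assumes T: "T \<in> carrier (mp_group M)"
  obtains T' where "T' \<in> carrier (mp_group M)" "\<And>x. x \<in> space M \<Longrightarrow> T (T' x) = x"
    "\<And>x. x \<in> space M \<Longrightarrow> T' (T x) = x"
proof -
  interpret group "mp_group M" by (rule group_mp_group)
  have I: "inv\<^bsub>mp_group M\<^esub> T \<in> carrier (mp_group M)" using T by simp
  show thesis
  proof (rule that[OF I])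
    fix x assume x: "x \<in> space M"
    show "T ((inv\<^bsub>mp_group M\<^esub> T) x) = x"
      using fun_cong[OF r_inv[OF T], of x] x by (simp add: mp_mult[OF T I] mp_one)
    show "(inv\<^bsub>mp_group M\<^esub> T) (T x) = x"
      using fun_cong[OF l_inv[OF T], of x] x by (simp add: mp_mult[OF I T] mp_one)
  qed
qed

abbreviation mcomp :: "'a measure \<Rightarrow> ('a \<Rightarrow> 'a) \<Rightarrow> ('a \<Rightarrow> 'a) \<Rightarrow> 'a \<Rightarrow> 'a" where
  "mcomp M S T \<equiv> (\<lambda>x\<in>space M. S (T x))"

lemma mcomp_carrier:
  assumes "S \<in> carrier (mp_group M)" "T \<in> carrier (mp_group M)"
  shows "mcomp M S T \<in> carrier (mp_group M)"
  using monoid.m_closed[OF group.is_monoid[OF group_mp_group] assms] by (simp add: mp_mult assms)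

lemma mp_id: "(\<lambda>x\<in>space M. x) \<in> carrier (mp_group M)"
  using monoid.one_closed[OF group.is_monoid[OF group_mp_group[of M]]] by (simp add: mp_one)

lemma UN_case_nat: "(\<Union>i. case_nat a A i) = a \<union> (\<Union>i. A i)"
proof (intro equalityI subsetI)
  fix x assume "x \<in> (\<Union>i. case_nat a A i)"
  then obtain i where "x \<in> case_nat a A i" by blast
  thus "x \<in> a \<union> (\<Union>i. A i)" by (cases i) auto
next
  fix x assume "x \<in> a \<union> (\<Union>i. A i)"
  hence "x \<in> case_nat a A 0 \<or> (\<exists>i. x \<in> case_nat a A (Suc i))" by auto
  thus "x \<in> (\<Union>i. case_nat a A i)" by blast
qed

lemma disjoint_family_case_nat:
  assumes "disjoint_family A" "a \<inter> (\<Union>i. A i) = {}"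
  shows "disjoint_family (case_nat a A)"
proof -
  have "case_nat a A i \<inter> case_nat a A j = {}" if "i \<noteq> j" for i j
    using assms that unfolding disjoint_family_on_def by (cases i; cases j) (simp_all, blast+)
  thus ?thesis by (simp add: disjoint_family_on_def)
qed

text \<open>Cutting and pasting along countable partitions. Since the pieces and their images both
  partition the space, the glued map is a bijection, and countable additivity makes it measure
  preserving.\<close>

lemma glue:
  assumes T: "\<And>i::nat. T i \<in> carrier (mp_group M)" and A: "\<And>i. A i \<in> sets M"
    and dA: "disjoint_family A" and UA: "(\<Union>i. A i) = space M"
    and dT: "disjoint_family (\<lambda>i. T i ` A i)" and UT: "(\<Union>i. T i ` A i) = space M"
  shows "\<exists>S\<in>carrier (mp_group M). \<forall>i. \<forall>x\<in>A i. S x = T i x"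
proof -
  define S where "S = (\<lambda>x\<in>space M. T (THE i. x \<in> A i) x)"
  have the: "(THE i. x \<in> A i) = i" if "x \<in> A i" for x i
    using that dA by (intro the_equality) (auto simp: disjoint_family_on_def)
  have sub: "A i \<subseteq> space M" for i using A sets.sets_into_space by blast
  have S: "S x = T i x" if "x \<in> A i" for i x using that sub the by (auto simp: S_def)
  have inj: "x = y" if xy: "x \<in> space M" "y \<in> space M" "S x = S y" for x y
  proof -
    obtain i j where ij: "x \<in> A i" "y \<in> A j" using xy UA by blast
    have "T i x = T j y" using S ij xy by metis
    hence "i = j" using dT ij unfolding disjoint_family_on_def by blast
    thus ?thesis using \<open>T i x = T j y\<close> mp_inj[OF T] xy by blast
  qed
  have "S ` A i = T i ` A i" for i using S by (intro image_cong) auto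
  hence "S ` space M = (\<Union>i. T i ` A i)" unfolding UA[symmetric] image_UN by simp
  hence bij: "bij_betw S (space M) (space M)" using UT inj by (auto simp: bij_betw_def inj_on_def)
  have pre: "S -` B \<inter> space M = (\<Union>i. A i \<inter> (T i -` B \<inter> space M))" for B
  proof (intro equalityI subsetI)
    fix x assume x: "x \<in> S -` B \<inter> space M"
    then obtain i where "x \<in> A i" using UA by blast
    thus "x \<in> (\<Union>i. A i \<inter> (T i -` B \<inter> space M))" using x S by auto
  qed (use S sub in auto)
  have im: "T i ` (A i \<inter> (T i -` B \<inter> space M)) = T i ` A i \<inter> B" for i B using sub[of i] by auto
  have m: "A i \<inter> (T i -` B \<inter> space M) \<in> sets M" if "B \<in> sets M" for i B
    using A measurable_sets[OF mp_measurable[OF T] that] by auto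
  have Sm: "S \<in> M \<rightarrow>\<^sub>M M"
  proof (rule measurableI)
    show "S x \<in> space M" if "x \<in> space M" for x using bij that by (auto simp: bij_betw_def)
    show "S -` B \<inter> space M \<in> sets M" if "B \<in> sets M" for B unfolding pre using m[OF that] by auto
  qed
  have "distr M M S = M"
  proof (rule measure_eqI)
    fix B assume "B \<in> sets (distr M M S)"
    hence B: "B \<in> sets M" by simp
    have "emeasure (distr M M S) B = emeasure M (\<Union>i. A i \<inter> (T i -` B \<inter> space M))"
      using emeasure_distr[OF Sm B] by (simp add: pre)
    also have "\<dots> = (\<Sum>i. emeasure M (A i \<inter> (T i -` B \<inter> space M)))"
      by (rule suminf_emeasure[symmetric]) (use m[OF B] dA in \<open>auto simp: disjoint_family_on_def\<close>)
    also have "\<dots> = (\<Sum>i. emeasure M (T i ` A i \<inter> B))"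
      by (intro suminf_cong) (metis mp_emeasure_image[OF T m[OF B]] im)
    also have "\<dots> = emeasure M (\<Union>i. T i ` A i \<inter> B)"
    proof (rule suminf_emeasure)
      show "disjoint_family (\<lambda>i. T i ` A i \<inter> B)"
        by (rule disjoint_family_subset[OF dT]) (rule Int_lower1)
    qed (use B mp_image_sets[OF T A] in auto)
    also have "(\<Union>i. T i ` A i \<inter> B) = B"
      using sets.sets_into_space[OF B] by (simp only: Int_commute[of _ B] flip: Int_UN_distrib) (simp add: UT Int_absorb2)
    finally show "emeasure (distr M M S) B = emeasure M B" .
  qed simp
  moreover have "inv_into (space M) S \<in> M \<rightarrow>\<^sub>M M"
  proof (rule measurableI)
    show "inv_into (space M) S x \<in> space M" if "x \<in> space M" for x
      using bij_betw_inv_into[OF bij] that by (auto simp: bij_betw_def)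
    fix B assume B: "B \<in> sets M"
    have BM: "B \<subseteq> space M" by (rule sets.sets_into_space[OF B])
    have "inv_into (space M) S -` B \<inter> space M = S ` B"
    proof (intro equalityI subsetI)
      fix x assume "x \<in> inv_into (space M) S -` B \<inter> space M"
      thus "x \<in> S ` B" using bij_betw_inv_into_right[OF bij, of x] by (metis IntE image_eqI vimageE)
    next
      fix x assume "x \<in> S ` B"
      then obtain y where y: "y \<in> B" "x = S y" by blast
      moreover have "y \<in> space M" using y BM by blast
      ultimately show "x \<in> inv_into (space M) S -` B \<inter> space M"
        using bij_betw_inv_into_left[OF bij, of y] bij by (auto simp: bij_betw_def)
    qed
    also have "S ` B = (\<Union>i. T i ` (A i \<inter> B))"
      using S UA BM by (auto simp: image_iff) (metis IntI UN_E subsetD)+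
    also have "\<dots> \<in> sets M" using mp_image_sets[OF T] A B by auto
    finally show "inv_into (space M) S -` B \<inter> space M \<in> sets M" .
  qed
  ultimately have "S \<in> carrier (mp_group M)"
    using bij Sm by (simp add: mp_carrier mp_bijection_def mp_map_def S_def)
  thus ?thesis using S by blast
qed

text \<open>The full group on the level of maps. Computations are done with these representatives,
  which are bijections everywhere; the quotient by null sets enters through
  \<open>cls\<close>.\<close>

definition fgroup :: "'a measure \<Rightarrow> ('a \<times> 'a) set \<Rightarrow> ('a \<Rightarrow> 'a) set" where
  "fgroup M R = {T \<in> carrier (mp_group M). AE x in M. (x, T x) \<in> R}"

lemma fgroup_mp: "T \<in> fgroup M R \<Longrightarrow> T \<in> carrier (mp_group M)"
  by (simp add: fgroup_def)

lemma full_group_carrier: "carrier (full_group M R) = aut_class M ` fgroup M R"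
  by (auto simp: full_group_def fgroup_def)

lemma full_group_mult:
  assumes "S \<in> fgroup M R" "T \<in> fgroup M R"
  shows "aut_class M S \<otimes>\<^bsub>full_group M R\<^esub> aut_class M T = aut_class M (mcomp M S T)"
  using aut_class_mult[of S M T] assms by (simp add: full_group_def fgroup_def)

lemma full_group_one: "\<one>\<^bsub>full_group M R\<^esub> = aut_class M (\<lambda>x\<in>space M. x)"
proof -
  interpret A: group "aut_group M" by (rule group_aut_group)
  let ?I = "aut_class M (\<lambda>x\<in>space M. x)"
  have I: "?I \<in> carrier (aut_group M)" using mp_id[of M] by (auto simp: aut_group_carrier)
  have "?I \<otimes>\<^bsub>aut_group M\<^esub> ?I = ?I"
    by (subst aut_class_mult[OF mp_id mp_id]) (auto intro!: arg_cong[where f = "aut_class M"])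
  hence "?I = \<one>\<^bsub>aut_group M\<^esub>" using I by (simp add: A.l_cancel_one')
  thus ?thesis by (simp add: full_group_def)
qed

section \<open>Cutting and pasting inside a full group\<close>

locale equiv_prob = prob_space M for M :: "'a measure" + fixes R :: "('a \<times> 'a) set"
  assumes equiv: "equiv (space M) R"
begin

abbreviation "cls \<equiv> aut_class M"
abbreviation "fg \<equiv> fgroup M R"
abbreviation "K \<equiv> full_group M R"
abbreviation comp (infixl "\<star>" 70) where "S \<star> T \<equiv> mcomp M S T"

lemma R_sym: "(x, y) \<in> R \<Longrightarrow> (y, x) \<in> R"
  and R_trans: "(x, y) \<in> R \<Longrightarrow> (y, z) \<in> R \<Longrightarrow> (x, z) \<in> R"
  and R_refl: "x \<in> space M \<Longrightarrow> (x, x) \<in> R"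
  using equiv by (auto simp: equiv_def refl_on_def dest: symD transD)

lemma fg_space: "T \<in> fg \<Longrightarrow> x \<in> space M \<Longrightarrow> T x \<in> space M"
  by (rule mp_space[OF fgroup_mp])

lemma fg_AE: "T \<in> fg \<Longrightarrow> AE x in M. P x \<Longrightarrow> AE x in M. P (T x)"
  by (rule mp_AE[OF fgroup_mp])

lemma fg_inj: "T \<in> fg \<Longrightarrow> x \<in> space M \<Longrightarrow> y \<in> space M \<Longrightarrow> T x = T y \<longleftrightarrow> x = y"
  by (rule mp_inj[OF fgroup_mp])

lemma fg_preimage: "T \<in> fg \<Longrightarrow> B \<in> sets M \<Longrightarrow> T -` B \<inter> space M \<in> sets M"
  by (rule measurable_sets[OF mp_measurable[OF fgroup_mp]])

lemma fg_id: "(\<lambda>x\<in>space M. x) \<in> fg"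
  using AE_space by (auto simp: fgroup_def mp_id elim!: eventually_mono intro: R_refl)

lemma fg_comp:
  assumes "S \<in> fg" "T \<in> fg" shows "S \<star> T \<in> fg"
proof -
  have "AE x in M. (x, T x) \<in> R" "AE x in M. (x, S x) \<in> R" using assms by (auto simp: fgroup_def)
  hence "AE x in M. (x, (S \<star> T) x) \<in> R"
    using fg_AE[OF assms(2), of "\<lambda>x. (x, S x) \<in> R"] AE_space
    by (auto elim!: eventually_elim2 intro: R_trans)
  thus ?thesis using assms mcomp_carrier by (auto simp: fgroup_def)
qed

lemma fg_inverse:
  assumes T: "T \<in> fg"
  obtains T' where "T' \<in> fg" "\<And>x. x \<in> space M \<Longrightarrow> T (T' x) = x" "\<And>x. x \<in> space M \<Longrightarrow> T' (T x) = x"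
proof -
  obtain T' where T': "T' \<in> carrier (mp_group M)" "\<And>x. x \<in> space M \<Longrightarrow> T (T' x) = x"
      "\<And>x. x \<in> space M \<Longrightarrow> T' (T x) = x"
    using mp_inverse[OF fgroup_mp[OF T]] by metis
  have "AE x in M. (x, T x) \<in> R" using T by (simp add: fgroup_def)
  hence "AE x in M. (T' x, T (T' x)) \<in> R" by (rule mp_AE[OF T'(1)])
  hence "AE x in M. (x, T' x) \<in> R" using AE_space by eventually_elim (simp add: T' R_sym)
  thus thesis using that[of T'] T' by (simp add: fgroup_def)
qed

lemma fg_glue:
  assumes T: "\<And>i::nat. T i \<in> fg" and A: "\<And>i. A i \<in> sets M"
    and dA: "disjoint_family A"
    and dT: "disjoint_family (\<lambda>i. T i ` A i)" and UT: "(\<Union>i. T i ` A i) = (\<Union>i. A i)"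
  shows "\<exists>S\<in>fg. (\<forall>i. \<forall>x\<in>A i. S x = T i x) \<and> (\<forall>x\<in>space M - (\<Union>i. A i). S x = x)"
proof -
  let ?rest = "space M - (\<Union>i. A i)" and ?id = "\<lambda>x\<in>space M. x"
  \<comment> \<open>Index 0 carries the complement of all pieces with the identity map, and the
    given pieces move up by one; the images still partition the space because \<open>UT\<close> says
    that pieces and images have the same union.\<close>
  define A' where "A' = case_nat ?rest A"
  define T' where "T' = case_nat ?id T"
  have sub: "A i \<subseteq> space M" for i using A sets.sets_into_space by blast
  have im: "T' i ` A' i = case_nat ?rest (\<lambda>i. T i ` A i) i" for i
    by (auto simp: A'_def T'_def split: nat.split)
  have subT: "T i ` A i \<subseteq> (\<Union>i. A i)" for i using UT by blast
  have T'fg: "T' i \<in> fg" for i using T fg_id by (simp add: T'_def split: nat.split)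
  have "\<exists>S\<in>carrier (mp_group M). \<forall>i. \<forall>x\<in>A' i. S x = T' i x"
  proof (rule glue[of T' M A'])
    show "T' i \<in> carrier (mp_group M)" for i using T'fg fgroup_mp by blast
    show "A' i \<in> sets M" for i using A by (auto simp: A'_def split: nat.split)
    show "disjoint_family A'"
      unfolding A'_def by (rule disjoint_family_case_nat[OF dA]) auto
    show "(\<Union>i. A' i) = space M"
      unfolding A'_def UN_case_nat using sub by auto
    show "disjoint_family (\<lambda>i. T' i ` A' i)"
      unfolding im by (rule disjoint_family_case_nat[OF dT]) (use UT in auto)
    show "(\<Union>i. T' i ` A' i) = space M"
    proof -
      have "(\<Union>i. T' i ` A' i) = ?rest \<union> (\<Union>i. T i ` A i)"
        unfolding im by (rule UN_case_nat)
      thus ?thesis using UT sub by auto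
    qed
  qed
  then obtain S where S: "S \<in> carrier (mp_group M)" "\<And>i x. x \<in> A' i \<Longrightarrow> S x = T' i x" by blast
  have "AE x in M. \<forall>i. (x, T' i x) \<in> R"
    unfolding AE_all_countable using T'fg by (simp add: fgroup_def)
  hence "AE x in M. (x, S x) \<in> R" using AE_space
  proof eventually_elim
    case (elim x)
    show ?case
    proof (cases "x \<in> (\<Union>i. A i)")
      case True
      then obtain i where "x \<in> A i" by blast
      hence "S x = T' (Suc i) x" by (intro S(2)) (simp add: A'_def)
      thus ?thesis using elim by simp
    next
      case False
      hence "S x = T' 0 x" using elim by (intro S(2)) (simp add: A'_def)
      thus ?thesis using elim by simp
    qed
  qed
  hence "S \<in> fg" using S(1) by (simp add: fgroup_def)
  moreover have "S x = T i x" if "x \<in> A i" for i x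
    using S(2)[of x "Suc i"] that by (simp add: A'_def T'_def)
  moreover have "S x = x" if "x \<in> space M" "x \<notin> (\<Union>i. A i)" for x
    using S(2)[of x 0] that by (simp add: A'_def T'_def)
  ultimately show ?thesis by blast
qed

text \<open>Glue \<open>T\<close> on \<open>C\<close>, the inverse of \<open>T\<close> on the image
  of \<open>C\<close>, and the identity elsewhere.\<close>

lemma fg_swap:
  assumes T: "T \<in> fg" and C: "C \<in> sets M" and d: "T ` C \<inter> C = {}"
  obtains S where "S \<in> fg" "\<And>x. x \<in> space M \<Longrightarrow> S (S x) = x" "\<And>x. x \<in> C \<Longrightarrow> S x = T x"
    "\<And>x. x \<in> space M \<Longrightarrow> x \<notin> C \<union> T ` C \<Longrightarrow> S x = x"
proof -
  obtain T' where T': "T' \<in> fg" "\<And>x. x \<in> space M \<Longrightarrow> T (T' x) = x" "\<And>x. x \<in> space M \<Longrightarrow> T' (T x) = x"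
    using fg_inverse[OF T] by metis
  have CM: "C \<subseteq> space M" by (rule sets.sets_into_space[OF C])
  let ?A = "\<lambda>i::nat. if i = 0 then C else if i = 1 then T ` C else {}"
  let ?T = "\<lambda>i::nat. if i = 0 then T else T'"
  have T'C: "T' ` T ` C = C" using T'(3) CM by (force simp: image_image)
  have UA: "(\<Union>i. ?A i) = C \<union> T ` C" by (auto split: if_splits)
  have im: "?T i ` ?A i = (if i = 0 then T ` C else if i = 1 then C else {})" for i using T'C by auto
  have "\<exists>S\<in>fg. (\<forall>i. \<forall>x\<in>?A i. S x = ?T i x) \<and> (\<forall>x\<in>space M - (\<Union>i. ?A i). S x = x)"
  proof (rule fg_glue[of ?T ?A])
    show "?A i \<in> sets M" for i using C mp_image_sets[OF fgroup_mp[OF T] C] by auto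
    show "disjoint_family ?A" using d by (auto simp: disjoint_family_on_def)
    show "disjoint_family (\<lambda>i. ?T i ` ?A i)" unfolding im using d by (auto simp: disjoint_family_on_def)
    show "(\<Union>i. ?T i ` ?A i) = (\<Union>i. ?A i)" unfolding im UA by (auto split: if_splits)
  qed (use T T' in auto)
  then obtain S where S: "S \<in> fg" "\<And>i x. x \<in> ?A i \<Longrightarrow> S x = ?T i x"
    "\<And>x. x \<in> space M \<Longrightarrow> x \<notin> (\<Union>i. ?A i) \<Longrightarrow> S x = x" by blast
  have S1: "S x = T x" if "x \<in> C" for x using S(2)[of x 0] that by simp
  have S2: "S x = T' x" if "x \<in> T ` C" for x using S(2)[of x 1] that by simp
  have S3: "S x = x" if "x \<in> space M" "x \<notin> C \<union> T ` C" for x using S(3)[OF that(1)] that(2) UA by simp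
  have "S (S x) = x" if x: "x \<in> space M" for x
  proof -
    consider "x \<in> C" | "x \<in> T ` C" | "x \<notin> C \<union> T ` C" by blast
    thus ?thesis
    proof cases
      case 1 thus ?thesis using S1 S2[of "T x"] T'(3)[OF x] by simp
    next
      case 2
      then obtain y where y: "y \<in> C" "x = T y" by blast
      hence "S x = y" using S2[OF 2] T'(3)[of y] CM by auto
      thus ?thesis using S1[OF y(1)] y by simp
    next
      case 3 thus ?thesis using S3[OF x] by simp
    qed
  qed
  thus thesis using that S(1) S1 S3 by blast
qed

lemma fg_restrict:
  assumes T: "T \<in> fg" and B: "B \<in> sets M" and inv: "\<And>x. x \<in> space M \<Longrightarrow> T x \<in> B \<longleftrightarrow> x \<in> B"
  obtains S where "S \<in> fg" "\<And>x. x \<in> space M \<Longrightarrow> S x = (if x \<in> B then T x else x)"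
proof -
  let ?A = "\<lambda>i::nat. if i = 0 then B else {}"
  have BM: "B \<subseteq> space M" by (rule sets.sets_into_space[OF B])
  have TB: "T ` B = B"
  proof
    show "T ` B \<subseteq> B" using inv BM by auto
    show "B \<subseteq> T ` B"
    proof
      fix y assume y: "y \<in> B"
      then obtain x where "x \<in> space M" "y = T x"
        using mp_bij[OF fgroup_mp[OF T]] BM by (auto simp: bij_betw_def)
      thus "y \<in> T ` B" using inv y by blast
    qed
  qed
  have "\<exists>S\<in>fg. (\<forall>i. \<forall>x\<in>?A i. S x = T x) \<and> (\<forall>x\<in>space M - (\<Union>i. ?A i). S x = x)"
    by (rule fg_glue[of "\<lambda>_. T" ?A])
      (use T B TB in \<open>auto simp: disjoint_family_on_def split: if_splits\<close>)
  then obtain S where S: "S \<in> fg" "\<And>i x. x \<in> ?A i \<Longrightarrow> S x = T x"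
    "\<And>x. x \<in> space M \<Longrightarrow> x \<notin> (\<Union>i. ?A i) \<Longrightarrow> S x = x" by blast
  have "S x = (if x \<in> B then T x else x)" if "x \<in> space M" for x
    using S(2)[of x 0] S(3)[OF that] by (auto split: if_splits)
  thus thesis using that S(1) by blast
qed

lemma cls_eq_iff: "S \<in> fg \<Longrightarrow> T \<in> fg \<Longrightarrow> cls S = cls T \<longleftrightarrow> (AE x in M. S x = T x)"
  by (simp add: aut_class_eq_iff fgroup_mp)

lemma cls_mult: "S \<in> fg \<Longrightarrow> T \<in> fg \<Longrightarrow> cls S \<otimes>\<^bsub>K\<^esub> cls T = cls (S \<star> T)"
  by (rule full_group_mult)

lemma cls_mult_eq_iff:
  assumes "S \<in> fg" "T \<in> fg" "U \<in> fg" "V \<in> fg"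
  shows "cls S \<otimes>\<^bsub>K\<^esub> cls T = cls U \<otimes>\<^bsub>K\<^esub> cls V \<longleftrightarrow> (AE x in M. S (T x) = U (V x))"
  unfolding cls_mult[OF assms(1,2)] cls_mult[OF assms(3,4)]
    cls_eq_iff[OF fg_comp[OF assms(1,2)] fg_comp[OF assms(3,4)]] by (intro AE_cong) simp

lemma cls_mult_one_iff:
  assumes "S \<in> fg" "T \<in> fg"
  shows "cls S \<otimes>\<^bsub>K\<^esub> cls T = \<one>\<^bsub>K\<^esub> \<longleftrightarrow> (AE x in M. S (T x) = x)"
  unfolding cls_mult[OF assms] full_group_one
    cls_eq_iff[OF fg_comp[OF assms] fg_id] by (intro AE_cong) simp

lemma group_K: "group K"
  using subgroup.subgroup_is_group[OF subgroup_full_group[OF equiv] group_aut_group]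
  by (simp add: full_group_def)

lemma K_carrier: "carrier K = cls ` fg"
  by (rule full_group_carrier)

end

text \<open>A greedy choice: each step takes a member of \<open>F\<close> inside the remainder whose
  measure is at least half of what any member fitting there can have; the empty set stands in when
  no member of positive measure fits. The chosen sets are disjoint, so their measures tend to 0, and
  a member of \<open>F\<close> fitting into the final remainder would have measure 0.\<close>

lemma (in finite_measure) exhaustion:
  assumes F: "F \<subseteq> sets M" and a: "a \<in> sets M"
    and ex: "\<And>b. b \<in> sets M \<Longrightarrow> b \<subseteq> a \<Longrightarrow> 0 < measure M b \<Longrightarrow> \<exists>c\<in>F. c \<subseteq> b \<and> 0 < measure M c"
  obtains c :: "nat \<Rightarrow> 'a set" where "\<And>n. c n \<in> insert {} F" "disjoint_family c" "\<And>n. c n \<subseteq> a"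
    "AE x in M. x \<in> a \<longrightarrow> x \<in> (\<Union>n. c n)"
proof -
  have "\<exists>c\<in>insert {} F. c \<subseteq> r \<and> (\<forall>d\<in>F. d \<subseteq> r \<longrightarrow> measure M d \<le> 2 * measure M c)" for r
  proof (cases "\<exists>d\<in>F. d \<subseteq> r \<and> 0 < measure M d")
    case True
    then obtain d0 where d0: "d0 \<in> F" "d0 \<subseteq> r" "0 < measure M d0" by blast
    let ?D = "measure M ` {d \<in> F. d \<subseteq> r}"
    have bdd: "bdd_above ?D" by (rule bdd_aboveI[of _ "measure M (space M)"]) (auto intro: bounded_measure)
    have "measure M d0 \<le> Sup ?D" by (rule cSup_upper[OF _ bdd]) (use d0 in auto)
    hence "Sup ?D / 2 < Sup ?D" using d0 by simp
    then obtain c where c: "c \<in> F" "c \<subseteq> r" "Sup ?D / 2 < measure M c"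
      using less_cSup_iff[OF _ bdd, of "Sup ?D / 2"] d0 by auto
    have "measure M d \<le> 2 * measure M c" if "d \<in> F" "d \<subseteq> r" for d
      using cSup_upper[OF _ bdd, of "measure M d"] that c(3) by auto
    thus ?thesis using c by blast
  next
    case False
    thus ?thesis by (intro bexI[of _ "{}"]) (auto simp: not_less)
  qed
  then obtain pick where pick: "\<And>r. pick r \<in> insert {} F" "\<And>r. pick r \<subseteq> r"
      "\<And>r d. d \<in> F \<Longrightarrow> d \<subseteq> r \<Longrightarrow> measure M d \<le> 2 * measure M (pick r)" by metis
  define r where "r = rec_nat a (\<lambda>_ s. s - pick s)"
  define c where "c n = pick (r n)" for n
  have rS: "r (Suc n) = r n - c n" and r0: "r 0 = a" for n by (simp_all add: r_def c_def)
  have cF: "c n \<in> insert {} F" and cr: "c n \<subseteq> r n" for n using pick by (auto simp: c_def)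
  have c_sets: "c n \<in> sets M" for n using cF[of n] F by auto
  have r_anti: "r n \<subseteq> r m" if "m \<le> n" for m n
    using that by (induction n rule: dec_induct) (auto simp: rS)
  have ra: "r n \<subseteq> a" for n using r_anti[of 0 n] r0 by simp
  have disj: "c m \<inter> c n = {}" if "m < n" for m n
    using cr[of n] r_anti[of "Suc m" n] rS[of m] that by auto
  have df: "disjoint_family c"
    unfolding disjoint_family_on_def
  proof (intro ballI impI)
    fix m n :: nat assume "m \<noteq> n"
    thus "c m \<inter> c n = {}" using disj[of m n] disj[of n m] by (cases "m < n") auto
  qed
  have rest: "a - (\<Union>n. c n) \<subseteq> r n" for n
    by (induction n) (auto simp: rS r0)
  let ?r = "a - (\<Union>n. c n)"
  have rs: "?r \<in> sets M" using a c_sets by auto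
  have "measure M ?r = 0"
  proof (rule ccontr)
    assume "measure M ?r \<noteq> 0"
    hence "0 < measure M ?r" using measure_nonneg[of M ?r] by linarith
    then obtain d where d: "d \<in> F" "d \<subseteq> ?r" "0 < measure M d" using ex[OF rs] by blast
    have le: "measure M d \<le> 2 * measure M (c n)" for n
      unfolding c_def using pick(3)[OF d(1), of "r n"] d(2) rest[of n] by blast
    have "(\<lambda>n. measure M (c n)) \<longlonglongrightarrow> 0"
      using finite_measure_UNION[OF _ df] c_sets summable_LIMSEQ_zero sums_summable by blast
    hence "(\<lambda>n. 2 * measure M (c n)) \<longlonglongrightarrow> 2 * 0" by (rule tendsto_mult_left)
    hence "measure M d \<le> 2 * 0" by (rule LIMSEQ_le_const) (use le in blast)
    thus False using d by simp
  qed
  hence "?r \<in> null_sets M" using rs by (simp add: null_sets_def emeasure_eq_measure)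
  hence ae: "AE x in M. x \<in> a \<longrightarrow> x \<in> (\<Union>n. c n)" by (rule AE_I') auto
  have "c n \<subseteq> a" for n using cr ra by blast
  thus thesis using that[of c] cF df ae by blast
qed

text \<open>\<open>moving\<close> is the form in which ergodicity enters: two sets of positive
  measure are connected, on parts of positive measure, by a single element of the full group. The
  acting group is no longer mentioned, so the reconstruction of the point map concerns the relation
  alone.\<close>

locale ergodic_relation = equiv_prob M R + standard_probability_space M
  for M :: "'a measure" and R +
  assumes moving: "\<And>a b. a \<in> sets M \<Longrightarrow> b \<in> sets M \<Longrightarrow> 0 < measure M a \<Longrightarrow> 0 < measure M b \<Longrightarrow>
    \<exists>T\<in>fg. \<exists>C\<in>sets M. C \<subseteq> a \<and> 0 < measure M C \<and> T ` C \<subseteq> b"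
begin

text \<open>The points of \<open>c\<close> moved by \<open>T\<close> are covered up to a null set by
  the countably many sets of \<open>x \<in> c\<close> with \<open>x \<in> sep n\<close> and
  \<open>T x \<notin> sep n\<close>. Each of these is disjoint from its image, and one has positive
  measure.\<close>

lemma displaced_set:
  assumes T: "T \<in> fg" and c: "c \<in> sets M" and n: "\<not> (AE x in M. x \<in> c \<longrightarrow> T x = x)"
  obtains b where "b \<in> sets M" "b \<subseteq> c" "0 < measure M b" "T ` b \<inter> b = {}"
proof -
  define b where "b n = c \<inter> sep n - (T -` sep n \<inter> space M)" for n
  have b: "b n \<in> sets M" for n
    unfolding b_def using c sep_sets fg_preimage[OF T] by auto
  have cM: "c \<subseteq> space M" by (rule sets.sets_into_space[OF c])
  have "\<exists>n. 0 < measure M (b n)"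
  proof (rule ccontr)
    assume "\<not> ?thesis"
    hence "measure M (b n) = 0" for n using measure_nonneg[of M "b n"] by (meson not_less order_antisym)
    hence "AE x in M. x \<notin> b n" for n using b by (intro AE_not_in) (simp add: null_sets_def emeasure_eq_measure)
    hence "AE x in M. \<forall>n. x \<notin> b n" by (simp add: AE_all_countable)
    hence "AE x in M. x \<in> c \<longrightarrow> T x = x" using AE_space
    proof eventually_elim
      case (elim x)
      show ?case
      proof
        assume "x \<in> c"
        show "T x = x"
        proof (rule ccontr)
          assume "T x \<noteq> x"
          then obtain n where "x \<in> sep n" "T x \<notin> sep n" using sep[of x "T x"] elim fg_space[OF T] by metis
          thus False using elim \<open>x \<in> c\<close> by (auto simp: b_def)
        qed
      qed
    qed
    thus False using n by blast
  qed
  then obtain n where "0 < measure M (b n)" by blast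
  moreover have "T ` b n \<inter> b n = {}" "b n \<subseteq> c" using cM by (auto simp: b_def)
  ultimately show thesis using that b by blast
qed

text \<open>Non-atomicity splits \<open>b\<close> into two parts of positive measure; an element
  moving a piece of one into the other is turned into an involution by
  \<open>fg_swap\<close>.\<close>

lemma small_involution:
  assumes b: "b \<in> sets M" "0 < measure M b"
  obtains S C where "S \<in> fg" "C \<in> sets M" "C \<subseteq> b" "0 < measure M C" "S ` C \<subseteq> b" "S ` C \<inter> C = {}"
    "\<And>x. x \<in> space M \<Longrightarrow> S (S x) = x" "\<And>x. x \<in> space M \<Longrightarrow> x \<notin> C \<union> S ` C \<Longrightarrow> S x = x"
proof -
  obtain b1 where b1: "b1 \<in> sets M" "b1 \<subseteq> b" "0 < measure M b1" "measure M b1 < measure M b"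
    using non_atomic[OF b] by blast
  have "measure M (b - b1) = measure M b - measure M b1" by (rule finite_measure_Diff) (use b b1 in auto)
  hence "0 < measure M (b - b1)" using b1 by simp
  then obtain T C where T: "T \<in> fg" "C \<in> sets M" "C \<subseteq> b - b1" "0 < measure M C" "T ` C \<subseteq> b1"
    using moving[of "b - b1" b1] b b1 by blast
  have "T ` C \<inter> C = {}" using T by blast
  obtain S where S: "S \<in> fg" "\<And>x. x \<in> space M \<Longrightarrow> S (S x) = x" "\<And>x. x \<in> C \<Longrightarrow> S x = T x"
    "\<And>x. x \<in> space M \<Longrightarrow> x \<notin> C \<union> T ` C \<Longrightarrow> S x = x"
    by (rule fg_swap[OF T(1,2) \<open>T ` C \<inter> C = {}\<close>]) blast
  have "S ` C = T ` C" using S(3) by (intro image_cong) auto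
  show thesis
  proof (rule that[OF S(1) T(2) _ T(4) _ _ S(2)])
    show "C \<subseteq> b" "S ` C \<subseteq> b" "S ` C \<inter> C = {}"
      unfolding \<open>S ` C = T ` C\<close> using T(3,5) b1(2) \<open>T ` C \<inter> C = {}\<close> by auto
    show "S x = x" if "x \<in> space M" "x \<notin> C \<union> S ` C" for x
      using S(4) that unfolding \<open>S ` C = T ` C\<close> by blast
  qed
qed

text \<open>A product of two non-commuting involutions.\<close>

lemma small_noninvolution:
  assumes b: "b \<in> sets M" "0 < measure M b"
  obtains S S' D where "S \<in> fg" "S' \<in> fg" "D \<in> sets M" "D \<subseteq> b" "0 < measure M D"
    "\<And>x. x \<in> space M \<Longrightarrow> S (S' x) = x" "\<And>x. x \<in> space M \<Longrightarrow> S' (S x) = x"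
    "\<And>x. x \<in> space M \<Longrightarrow> x \<notin> b \<Longrightarrow> S x = x" "\<And>x. x \<in> D \<Longrightarrow> S (S x) \<noteq> x"
proof -
  obtain T C where T: "T \<in> fg" "C \<in> sets M" "C \<subseteq> b" "0 < measure M C" "T ` C \<subseteq> b" "T ` C \<inter> C = {}"
    "\<And>x. x \<in> space M \<Longrightarrow> T (T x) = x" "\<And>x. x \<in> space M \<Longrightarrow> x \<notin> C \<union> T ` C \<Longrightarrow> T x = x"
    by (rule small_involution[OF b]) blast
  obtain U D where U: "U \<in> fg" "D \<in> sets M" "D \<subseteq> C" "0 < measure M D" "U ` D \<subseteq> C" "U ` D \<inter> D = {}"
    "\<And>x. x \<in> space M \<Longrightarrow> U (U x) = x" "\<And>x. x \<in> space M \<Longrightarrow> x \<notin> D \<union> U ` D \<Longrightarrow> U x = x"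
    by (rule small_involution[OF T(2,4)]) blast
  have CM: "C \<subseteq> space M" by (rule sets.sets_into_space[OF T(2)])
  have sp: "T x \<in> space M" "U x \<in> space M" if "x \<in> space M" for x
    using fg_space that T(1) U(1) by blast+
  have fix_off: "(T \<star> U) x = x" if x: "x \<in> space M" "x \<notin> b" for x
  proof -
    have "x \<notin> D \<union> U ` D" "x \<notin> C \<union> T ` C" using x(2) T(3,5) U(3,5) by auto
    thus ?thesis using x T(8)[of x] U(8)[of x] by simp
  qed
  \<comment> \<open>The product behaves like a 3-cycle: it sends \<open>x\<close> to
    \<open>T (U x)\<close>, which \<open>U\<close> fixes, and from there to
    \<open>T (T (U x)) = U x\<close>, which differs from \<open>x\<close>.\<close>
  have moved: "(T \<star> U) ((T \<star> U) x) \<noteq> x" if x: "x \<in> D" for x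
  proof -
    have xs: "x \<in> space M" "U x \<in> C" using x U(3,5) CM by auto
    hence "T (U x) \<in> T ` C" by blast
    hence "T (U x) \<notin> D \<union> U ` D" using T(6) U(3,5) by blast
    hence "U (T (U x)) = T (U x)" using U(8) sp xs by blast
    hence "(T \<star> U) ((T \<star> U) x) = U x" using T(7) sp xs by simp
    thus ?thesis using x U(6) by auto
  qed
  show thesis
  proof (rule that[OF fg_comp[OF T(1) U(1)] fg_comp[OF U(1) T(1)] U(2) _ U(4) _ _ fix_off moved])
    show "D \<subseteq> b" using U(3) T(3) by blast
    show "(T \<star> U) ((U \<star> T) x) = x" "(U \<star> T) ((T \<star> U) x) = x" if "x \<in> space M" for x
      using that sp T(7) U(7) by simp_all
  qed
qed

text \<open>The set \<open>a\<close> is exhausted, up to a null set, by disjoint supports of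
  involutions from \<open>small_involution\<close>, and these involutions are glued.\<close>

lemma involution_support:
  assumes a: "a \<in> sets M"
  obtains P where "P \<in> fg" "\<And>x. x \<in> space M \<Longrightarrow> P (P x) = x" "AE x in M. x \<in> a \<longleftrightarrow> P x \<noteq> x"
proof -
  let ?inv = "\<lambda>S c. S \<in> fg \<and> (\<forall>x\<in>space M. S (S x) = x \<and> (x \<in> c \<longleftrightarrow> S x \<noteq> x))"
  let ?F = "{c \<in> sets M. \<exists>S. ?inv S c}"
  have ex: "\<exists>c\<in>?F. c \<subseteq> b \<and> 0 < measure M c" if b: "b \<in> sets M" "0 < measure M b" for b
  proof -
    obtain S C where S: "S \<in> fg" "C \<in> sets M" "C \<subseteq> b" "0 < measure M C" "S ` C \<subseteq> b" "S ` C \<inter> C = {}"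
      "\<And>x. x \<in> space M \<Longrightarrow> S (S x) = x" "\<And>x. x \<in> space M \<Longrightarrow> x \<notin> C \<union> S ` C \<Longrightarrow> S x = x"
      by (rule small_involution[OF b]) blast
    have CM: "C \<subseteq> space M" by (rule sets.sets_into_space[OF S(2)])
    have SC: "S ` C \<in> sets M" by (rule mp_image_sets[OF fgroup_mp[OF S(1)] S(2)])
    have "x \<in> C \<union> S ` C \<longleftrightarrow> S x \<noteq> x" if x: "x \<in> space M" for x
    proof
      assume "x \<in> C \<union> S ` C"
      thus "S x \<noteq> x"
      proof
        assume "x \<in> C" thus ?thesis using S(6) by auto
      next
        assume "x \<in> S ` C"
        then obtain y where "y \<in> C" "x = S y" by blast
        hence "S x = y" using S(7)[of y] CM by blast
        thus ?thesis using S(6) \<open>y \<in> C\<close> \<open>x \<in> S ` C\<close> by blast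
      qed
    qed (use S(8)[OF x] in blast)
    hence "?inv S (C \<union> S ` C)" using S(1,7) by blast
    hence "C \<union> S ` C \<in> ?F" using S(2) SC by blast
    moreover have "0 < measure M (C \<union> S ` C)"
      using finite_measure_mono[of C "C \<union> S ` C"] S(2,4) SC by (metis Un_upper1 less_le_trans sets.Un)
    moreover have "C \<union> S ` C \<subseteq> b" using S(3,5) by blast
    ultimately show ?thesis by (rule_tac bexI[of _ "C \<union> S ` C"]) (rule conjI)
  qed
  have Fs: "?F \<subseteq> sets M" by blast
  obtain c :: "nat \<Rightarrow> 'a set" where c: "\<And>n. c n \<in> insert {} ?F" "disjoint_family c" "\<And>n. c n \<subseteq> a"
    "AE x in M. x \<in> a \<longrightarrow> x \<in> (\<Union>n. c n)"
    by (rule exhaustion[OF Fs a ex]) (assumption, assumption, rule that)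
  \<comment> \<open>Pieces of the exhaustion may be empty; the identity is the involution with empty
    support.\<close>
  have "?inv (\<lambda>x\<in>space M. x) {}" using fg_id by simp
  hence "\<exists>S. ?inv S (c n)" for n using c(1)[of n] by blast
  then obtain S where S: "\<And>n. S n \<in> fg" "\<And>n x. x \<in> space M \<Longrightarrow> S n (S n x) = x"
      "\<And>n x. x \<in> space M \<Longrightarrow> x \<in> c n \<longleftrightarrow> S n x \<noteq> x" by metis
  have cs: "c n \<in> sets M" for n using c(1)[of n] by auto
  hence cM: "c n \<subseteq> space M" for n using sets.sets_into_space by blast
  have Sc: "S n x \<in> c n" if "x \<in> c n" for n x
  proof -
    have x: "x \<in> space M" "S n x \<noteq> x" using that cM S(3) by blast+
    thus ?thesis using S(2)[OF x(1), of n] S(3)[OF fg_space[OF S(1) x(1)], of n n] by simp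
  qed
  have im: "S n ` c n = c n" for n
  proof
    show "c n \<subseteq> S n ` c n"
    proof
      fix x assume x: "x \<in> c n"
      hence "x = S n (S n x)" using S(2) cM by (metis subsetD)
      thus "x \<in> S n ` c n" using Sc[OF x] by (rule image_eqI)
    qed
  qed (use Sc in blast)
  have "\<exists>P\<in>fg. (\<forall>n. \<forall>x\<in>c n. P x = S n x) \<and> (\<forall>x\<in>space M - (\<Union>n. c n). P x = x)"
    by (rule fg_glue[OF S(1) cs c(2)]) (simp_all only: im c(2))
  then obtain P where P: "P \<in> fg" "\<And>n x. x \<in> c n \<Longrightarrow> P x = S n x"
    "\<And>x. x \<in> space M \<Longrightarrow> x \<notin> (\<Union>n. c n) \<Longrightarrow> P x = x" by blast
  have "P (P x) = x \<and> (x \<in> (\<Union>n. c n) \<longleftrightarrow> P x \<noteq> x)" if x: "x \<in> space M" for x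
  proof (cases "x \<in> (\<Union>n. c n)")
    case True
    then obtain n where n: "x \<in> c n" by blast
    thus ?thesis using P(2)[OF n] P(2)[OF Sc[OF n]] S(2,3)[OF x] True by simp
  next
    case False
    thus ?thesis using P(3)[OF x] by simp
  qed
  note P' = this
  have "AE x in M. x \<in> a \<longleftrightarrow> P x \<noteq> x" using c(4) AE_space
    by eventually_elim (use P' c(3) in blast)
  thus thesis using that[of P] P(1) P' by blast
qed

end

section \<open>Supports in terms of the group structure\<close>

definition centr :: "('k, 'l) monoid_scheme \<Rightarrow> 'k set \<Rightarrow> 'k set" where
  "centr K A = {c \<in> carrier K. \<forall>a\<in>A. c \<otimes>\<^bsub>K\<^esub> a = a \<otimes>\<^bsub>K\<^esub> c}"

text \<open>The set \<open>U\<close> of the overview for \<open>p = \<pi>\<close>. The inverse of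
  \<open>c\<close> appears as an element \<open>c'\<close> with
  \<open>c \<otimes> c' = \<one>\<close>, so that membership is expressed by products alone; this
  suits both the transport along isomorphisms and the evaluation on representatives.\<close>

definition local_involutions :: "('k, 'l) monoid_scheme \<Rightarrow> 'k \<Rightarrow> 'k set" where
  "local_involutions K p = {f \<in> centr K {p}. f \<otimes>\<^bsub>K\<^esub> f = \<one>\<^bsub>K\<^esub> \<and>
     (\<forall>c\<in>centr K {p}. \<forall>c'\<in>centr K {p}. c \<otimes>\<^bsub>K\<^esub> c' = \<one>\<^bsub>K\<^esub> \<longrightarrow>
        f \<otimes>\<^bsub>K\<^esub> (c \<otimes>\<^bsub>K\<^esub> f \<otimes>\<^bsub>K\<^esub> c') = (c \<otimes>\<^bsub>K\<^esub> f \<otimes>\<^bsub>K\<^esub> c') \<otimes>\<^bsub>K\<^esub> f)}"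

text \<open>For an involution \<open>p\<close> of a full group, this is the subgroup of the elements supported in the
  support of \<open>p\<close>, described in terms of the group structure only.\<close>

definition support_group :: "('k, 'l) monoid_scheme \<Rightarrow> 'k \<Rightarrow> 'k set" where
  "support_group K p = centr K ((\<lambda>v. v \<otimes>\<^bsub>K\<^esub> v) ` centr K (local_involutions K p))"

lemma image_eq_if_iff:
  assumes "bij_betw h C C'" "A \<subseteq> C" "A' \<subseteq> C'" "\<And>c. c \<in> C \<Longrightarrow> c \<in> A \<longleftrightarrow> h c \<in> A'"
  shows "h ` A = A'"
proof
  show "h ` A \<subseteq> A'" using assms by blast
  show "A' \<subseteq> h ` A"
  proof
    fix y assume y: "y \<in> A'"
    then obtain x where "x \<in> C" "y = h x" using assms(1,3) by (auto simp: bij_betw_def)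
    thus "y \<in> h ` A" using assms(4) y by blast
  qed
qed

locale group_iso = K: group K + L: group L for K :: "('k, 'l) monoid_scheme" and L :: "('p, 'q) monoid_scheme" +
  fixes h assumes iso: "h \<in> iso K L"
begin

lemma bij: "bij_betw h (carrier K) (carrier L)"
  using iso by (simp add: iso_def)

lemma closed: "x \<in> carrier K \<Longrightarrow> h x \<in> carrier L"
  using bij by (auto simp: bij_betw_def)

lemma mult: "x \<in> carrier K \<Longrightarrow> y \<in> carrier K \<Longrightarrow> h (x \<otimes>\<^bsub>K\<^esub> y) = h x \<otimes>\<^bsub>L\<^esub> h y"
  using iso by (simp add: iso_def hom_def)

lemma eq_iff: "x \<in> carrier K \<Longrightarrow> y \<in> carrier K \<Longrightarrow> h x = h y \<longleftrightarrow> x = y"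
  using bij by (auto simp: bij_betw_def dest: inj_onD)

lemma one: "h \<one>\<^bsub>K\<^esub> = \<one>\<^bsub>L\<^esub>"
  using iso by (intro hom_one) (auto simp: iso_def K.group_axioms L.group_axioms)

lemma centr_iso:
  assumes A: "A \<subseteq> carrier K" shows "h ` centr K A = centr L (h ` A)"
proof (rule image_eq_if_iff[OF bij])
  fix c assume c: "c \<in> carrier K"
  have "(h c \<otimes>\<^bsub>L\<^esub> h a = h a \<otimes>\<^bsub>L\<^esub> h c) \<longleftrightarrow> (c \<otimes>\<^bsub>K\<^esub> a = a \<otimes>\<^bsub>K\<^esub> c)" if "a \<in> A" for a
  proof -
    have a: "a \<in> carrier K" using that A by blast
    show ?thesis using eq_iff[of "c \<otimes>\<^bsub>K\<^esub> a" "a \<otimes>\<^bsub>K\<^esub> c"] a c by (simp add: mult)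
  qed
  thus "c \<in> centr K A \<longleftrightarrow> h c \<in> centr L (h ` A)" using c closed by (simp add: centr_def)
qed (auto simp: centr_def)

lemma local_involutions_iso:
  assumes p: "p \<in> carrier K" shows "h ` local_involutions K p = local_involutions L (h p)"
proof (rule image_eq_if_iff[OF bij])
  let ?C = "centr K {p}"
  have C: "centr L {h p} = h ` ?C" using centr_iso[of "{p}"] p by simp
  have sub: "?C \<subseteq> carrier K" by (auto simp: centr_def)
  fix f assume f: "f \<in> carrier K"
  have "f \<in> ?C \<longleftrightarrow> h f \<in> h ` ?C" using eq_iff f sub by (auto simp: image_iff)
  moreover have "h f \<otimes>\<^bsub>L\<^esub> h f = \<one>\<^bsub>L\<^esub> \<longleftrightarrow> f \<otimes>\<^bsub>K\<^esub> f = \<one>\<^bsub>K\<^esub>"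
    using eq_iff[of "f \<otimes>\<^bsub>K\<^esub> f" "\<one>\<^bsub>K\<^esub>"] f by (simp add: mult one)
  moreover have "h c \<otimes>\<^bsub>L\<^esub> h c' = \<one>\<^bsub>L\<^esub> \<longleftrightarrow> c \<otimes>\<^bsub>K\<^esub> c' = \<one>\<^bsub>K\<^esub>"
    and "h f \<otimes>\<^bsub>L\<^esub> (h c \<otimes>\<^bsub>L\<^esub> h f \<otimes>\<^bsub>L\<^esub> h c') = (h c \<otimes>\<^bsub>L\<^esub> h f \<otimes>\<^bsub>L\<^esub> h c') \<otimes>\<^bsub>L\<^esub> h f \<longleftrightarrow>
      f \<otimes>\<^bsub>K\<^esub> (c \<otimes>\<^bsub>K\<^esub> f \<otimes>\<^bsub>K\<^esub> c') = (c \<otimes>\<^bsub>K\<^esub> f \<otimes>\<^bsub>K\<^esub> c') \<otimes>\<^bsub>K\<^esub> f" if "c \<in> ?C" "c' \<in> ?C" for c c'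
  proof -
    have c: "c \<in> carrier K" "c' \<in> carrier K" using that sub by blast+
    show "h c \<otimes>\<^bsub>L\<^esub> h c' = \<one>\<^bsub>L\<^esub> \<longleftrightarrow> c \<otimes>\<^bsub>K\<^esub> c' = \<one>\<^bsub>K\<^esub>"
      using eq_iff[of "c \<otimes>\<^bsub>K\<^esub> c'" "\<one>\<^bsub>K\<^esub>"] c by (simp add: mult one)
    show "h f \<otimes>\<^bsub>L\<^esub> (h c \<otimes>\<^bsub>L\<^esub> h f \<otimes>\<^bsub>L\<^esub> h c') = (h c \<otimes>\<^bsub>L\<^esub> h f \<otimes>\<^bsub>L\<^esub> h c') \<otimes>\<^bsub>L\<^esub> h f \<longleftrightarrow>
      f \<otimes>\<^bsub>K\<^esub> (c \<otimes>\<^bsub>K\<^esub> f \<otimes>\<^bsub>K\<^esub> c') = (c \<otimes>\<^bsub>K\<^esub> f \<otimes>\<^bsub>K\<^esub> c') \<otimes>\<^bsub>K\<^esub> f"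
      using eq_iff[of "f \<otimes>\<^bsub>K\<^esub> (c \<otimes>\<^bsub>K\<^esub> f \<otimes>\<^bsub>K\<^esub> c')" "(c \<otimes>\<^bsub>K\<^esub> f \<otimes>\<^bsub>K\<^esub> c') \<otimes>\<^bsub>K\<^esub> f"] c f
      by (simp add: mult)
  qed
  ultimately show "f \<in> local_involutions K p \<longleftrightarrow> h f \<in> local_involutions L (h p)"
    unfolding local_involutions_def C by simp
qed (auto simp: local_involutions_def centr_def)

lemma support_group_iso:
  assumes p: "p \<in> carrier K" shows "h ` support_group K p = support_group L (h p)"
proof -
  let ?V = "centr K (local_involutions K p)"
  have "local_involutions K p \<subseteq> carrier K" by (auto simp: local_involutions_def centr_def)
  hence V: "h ` ?V = centr L (local_involutions L (h p))"
    by (simp add: centr_iso local_involutions_iso[OF p])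
  have sub: "?V \<subseteq> carrier K" by (auto simp: centr_def)
  have "h ` (\<lambda>v. v \<otimes>\<^bsub>K\<^esub> v) ` ?V = (\<lambda>v. v \<otimes>\<^bsub>L\<^esub> v) ` h ` ?V"
    unfolding image_image by (rule image_cong) (use sub mult in auto)
  moreover have "(\<lambda>v. v \<otimes>\<^bsub>K\<^esub> v) ` ?V \<subseteq> carrier K" using sub by auto
  ultimately show ?thesis unfolding support_group_def by (simp add: centr_iso V)
qed

end

section \<open>Supports of elements of the full group\<close>

context ergodic_relation
begin

definition supported :: "'a set \<Rightarrow> ('a \<Rightarrow> 'a) set set" where
  "supported a = cls ` {T \<in> fg. AE x in M. x \<notin> a \<longrightarrow> T x = x}"

lemma cls_supported_iff:
  assumes "T \<in> fg" shows "cls T \<in> supported a \<longleftrightarrow> (AE x in M. x \<notin> a \<longrightarrow> T x = x)"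
proof
  assume "cls T \<in> supported a"
  then obtain S where S: "S \<in> fg" "cls T = cls S" "AE x in M. x \<notin> a \<longrightarrow> S x = x"
    by (auto simp: supported_def)
  have "AE x in M. T x = S x" using S assms cls_eq_iff by blast
  thus "AE x in M. x \<notin> a \<longrightarrow> T x = x" using S(3) by eventually_elim simp
qed (use assms in \<open>auto simp: supported_def\<close>)

lemma cls_centr_iff:
  assumes "T \<in> fg" "A \<subseteq> carrier K"
  shows "cls T \<in> centr K A \<longleftrightarrow> (\<forall>S\<in>fg. cls S \<in> A \<longrightarrow> (AE x in M. T (S x) = S (T x)))"
proof -
  have "cls T \<in> centr K A \<longleftrightarrow> (\<forall>a\<in>A. cls T \<otimes>\<^bsub>K\<^esub> a = a \<otimes>\<^bsub>K\<^esub> cls T)"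
    using assms(1) by (auto simp: centr_def K_carrier)
  also have "\<dots> \<longleftrightarrow> (\<forall>S\<in>fg. cls S \<in> A \<longrightarrow> cls T \<otimes>\<^bsub>K\<^esub> cls S = cls S \<otimes>\<^bsub>K\<^esub> cls T)"
    using assms(2) by (force simp: K_carrier)
  finally show ?thesis using assms(1) by (simp add: cls_mult_eq_iff)
qed

lemma cls_centr_sing_iff:
  assumes "T \<in> fg" "P \<in> fg"
  shows "cls T \<in> centr K {cls P} \<longleftrightarrow> (AE x in M. T (P x) = P (T x))"
  using assms by (auto simp: centr_def K_carrier cls_mult_eq_iff)

lemma cls_local_involutions_iff:
  assumes f: "f \<in> fg" and P: "P \<in> fg"
  shows "cls f \<in> local_involutions K (cls P) \<longleftrightarrow>
    (AE x in M. f (P x) = P (f x)) \<and> (AE x in M. f (f x) = x) \<and>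
    (\<forall>c\<in>fg. \<forall>c'\<in>fg. (AE x in M. c (P x) = P (c x)) \<longrightarrow> (AE x in M. c' (P x) = P (c' x)) \<longrightarrow>
       (AE x in M. c (c' x) = x) \<longrightarrow> (AE x in M. f (c (f (c' x))) = c (f (c' (f x)))))"
proof -
  have C: "centr K {cls P} = cls ` {c \<in> fg. AE x in M. c (P x) = P (c x)}"
    using cls_centr_sing_iff[OF _ P] by (auto simp: centr_def K_carrier)
  have "cls f \<otimes>\<^bsub>K\<^esub> (cls c \<otimes>\<^bsub>K\<^esub> cls f \<otimes>\<^bsub>K\<^esub> cls c') = cls c \<otimes>\<^bsub>K\<^esub> cls f \<otimes>\<^bsub>K\<^esub> cls c' \<otimes>\<^bsub>K\<^esub> cls f \<longleftrightarrow>
      (AE x in M. f (c (f (c' x))) = c (f (c' (f x))))" if c: "c \<in> fg" "c' \<in> fg" for c c'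
  proof -
    have cf: "c \<star> f \<in> fg" "c \<star> f \<star> c' \<in> fg" using fg_comp c f by blast+
    have "cls c \<otimes>\<^bsub>K\<^esub> cls f \<otimes>\<^bsub>K\<^esub> cls c' = cls (c \<star> f \<star> c')"
      by (simp only: cls_mult[OF c(1) f] cls_mult[OF cf(1) c(2)])
    thus ?thesis
      by (simp only: cls_mult_eq_iff[OF f cf(2) cf(2) f]) (intro AE_cong, use fg_space c f in simp)
  qed
  moreover have "cls f \<in> centr K {cls P} \<longleftrightarrow> (AE x in M. f (P x) = P (f x))"
    by (rule cls_centr_sing_iff[OF f P])
  ultimately show ?thesis
    unfolding local_involutions_def mem_Collect_eq cls_mult_one_iff[OF f f] C
    by (simp add: cls_mult_one_iff) blast
qed

text \<open>Each map preserves the set on which it may act: if \<open>x \<in> A\<close> and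
  \<open>T x \<notin> A\<close>, then \<open>T (T x) = T x\<close>, so \<open>T x = x\<close> by
  injectivity, a contradiction. Thus, off a null set, one of the two maps is the identity both
  before and after the other one is applied.\<close>

lemma disjoint_supports_commute:
  assumes S: "S \<in> fg" "AE x in M. x \<in> A \<longrightarrow> S x = x" and T: "T \<in> fg" "AE x in M. x \<notin> A \<longrightarrow> T x = x"
  shows "AE x in M. S (T x) = T (S x)"
  using S(2) T(2) fg_AE[OF T(1) S(2)] fg_AE[OF S(1) T(2)] fg_AE[OF S(1) S(2)] fg_AE[OF T(1) T(2)] AE_space
proof eventually_elim
  case (elim x)
  have sp: "S x \<in> space M" "T x \<in> space M" using fg_space S(1) T(1) elim by blast+
  show ?case
  proof (cases "x \<in> A")
    case True
    have "T x \<in> A" using elim True fg_inj[OF T(1) sp(2), of x] by metis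
    thus ?thesis using elim True by simp
  next
    case False
    have "S x \<notin> A" using elim False fg_inj[OF S(1) sp(1), of x] by metis
    thus ?thesis using elim False by simp
  qed
qed

lemma fixed_sets: "T \<in> fg \<Longrightarrow> {x \<in> space M. T x = x} \<in> sets M"
proof -
  assume T: "T \<in> fg"
  have "{x \<in> space M. T x = x} = space M - (\<Union>n. sep n - (T -` sep n \<inter> space M))"
  proof (intro equalityI subsetI)
    fix x assume x: "x \<in> space M - (\<Union>n. sep n - (T -` sep n \<inter> space M))"
    have "T x = x"
    proof (rule ccontr)
      assume "T x \<noteq> x"
      then obtain n where "x \<in> sep n" "T x \<notin> sep n" using sep[of x "T x"] fg_space[OF T] x by (metis DiffD1)
      thus False using x by blast
    qed
    thus "x \<in> {x \<in> space M. T x = x}" using x by blast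
  qed auto
  moreover have "T -` sep n \<inter> space M \<in> sets M" for n
    by (rule fg_preimage[OF T sep_sets])
  ultimately show ?thesis using sep_sets by auto
qed

section \<open>The support of an involution recovered from centralizers\<close>

context
  fixes P assumes P: "P \<in> fg" and PP: "\<And>x. x \<in> space M \<Longrightarrow> P (P x) = x"
begin

abbreviation (input) "suppP \<equiv> {x \<in> space M. P x \<noteq> x}"

lemma P_space: "x \<in> space M \<Longrightarrow> P x \<in> space M"
  by (rule fg_space[OF P])

lemma suppP_sets: "suppP \<in> sets M"
  using sets.compl_sets[OF fixed_sets[OF P]] by (simp add: set_diff_eq conj_commute cong: conj_cong)

text \<open>Suppose \<open>f\<close> moves a set \<open>b\<close> of fixed points of
  \<open>P\<close> off itself. An element \<open>S\<close> supported in \<open>b\<close> with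
  nontrivial square commutes with \<open>P\<close>, so \<open>f\<close> commutes with
  \<open>S f S'\<close>. Evaluated at \<open>S x\<close> for \<open>x \<in> D\<close>, this identity
  reads \<open>x = S (S x)\<close>, because \<open>f\<close> is an involution and \<open>S\<close>,
  \<open>S'\<close> fix the points \<open>f x\<close>, \<open>f (S x)\<close> outside
  \<open>b\<close>.\<close>

lemma local_involution_support:
  assumes f: "f \<in> fg" "cls f \<in> local_involutions K (cls P)"
  shows "AE x in M. P x = x \<longrightarrow> f x = x"
proof (rule ccontr)
  have ff: "AE x in M. f (f x) = x"
    and comm: "\<And>c c'. c \<in> fg \<Longrightarrow> c' \<in> fg \<Longrightarrow> (AE x in M. c (P x) = P (c x)) \<Longrightarrow>
      (AE x in M. c' (P x) = P (c' x)) \<Longrightarrow> (AE x in M. c (c' x) = x) \<Longrightarrow>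
      (AE x in M. f (c (f (c' x))) = c (f (c' (f x))))"
    using f(2) unfolding cls_local_involutions_iff[OF f(1) P] by blast+
  assume "\<not> ?thesis"
  hence "\<not> (AE x in M. x \<in> space M - suppP \<longrightarrow> f x = x)" using AE_space by (auto elim!: eventually_mp[rotated])
  then obtain b where b: "b \<in> sets M" "b \<subseteq> space M - suppP" "0 < measure M b" "f ` b \<inter> b = {}"
    using displaced_set[OF f(1), of "space M - suppP"] suppP_sets by blast
  obtain S S' D where S: "S \<in> fg" "S' \<in> fg" "D \<in> sets M" "D \<subseteq> b" "0 < measure M D"
    "\<And>x. x \<in> space M \<Longrightarrow> S (S' x) = x" "\<And>x. x \<in> space M \<Longrightarrow> S' (S x) = x"
    "\<And>x. x \<in> space M \<Longrightarrow> x \<notin> b \<Longrightarrow> S x = x" "\<And>x. x \<in> D \<Longrightarrow> S (S x) \<noteq> x"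
    by (rule small_noninvolution[OF b(1,3)]) blast
  have S'b: "S' x = x" if "x \<in> space M" "x \<notin> b" for x using S(7,8) that by metis
  have bM: "b \<subseteq> space M" using b(2) by blast
  have Sin: "S x \<in> b" "S' x \<in> b" if "x \<in> b" for x
    using S'b[of "S x"] S(6-8)[of x] S(8)[of "S' x"] that bM fg_space[OF S(1)] fg_space[OF S(2)]
    by (metis subsetD)+
  have cP: "AE x in M. S (P x) = P (S x)" "AE x in M. S' (P x) = P (S' x)"
  proof -
    have "AE x in M. x \<in> suppP \<longrightarrow> S x = x" "AE x in M. x \<in> suppP \<longrightarrow> S' x = x"
      by (rule AE_I2, use S(8) S'b b(2) in blast)+
    moreover have "AE x in M. x \<notin> suppP \<longrightarrow> P x = x" by (rule AE_I2) simp
    ultimately show "AE x in M. S (P x) = P (S x)" "AE x in M. S' (P x) = P (S' x)"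
      using disjoint_supports_commute S(1,2) P by blast+
  qed
  have "AE x in M. f (S (f (S' x))) = S (f (S' (f x)))"
    by (rule comm[OF S(1,2) cP]) (use S(6) in \<open>auto intro!: AE_I2\<close>)
  from fg_AE[OF S(1) this] ff fg_AE[OF S(1) ff] fg_AE[OF S(1) fg_AE[OF S(1) ff]] AE_space
  have "AE x in M. x \<notin> D"
  proof eventually_elim
    case (elim x)
    show ?case
    proof
      assume xD: "x \<in> D"
      have x: "x \<in> b" "S x \<in> b" "S (S x) \<in> b" using xD S(4) Sin by blast+
      have "f x \<notin> b" "f (S x) \<notin> b" using x b(4) by blast+
      moreover have "f x \<in> space M" "f (S x) \<in> space M" using fg_space[OF f(1)] x bM by blast+
      ultimately have "S (f x) = f x" "S' (f (S x)) = f (S x)" using S(8) S'b by blast+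
      moreover have "S' (S x) = x" using S(7) elim by blast
      ultimately have "f (f x) = S (f (f (S x)))" using elim(1) by simp
      hence "x = S (S x)" using elim(2,3) by simp
      thus False using S(9)[OF xD] by simp
    qed
  qed
  hence "D \<in> null_sets M" using AE_iff_null_sets[OF S(3)] by blast
  thus False using S(5) by (simp add: null_sets_def measure_def)
qed

text \<open>For \<open>c\<close> commuting with \<open>P\<close>, the conjugate
  \<open>c Q c'\<close> acts at each point \<open>x\<close> as \<open>P\<close> or as the identity,
  according to whether \<open>c' x\<close> lies in the invariant set \<open>B\<close>. The same is
  true of \<open>Q\<close> with \<open>x\<close> in place of \<open>c' x\<close>, and these choices
  do not change when \<open>x\<close> is replaced by \<open>P x\<close>.\<close>

lemma restricted_involution:
  assumes Q: "Q \<in> fg" "\<And>x. x \<in> space M \<Longrightarrow> Q x = (if x \<in> B then P x else x)"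
    and inv: "\<And>x. x \<in> space M \<Longrightarrow> P x \<in> B \<longleftrightarrow> x \<in> B"
  shows "cls Q \<in> local_involutions K (cls P)"
  unfolding cls_local_involutions_iff[OF Q(1) P]
proof (intro conjI ballI impI)
  show "AE x in M. Q (P x) = P (Q x)" "AE x in M. Q (Q x) = x"
    using AE_space by (eventually_elim, use Q(2) inv PP P_space in simp)+
  fix c c' assume c: "c \<in> fg" "c' \<in> fg"
    and cP: "AE x in M. c (P x) = P (c x)" "AE x in M. c' (P x) = P (c' x)" "AE x in M. c (c' x) = x"
  show "AE x in M. Q (c (Q (c' x))) = c (Q (c' (Q x)))"
    using cP(2,3) fg_AE[OF c(2) cP(1)] fg_AE[OF P cP(3)] AE_space
  proof eventually_elim
    case (elim x)
    have sp: "c' x \<in> space M" "P x \<in> space M" "c' (P x) \<in> space M"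
      using fg_space c elim P_space by blast+
    have "P (c (c' x)) = P x" "c (P (c' x)) = P x" using elim by simp_all
    thus ?case using elim sp Q(2) inv PP by (cases "x \<in> B"; cases "c' x \<in> B") auto
  qed
qed

text \<open>Commuting with the restriction of \<open>P\<close> to an invariant set forces
  \<open>f\<close> to map the part of that set inside the support into the set. Countably many
  invariant sets separate the orbits of \<open>P\<close>, so \<open>f x\<close> is \<open>x\<close>
  or \<open>P x\<close>; since \<open>f\<close> commutes with \<open>P\<close>, squaring gives the
  identity in both cases.\<close>

lemma centralizer_square_trivial:
  assumes f: "f \<in> fg" "cls f \<in> centr K (local_involutions K (cls P))"
  shows "AE x in M. P x \<noteq> x \<longrightarrow> f (f x) = x"
proof -
  \<comment> \<open>The saturation under \<open>P\<close> of \<open>sep m \<inter> sep n\<close>.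
    Two indices occur because one separates \<open>x\<close> from \<open>f x\<close> and the other
    separates \<open>x\<close> from \<open>P (f x)\<close>.\<close>
  define E where "E m n = (sep m \<inter> sep n) \<union> (P -` (sep m \<inter> sep n) \<inter> space M)" for m n
  have E: "E m n \<in> sets M" for m n
    unfolding E_def using sep_sets fg_preimage[OF P]
    by (metis sets.Int sets.Un)
  have BM: "sep n \<subseteq> space M" for n by (rule sets.sets_into_space[OF sep_sets])
  have inv: "P x \<in> E m n \<longleftrightarrow> x \<in> E m n" if "x \<in> space M" for x m n
    using that PP P_space BM by (auto simp: E_def)
  have sub: "local_involutions K (cls P) \<subseteq> carrier K" by (auto simp: local_involutions_def centr_def)
  have comm: "AE x in M. f (Q x) = Q (f x)" if "Q \<in> fg" "cls Q \<in> local_involutions K (cls P)" for Q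
    using f(2) that unfolding cls_centr_iff[OF f(1) sub] by blast
  have "AE x in M. x \<in> E m n \<longrightarrow> P x \<noteq> x \<longrightarrow> f x \<in> E m n" for m n
  proof -
    obtain Q where Q: "Q \<in> fg" "\<And>x. x \<in> space M \<Longrightarrow> Q x = (if x \<in> E m n then P x else x)"
      by (rule fg_restrict[OF P E inv]) blast+
    have "AE x in M. f (Q x) = Q (f x)" by (rule comm[OF Q(1) restricted_involution[OF Q inv]])
    thus ?thesis using AE_space
    proof eventually_elim
      case (elim x)
      show ?case
      proof (intro impI, rule ccontr)
        assume x: "x \<in> E m n" "P x \<noteq> x" "f x \<notin> E m n"
        hence "f (P x) = f x" using elim Q(2) fg_space[OF f(1)] by simp
        thus False using fg_inj[OF f(1), of "P x" x] P_space elim x by blast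
      qed
    qed
  qed
  hence "AE x in M. \<forall>m n. x \<in> E m n \<longrightarrow> P x \<noteq> x \<longrightarrow> f x \<in> E m n" by (simp add: AE_all_countable)
  moreover have "AE x in M. f (P x) = P (f x)"
    by (rule comm[OF P restricted_involution[of P "space M"]]) (use P P_space in auto)
  ultimately show ?thesis using AE_space
  proof eventually_elim
    case (elim x)
    show ?case
    proof
      assume Px: "P x \<noteq> x"
      have fx: "f x \<in> space M" using fg_space[OF f(1)] elim by blast
      have "f x = x \<or> f x = P x"
      proof (rule ccontr)
        assume "\<not> ?thesis"
        hence ne: "x \<noteq> f x" "x \<noteq> P (f x)" using PP[OF fx] by metis+
        obtain m n where mn: "x \<in> sep m" "f x \<notin> sep m" "x \<in> sep n" "P (f x) \<notin> sep n"
          using sep[OF elim(3) fx ne(1)] sep[OF elim(3) P_space[OF fx] ne(2)] by blast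
        hence "x \<in> E m n" "f x \<notin> E m n" by (auto simp: E_def)
        thus False using elim(1) Px by blast
      qed
      thus "f (f x) = x" using elim(2) PP[OF elim(3)] by auto
    qed
  qed
qed

theorem support_group_involution: "support_group K (cls P) = supported suppP"
proof -
  let ?U = "local_involutions K (cls P)"
  let ?S = "(\<lambda>v. v \<otimes>\<^bsub>K\<^esub> v) ` centr K ?U"
  have U: "?U \<subseteq> carrier K" by (auto simp: local_involutions_def centr_def)
  have V: "centr K ?U \<subseteq> carrier K" by (auto simp: centr_def)
  interpret K: group K by (rule group_K)
  have S: "?S \<subseteq> carrier K" using V by auto
  have S_triv: "AE x in M. x \<in> suppP \<longrightarrow> T x = x" if T: "T \<in> fg" "cls T \<in> ?S" for T
  proof -
    obtain v where v: "v \<in> centr K ?U" "cls T = v \<otimes>\<^bsub>K\<^esub> v" using T(2) by blast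
    then obtain f where f: "f \<in> fg" "v = cls f" using V by (auto simp: K_carrier)
    have "cls T = cls (f \<star> f)" using v(2) f cls_mult by simp
    hence "AE x in M. T x = (f \<star> f) x" using cls_eq_iff fg_comp T(1) f(1) by blast
    moreover have "AE x in M. P x \<noteq> x \<longrightarrow> f (f x) = x"
      using centralizer_square_trivial f v(1) by blast
    ultimately show ?thesis using AE_space by eventually_elim simp
  qed
  have "cls T \<in> support_group K (cls P) \<longleftrightarrow> cls T \<in> supported suppP" if T: "T \<in> fg" for T
  proof
    assume "cls T \<in> supported suppP"
    hence Ts: "AE x in M. x \<notin> suppP \<longrightarrow> T x = x" by (simp add: cls_supported_iff T)
    show "cls T \<in> support_group K (cls P)"
      unfolding support_group_def cls_centr_iff[OF T S]
    proof (intro ballI impI)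
      fix Q assume Q: "Q \<in> fg" "cls Q \<in> ?S"
      from disjoint_supports_commute[OF Q(1) S_triv[OF Q] T Ts]
      show "AE x in M. T (Q x) = Q (T x)" by eventually_elim simp
    qed
  next
    assume "cls T \<in> support_group K (cls P)"
    hence comm: "AE x in M. T (Q x) = Q (T x)" if "Q \<in> fg" "cls Q \<in> ?S" for Q
      using that unfolding support_group_def cls_centr_iff[OF T S] by blast
    have "AE x in M. x \<in> space M - suppP \<longrightarrow> T x = x"
    proof (rule ccontr)
      assume "\<not> ?thesis"
      then obtain b where b: "b \<in> sets M" "b \<subseteq> space M - suppP" "0 < measure M b" "T ` b \<inter> b = {}"
        using displaced_set[OF T, of "space M - suppP"] suppP_sets by blast
      \<comment> \<open>This \<open>f\<close> lives off the support of \<open>P\<close>, hence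
        centralizes the local involutions, and \<open>T\<close> must commute with its square. For
        \<open>x \<in> D\<close> the point \<open>T x\<close> is outside \<open>b\<close> and fixed
        by \<open>f\<close>, so \<open>T (f (f x)) = T x\<close>, which contradicts
        \<open>f (f x) \<noteq> x\<close>.\<close>
      obtain f f' D where f: "f \<in> fg" "f' \<in> fg" "D \<in> sets M" "D \<subseteq> b" "0 < measure M D"
        "\<And>x. x \<in> space M \<Longrightarrow> f (f' x) = x" "\<And>x. x \<in> space M \<Longrightarrow> f' (f x) = x"
        "\<And>x. x \<in> space M \<Longrightarrow> x \<notin> b \<Longrightarrow> f x = x" "\<And>x. x \<in> D \<Longrightarrow> f (f x) \<noteq> x"
        by (rule small_noninvolution[OF b(1,3)]) blast
      have "cls f \<in> centr K ?U"
        unfolding cls_centr_iff[OF f(1) U]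
      proof (intro ballI impI)
        fix Q assume Q: "Q \<in> fg" "cls Q \<in> ?U"
        show "AE x in M. f (Q x) = Q (f x)"
        proof (rule disjoint_supports_commute[where A = suppP])
          show "AE x in M. x \<in> suppP \<longrightarrow> f x = x" by (rule AE_I2) (use f(8) b(2) in auto)
          show "AE x in M. x \<notin> suppP \<longrightarrow> Q x = x"
            using local_involution_support[OF Q] AE_space by eventually_elim simp
        qed (use f Q in auto)
      qed
      hence "cls f \<otimes>\<^bsub>K\<^esub> cls f \<in> ?S" by blast
      hence "cls (f \<star> f) \<in> ?S" using cls_mult f(1) by simp
      hence "AE x in M. T ((f \<star> f) x) = (f \<star> f) (T x)" using comm fg_comp f(1) by blast
      hence "AE x in M. x \<notin> D" using AE_space
      proof eventually_elim
        case (elim x)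
        have sp: "T x \<in> space M" "f x \<in> space M" "f (f x) \<in> space M"
          using fg_space T f(1) elim by blast+
        show ?case
        proof
          assume xD: "x \<in> D"
          hence "T x \<notin> b" using b(4) f(4) by blast
          hence "f (T x) = T x" using f(8) sp by blast
          hence "T (f (f x)) = T x" using elim sp by simp
          thus False using fg_inj[OF T sp(3) elim(2)] f(9)[OF xD] by blast
        qed
      qed
      hence "D \<in> null_sets M" using AE_iff_null_sets[OF f(3)] by blast
      thus False using f(5) by (simp add: null_sets_def measure_def)
    qed
    hence "AE x in M. x \<notin> suppP \<longrightarrow> T x = x" using AE_space by eventually_elim blast
    thus "cls T \<in> supported suppP" by (simp add: cls_supported_iff T)
  qed
  moreover have "support_group K (cls P) \<subseteq> cls ` fg" "supported suppP \<subseteq> cls ` fg"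
    using K_carrier by (auto simp: support_group_def centr_def supported_def)
  ultimately show ?thesis by blast
qed

end

end

section \<open>Point realization of automorphisms of the measure algebra\<close>

text \<open>An order automorphism of the measure algebra, given by representatives
  \<open>\<Theta> b\<close>. Order alone determines countable suprema and complements, which is how
  the following lemmas obtain them.\<close>

locale measure_algebra_iso = standard_probability_space M for M :: "'a measure" +
  fixes \<Theta> :: "'a set \<Rightarrow> 'a set"
  assumes \<Theta>_sets: "\<And>b. b \<in> sets M \<Longrightarrow> \<Theta> b \<in> sets M"
    and \<Theta>_le_iff: "\<And>b c. b \<in> sets M \<Longrightarrow> c \<in> sets M \<Longrightarrow>
      (AE x in M. x \<in> \<Theta> b \<longrightarrow> x \<in> \<Theta> c) \<longleftrightarrow> (AE x in M. x \<in> b \<longrightarrow> x \<in> c)"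
    and \<Theta>_surj: "\<And>a. a \<in> sets M \<Longrightarrow> \<exists>b\<in>sets M. AE x in M. x \<in> a \<longleftrightarrow> x \<in> \<Theta> b"
begin

lemma \<Theta>_mono: "b \<in> sets M \<Longrightarrow> c \<in> sets M \<Longrightarrow> AE x in M. x \<in> b \<longrightarrow> x \<in> c \<Longrightarrow> AE x in M. x \<in> \<Theta> b \<longrightarrow> x \<in> \<Theta> c"
  using \<Theta>_le_iff by blast

lemma \<Theta>_empty: "AE x in M. x \<notin> \<Theta> {}"
proof -
  obtain e where e: "e \<in> sets M" "AE x in M. x \<in> {} \<longleftrightarrow> x \<in> \<Theta> e" using \<Theta>_surj[of "{}"] by blast
  have "AE x in M. x \<in> \<Theta> {} \<longrightarrow> x \<in> \<Theta> e" by (rule \<Theta>_mono) (use e in auto)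
  thus ?thesis using e(2) by eventually_elim simp
qed

lemma \<Theta>_space: "AE x in M. x \<in> \<Theta> (space M)"
proof -
  obtain e where e: "e \<in> sets M" "AE x in M. x \<in> space M \<longleftrightarrow> x \<in> \<Theta> e" using \<Theta>_surj[of "space M"] by blast
  have "AE x in M. x \<in> \<Theta> e \<longrightarrow> x \<in> \<Theta> (space M)"
    by (rule \<Theta>_mono) (use e AE_space in \<open>auto elim!: eventually_mono\<close>)
  thus ?thesis using e(2) AE_space by eventually_elim simp
qed

text \<open>Suprema are determined by the order: the union of the images is, modulo null sets, the
  image of some \<open>u\<close>, and \<open>u\<close> lies above every \<open>b n\<close>.\<close>

lemma \<Theta>_UN:
  assumes b: "\<And>n::nat. b n \<in> sets M" shows "AE x in M. x \<in> \<Theta> (\<Union>n. b n) \<longleftrightarrow> (\<exists>n. x \<in> \<Theta> (b n))"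
proof -
  have Ub: "(\<Union>n. b n) \<in> sets M" using b by auto
  have "(\<Union>n. \<Theta> (b n)) \<in> sets M" using b \<Theta>_sets by auto
  then obtain u where u: "u \<in> sets M" "AE x in M. x \<in> (\<Union>n. \<Theta> (b n)) \<longleftrightarrow> x \<in> \<Theta> u" using \<Theta>_surj by blast
  have "AE x in M. x \<in> b n \<longrightarrow> x \<in> u" for n
    unfolding \<Theta>_le_iff[OF b u(1), symmetric] using u(2) by eventually_elim blast
  hence "AE x in M. \<forall>n. x \<in> b n \<longrightarrow> x \<in> u" unfolding AE_all_countable by blast
  hence "AE x in M. x \<in> (\<Union>n. b n) \<longrightarrow> x \<in> u" by eventually_elim blast
  hence "AE x in M. x \<in> \<Theta> (\<Union>n. b n) \<longrightarrow> x \<in> \<Theta> u" by (rule \<Theta>_mono[OF Ub u(1)])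
  moreover have "AE x in M. x \<in> \<Theta> (b n) \<longrightarrow> x \<in> \<Theta> (\<Union>n. b n)" for n
    by (rule \<Theta>_mono[OF b Ub]) auto
  hence "AE x in M. \<forall>n. x \<in> \<Theta> (b n) \<longrightarrow> x \<in> \<Theta> (\<Union>n. b n)" unfolding AE_all_countable by blast
  ultimately show ?thesis using u(2) by eventually_elim blast
qed

lemma \<Theta>_disjoint:
  assumes "b \<in> sets M" "c \<in> sets M" "b \<inter> c = {}" shows "AE x in M. \<not> (x \<in> \<Theta> b \<and> x \<in> \<Theta> c)"
proof -
  have "\<Theta> b \<inter> \<Theta> c \<in> sets M" using assms \<Theta>_sets by auto
  then obtain e where e: "e \<in> sets M" "AE x in M. x \<in> \<Theta> b \<inter> \<Theta> c \<longleftrightarrow> x \<in> \<Theta> e" using \<Theta>_surj by blast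
  have "AE x in M. x \<in> e \<longrightarrow> x \<in> b" "AE x in M. x \<in> e \<longrightarrow> x \<in> c"
    unfolding \<Theta>_le_iff[OF e(1) assms(1), symmetric] \<Theta>_le_iff[OF e(1) assms(2), symmetric]
    using e(2) by (eventually_elim, blast)+
  hence "AE x in M. x \<in> e \<longrightarrow> x \<in> {}" by eventually_elim (use assms(3) in blast)
  hence "AE x in M. x \<in> \<Theta> e \<longrightarrow> x \<in> \<Theta> {}" by (intro \<Theta>_mono e) auto
  thus ?thesis using e(2) \<Theta>_empty by eventually_elim blast
qed

lemma \<Theta>_compl:
  assumes b: "b \<in> sets M" shows "AE x in M. x \<in> \<Theta> (space M - b) \<longleftrightarrow> x \<notin> \<Theta> b"
proof -
  have c: "space M - b \<in> sets M" using b by auto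
  let ?f = "\<lambda>n::nat. if n = 0 then b else space M - b"
  have "(\<Union>n. ?f n) = space M" using sets.sets_into_space[OF b] by (auto split: if_splits)
  moreover have "AE x in M. x \<in> \<Theta> (\<Union>n. ?f n) \<longleftrightarrow> (\<exists>n. x \<in> \<Theta> (?f n))"
    by (rule \<Theta>_UN) (use b c in auto)
  ultimately have "AE x in M. x \<in> \<Theta> (space M) \<longleftrightarrow> (\<exists>n. x \<in> \<Theta> (?f n))" by simp
  moreover have "AE x in M. \<not> (x \<in> \<Theta> b \<and> x \<in> \<Theta> (space M - b))" by (rule \<Theta>_disjoint[OF b c]) auto
  ultimately show ?thesis using \<Theta>_space by eventually_elim (auto split: if_splits)
qed

text \<open>The image of \<open>x\<close> is the limit of centres of balls \<open>b\<close> of radius \<open>2\<^sup>-\<^sup>k\<close> with \<open>x \<in> \<Theta> b\<close>.\<close>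

theorem point_realization: "\<exists>S\<in>M \<rightarrow>\<^sub>M M. \<forall>b\<in>sets M. AE x in M. S x \<in> b \<longleftrightarrow> x \<in> \<Theta> b"
proof -
  obtain X where X: "topspace X = space M" "polish_topology X" "sets (borel_of X) = sets M"
    using standard_borel by blast
  obtain d C where d: "Metric_space (space M) d" "Metric_space.mtopology (space M) d = X"
    "Metric_space.mcomplete (space M) d" "countable C" "C \<subseteq> space M"
    and dense: "\<And>x r. x \<in> space M \<Longrightarrow> 0 < r \<Longrightarrow> \<exists>q\<in>C. d x q < r"
    using polish_metric[OF X(2)] unfolding X(1) by metis
  interpret d: Metric_space "space M" d by (rule d)
  obtain p where p: "p \<in> space M" using not_empty by blast
  have C: "C \<noteq> {}" using dense[OF p, of 1] by auto
  define q where "q = from_nat_into C"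
  have q: "q n \<in> space M" for n using from_nat_into[OF C] d(5) by (auto simp: q_def)
  have q_dense: "\<exists>n. d x (q n) < r" if "x \<in> space M" "0 < r" for x r
    using dense[OF that] from_nat_into_surj[OF d(4)] unfolding q_def by metis
  define e where "e k = (1/2 :: real) ^ k" for k :: nat
  have e0: "0 < e k" for k by (simp add: e_def)
  have e_small: "\<exists>k0. \<forall>k\<ge>k0. e k < r" if "0 < r" for r
  proof -
    have "e \<longlonglongrightarrow> 0" unfolding e_def by (rule LIMSEQ_power_zero) simp
    thus ?thesis using that e0 by (auto simp: LIMSEQ_iff less_imp_le abs_of_nonneg)
  qed
  define ball where "ball k n = d.mball (q n) (e k)" for k n
  have ball_sets: "d.mball x r \<in> sets M" for x r
    using openin_borel_of[of X] d.openin_mball unfolding d(2) X(3) by blast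
  have ball: "ball k n \<in> sets M" for k n by (simp add: ball_def ball_sets)
  have UN_ball: "(\<Union>n. ball k n) = space M" for k
  proof
    show "space M \<subseteq> (\<Union>n. ball k n)"
    proof
      fix x assume x: "x \<in> space M"
      then obtain n where "d x (q n) < e k" using q_dense e0 by blast
      thus "x \<in> (\<Union>n. ball k n)" using x q d.commute[of x "q n"] by (auto simp: ball_def)
    qed
  qed (auto simp: ball_def)
  have "AE x in M. \<exists>n. x \<in> \<Theta> (ball k n)" for k
    using \<Theta>_UN[of "ball k", OF ball] \<Theta>_space unfolding UN_ball by eventually_elim blast
  hence ae1: "AE x in M. \<forall>k. \<exists>n. x \<in> \<Theta> (ball k n)" by (simp add: AE_all_countable)
  have "AE x in M. ball k n \<inter> ball l m = {} \<longrightarrow> \<not> (x \<in> \<Theta> (ball k n) \<and> x \<in> \<Theta> (ball l m))" for k n l m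
    using \<Theta>_disjoint[OF ball ball] by (cases "ball k n \<inter> ball l m = {}") auto
  hence ae2: "AE x in M. \<forall>k n l m. ball k n \<inter> ball l m = {} \<longrightarrow> \<not> (x \<in> \<Theta> (ball k n) \<and> x \<in> \<Theta> (ball l m))"
    by (simp add: AE_all_countable)
  have "AE x in M. (\<forall>k. \<exists>n. x \<in> \<Theta> (ball k n)) \<and>
      (\<forall>k n l m. ball k n \<inter> ball l m = {} \<longrightarrow> \<not> (x \<in> \<Theta> (ball k n) \<and> x \<in> \<Theta> (ball l m)))"
    using ae1 ae2 by eventually_elim blast
  \<comment> \<open>Countably many balls occur, so one null set collects all failures, and off
    \<open>N\<close> the conditions hold at every point.\<close>
  then obtain N where N: "N \<in> null_sets M"
    and good: "\<And>x. x \<in> space M - N \<Longrightarrow> (\<forall>k. \<exists>n. x \<in> \<Theta> (ball k n)) \<and>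
      (\<forall>k n l m. ball k n \<inter> ball l m = {} \<longrightarrow> \<not> (x \<in> \<Theta> (ball k n) \<and> x \<in> \<Theta> (ball l m)))"
    by (rule AE_E3) blast
  have NM: "N \<in> sets M" "AE x in M. x \<notin> N" using N AE_not_in by auto
  have close: "d (q n) (q m) < e k + e l"
    if "x \<in> space M - N" "x \<in> \<Theta> (ball k n)" "x \<in> \<Theta> (ball l m)" for x k n l m
  proof -
    have "ball k n \<inter> ball l m \<noteq> {}" using good[OF that(1)] that(2,3) by blast
    then obtain y where y: "y \<in> space M" "d (q n) y < e k" "d (q m) y < e l" by (auto simp: ball_def)
    have "d (q n) (q m) \<le> d (q n) y + d y (q m)" by (rule d.triangle) (use q y in auto)
    thus ?thesis using y d.commute[of y "q m"] by simp
  qed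
  have "\<exists>l\<in>space M. \<forall>k n. x \<in> \<Theta> (ball k n) \<longrightarrow> d (q n) l \<le> e k" if x: "x \<in> space M - N" for x
  proof -
    obtain n where n: "\<And>k. x \<in> \<Theta> (ball k (n k))" using good[OF x] by metis
    have "d.MCauchy (\<lambda>k. q (n k))"
      unfolding d.MCauchy_def
    proof (intro conjI allI impI)
      show "range (\<lambda>k. q (n k)) \<subseteq> space M" using q by auto
      fix r :: real assume r: "0 < r"
      obtain k0 where k0: "\<forall>k\<ge>k0. e k < r / 2" using e_small[of "r / 2"] r by auto
      have "d (q (n k)) (q (n l)) < r" if "k0 \<le> k" "k0 \<le> l" for k l
      proof -
        have "e k < r / 2" "e l < r / 2" using k0 that by auto
        thus ?thesis using close[OF x n[of k] n[of l]] by linarith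
      qed
      thus "\<exists>k0. \<forall>k l. k0 \<le> k \<longrightarrow> k0 \<le> l \<longrightarrow> d (q (n k)) (q (n l)) < r" by blast
    qed
    then obtain l where l: "limitin d.mtopology (\<lambda>k. q (n k)) l sequentially"
      using d(3) unfolding d.mcomplete_def by blast
    have lM: "l \<in> space M" using l by (simp add: d.limitin_metric)
    have "d (q m) l \<le> e k" if m: "x \<in> \<Theta> (ball k m)" for k m
    proof (rule field_le_epsilon)
      fix r :: real assume r: "0 < r"
      obtain k0 where k0: "\<forall>k\<ge>k0. e k < r / 2" using e_small[of "r / 2"] r by auto
      obtain k1 where k1: "\<forall>k\<ge>k1. d (q (n k)) l < r / 2"
        using l r unfolding d.limit_metric_sequentially by (metis half_gt_zero)
      let ?j = "max k0 k1"
      have "d (q m) l \<le> d (q m) (q (n ?j)) + d (q (n ?j)) l" by (rule d.triangle) (use q lM in auto)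
      moreover have "d (q m) (q (n ?j)) < e k + e ?j" by (rule close[OF x m n])
      moreover have "e ?j < r / 2" "d (q (n ?j)) l < r / 2" using k0 k1 by auto
      ultimately show "d (q m) l \<le> e k + r" by linarith
    qed
    thus ?thesis using lM by blast
  qed
  then obtain L where L: "\<And>x. x \<in> space M - N \<Longrightarrow> L x \<in> space M"
      "\<And>x k n. x \<in> space M - N \<Longrightarrow> x \<in> \<Theta> (ball k n) \<Longrightarrow> d (q n) (L x) \<le> e k" by metis
  define S where "S x = (if x \<in> space M - N then L x else p)" for x
  \<comment> \<open>The radius \<open>3 * e k\<close> leaves room on both sides: \<open>L x\<close>
    is within \<open>e k\<close> of the centre \<open>q n\<close>, hence inside the enlarged ball,
    and an enlarged ball whose centre is within \<open>e k\<close> of \<open>y\<close> stays inside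
    the ball of radius \<open>4 * e k\<close> around \<open>y\<close>.\<close>
  define J where "J U = {(k, n). d.mball (q n) (3 * e k) \<subseteq> U}" for U
  have four: "d.mball (q n) (3 * e k) \<subseteq> d.mball y r"
    if "y \<in> space M" "d y (q n) \<le> e k" "4 * e k < r" for y k n r
  proof
    fix z assume "z \<in> d.mball (q n) (3 * e k)"
    hence z: "z \<in> space M" "d (q n) z < 3 * e k" by auto
    have "d y z \<le> d y (q n) + d (q n) z" by (rule d.triangle) (use that z q in auto)
    thus "z \<in> d.mball y r" using that z by simp
  qed
  have small4: "\<exists>k. 4 * e k < r" if r: "0 < r" for r
  proof -
    obtain k where "\<forall>l\<ge>k. e l < r / 4" using e_small[of "r / 4"] r by auto
    hence "e k < r / 4" by simp
    thus ?thesis by (intro exI[of _ k]) simp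
  qed
  have S_open: "L x \<in> U \<longleftrightarrow> (\<exists>(k, n)\<in>J U. x \<in> \<Theta> (ball k n))"
    if U: "openin X U" and x: "x \<in> space M - N" for U x
  proof
    assume "L x \<in> U"
    then obtain r where r: "0 < r" "d.mball (L x) r \<subseteq> U" using U unfolding d(2)[symmetric] d.openin_mtopology by blast
    obtain k where k: "4 * e k < r" using small4[OF r(1)] by blast
    obtain n where n: "x \<in> \<Theta> (ball k n)" using good[OF x] by blast
    have "d.mball (q n) (3 * e k) \<subseteq> d.mball (L x) r"
      by (rule four[OF L(1)[OF x] _ k]) (use L(2)[OF x n] d.commute in metis)
    hence "(k, n) \<in> J U" using r(2) by (auto simp: J_def)
    thus "\<exists>(k, n)\<in>J U. x \<in> \<Theta> (ball k n)" using n by blast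
  next
    assume "\<exists>(k, n)\<in>J U. x \<in> \<Theta> (ball k n)"
    then obtain k n where kn: "d.mball (q n) (3 * e k) \<subseteq> U" "x \<in> \<Theta> (ball k n)" by (auto simp: J_def)
    have "L x \<in> d.mball (q n) (3 * e k)" using L(1)[OF x] L(2)[OF x kn(2)] q e0[of k] by simp
    thus "L x \<in> U" using kn(1) by blast
  qed
  have open_UN: "U = (\<Union>(k, n)\<in>J U. ball k n)" if U: "openin X U" for U
  proof
    show "U \<subseteq> (\<Union>(k, n)\<in>J U. ball k n)"
    proof
      fix y assume y: "y \<in> U"
      hence yM: "y \<in> space M" using openin_subset[OF U] X(1) by auto
      obtain r where r: "0 < r" "d.mball y r \<subseteq> U" using U y unfolding d(2)[symmetric] d.openin_mtopology by blast
      obtain k where k: "4 * e k < r" using small4[OF r(1)] by blast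
      obtain n where n: "d y (q n) < e k" using q_dense[OF yM e0] by blast
      have "d.mball (q n) (3 * e k) \<subseteq> d.mball y r" by (rule four[OF yM _ k]) (use n in simp)
      hence "(k, n) \<in> J U" using r(2) by (auto simp: J_def)
      moreover have "y \<in> ball k n" using n yM q d.commute[of y "q n"] by (simp add: ball_def)
      ultimately show "y \<in> (\<Union>(k, n)\<in>J U. ball k n)" by blast
    qed
    have "ball k n \<subseteq> d.mball (q n) (3 * e k)" for k n
      unfolding ball_def by (rule d.mball_subset_concentric) (use e0[of k] in simp)
    thus "(\<Union>(k, n)\<in>J U. ball k n) \<subseteq> U" by (fastforce simp: J_def)
  qed
  have ae_open: "AE x in M. x \<in> \<Theta> U \<longleftrightarrow> (\<exists>(k, n)\<in>J U. x \<in> \<Theta> (ball k n))" if U: "openin X U" for U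
  proof -
    \<comment> \<open>The index set \<open>J U\<close> is turned into a sequence; codes outside it
      contribute the empty set, whose image is null.\<close>
    let ?b = "\<lambda>i. if prod_decode i \<in> J U then ball (fst (prod_decode i)) (snd (prod_decode i)) else {}"
    have "(\<Union>i. ?b i) = (\<Union>(k, n)\<in>J U. ball k n)"
      by (force split: if_splits intro: exI[of _ "prod_encode _"])
    hence "(\<Union>i. ?b i) = U" using open_UN[OF U] by simp
    moreover have "AE x in M. x \<in> \<Theta> (\<Union>i. ?b i) \<longleftrightarrow> (\<exists>i. x \<in> \<Theta> (?b i))"
      by (rule \<Theta>_UN) (use ball in auto)
    ultimately have "AE x in M. x \<in> \<Theta> U \<longleftrightarrow> (\<exists>i. x \<in> \<Theta> (?b i))" by simp
    thus ?thesis using \<Theta>_empty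
    proof eventually_elim
      case (elim x)
      have "(\<exists>i. x \<in> \<Theta> (?b i)) \<longleftrightarrow> (\<exists>(k, n)\<in>J U. x \<in> \<Theta> (ball k n))"
      proof
        assume "\<exists>i. x \<in> \<Theta> (?b i)"
        then obtain i where "x \<in> \<Theta> (?b i)" by blast
        hence "prod_decode i \<in> J U" "x \<in> \<Theta> (ball (fst (prod_decode i)) (snd (prod_decode i)))"
          using elim by (auto split: if_splits)
        thus "\<exists>(k, n)\<in>J U. x \<in> \<Theta> (ball k n)" by (intro bexI[of _ "prod_decode i"]) auto
      next
        assume "\<exists>(k, n)\<in>J U. x \<in> \<Theta> (ball k n)"
        then obtain k n where "(k, n) \<in> J U" "x \<in> \<Theta> (ball k n)" by blast
        thus "\<exists>i. x \<in> \<Theta> (?b i)" by (intro exI[of _ "prod_encode (k, n)"]) simp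
      qed
      thus ?case using elim by simp
    qed
  qed
  have SM: "S x \<in> space M" for x using L(1) p by (simp add: S_def)
  have "b \<in> sigma_sets (space M) {U. openin X U} \<Longrightarrow>
      S -` b \<inter> space M \<in> sets M \<and> (AE x in M. S x \<in> b \<longleftrightarrow> x \<in> \<Theta> b)" for b
  proof (induction b rule: sigma_sets.induct)
    case (Basic U)
    hence U: "openin X U" by simp
    let ?V = "\<Union>(k, n)\<in>J U. \<Theta> (ball k n)"
    have V: "?V \<in> sets M"
      by (rule sets.countable_UN') (use ball \<Theta>_sets in auto)
    have "S -` U \<inter> space M = (?V \<inter> (space M - N)) \<union> (if p \<in> U then N \<inter> space M else {})"
    proof (rule Set.set_eqI)
      fix x
      have "x \<in> ?V \<longleftrightarrow> (\<exists>(k, n)\<in>J U. x \<in> \<Theta> (ball k n))" by auto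
      thus "x \<in> S -` U \<inter> space M \<longleftrightarrow> x \<in> (?V \<inter> (space M - N)) \<union> (if p \<in> U then N \<inter> space M else {})"
        using S_open[OF U, of x] by (cases "x \<in> N") (auto simp: S_def)
    qed
    hence "S -` U \<inter> space M \<in> sets M" using V NM(1) by auto
    moreover have "AE x in M. S x \<in> U \<longleftrightarrow> x \<in> \<Theta> U"
      using ae_open[OF U] NM(2) AE_space by eventually_elim (use S_open[OF U] in \<open>simp add: S_def\<close>)
    ultimately show ?case by blast
  next
    case Empty
    show ?case using \<Theta>_empty by simp
  next
    case (Compl a)
    hence a: "a \<in> sets M" using X(1,3) by (simp add: sets_borel_of)
    have "S -` (space M - a) \<inter> space M = space M - (S -` a \<inter> space M)" using SM by auto
    moreover have "AE x in M. S x \<in> space M - a \<longleftrightarrow> x \<in> \<Theta> (space M - a)"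
      using \<Theta>_compl[OF a] Compl.IH[THEN conjunct2] by eventually_elim (use SM in auto)
    ultimately show ?case using Compl.IH by auto
  next
    case (Union b)
    have b: "b n \<in> sets M" for n using Union.hyps[of n] X(1,3) by (simp add: sets_borel_of)
    have "S -` (\<Union>n. b n) \<inter> space M = (\<Union>n. S -` b n \<inter> space M)" by auto
    also have "\<dots> \<in> sets M" by (rule sets.countable_UN) (use Union.IH in blast)
    finally have "S -` (\<Union>n. b n) \<inter> space M \<in> sets M" .
    moreover have "AE x in M. \<forall>n. S x \<in> b n \<longleftrightarrow> x \<in> \<Theta> (b n)"
      using Union.IH by (simp add: AE_all_countable)
    hence "AE x in M. S x \<in> (\<Union>n. b n) \<longleftrightarrow> x \<in> \<Theta> (\<Union>n. b n)"
      using \<Theta>_UN[of b, OF b] by eventually_elim blast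
    ultimately show ?case by blast
  qed
  moreover have "sets M = sigma_sets (space M) {U. openin X U}"
    using X by (simp add: sets_borel_of flip: X(3))
  ultimately have "S \<in> M \<rightarrow>\<^sub>M M" "\<forall>b\<in>sets M. AE x in M. S x \<in> b \<longleftrightarrow> x \<in> \<Theta> b"
    using SM by (auto intro!: measurableI)
  thus ?thesis by blast
qed

end

text \<open>Let \<open>f\<close> be the density of \<open>N\<close>. If \<open>f < 1\<close> and
  \<open>f > 1\<close> both occurred with positive measure, some \<open>T\<close> would move a part
  \<open>C\<close> of the first set into the second; invariance then gives
  \<open>M C \<le> N C\<close>, whereas \<open>f < 1\<close> on \<open>C\<close> gives
  \<open>N C < M C\<close>. So \<open>f\<close> stays on one side of 1, and as its integral is 1 it
  equals 1.\<close>

lemma (in ergodic_relation) invariant_measure_unique: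
  assumes N: "prob_space N" "sets N = sets M" "absolutely_continuous M N"
    and inv: "\<And>T b. T \<in> fg \<Longrightarrow> b \<in> sets M \<Longrightarrow> emeasure N (T -` b \<inter> space M) = emeasure N b"
  shows "N = M"
proof -
  interpret N: prob_space N by (rule N)
  obtain f where f: "f \<in> borel_measurable M" "density M f = N"
    using Radon_Nikodym[OF N(3,2)] by blast
  have Nm: "emeasure N b = (\<integral>\<^sup>+x. f x * indicator b x \<partial>M)" if "b \<in> sets M" for b
    using emeasure_density[OF f(1) that] f(2) by simp
  have m: "emeasure M b = (\<integral>\<^sup>+x. indicator b x \<partial>M)" if "b \<in> sets M" for b
    using that by simp
  let ?a = "{x \<in> space M. f x < 1}" and ?b = "{x \<in> space M. 1 < f x}"
  have ab: "?a \<in> sets M" "?b \<in> sets M" using f(1) by measurable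
  have less: "emeasure N C < emeasure M C" if C: "C \<in> sets M" "C \<subseteq> ?a" "emeasure M C \<noteq> 0" for C
    unfolding Nm[OF C(1)] m[OF C(1)]
  proof (rule nn_integral_less)
    show "(\<integral>\<^sup>+x. f x * indicator C x \<partial>M) \<noteq> \<infinity>" using N.emeasure_finite[of C] unfolding Nm[OF C(1)] by simp
    show "AE x in M. f x * indicator C x \<le> indicator C x"
      by (rule AE_I2) (use C(2) in \<open>auto simp: indicator_def\<close>)
    show "\<not> (AE x in M. indicator C x \<le> f x * indicator C x)"
    proof
      assume "AE x in M. indicator C x \<le> f x * indicator C x"
      hence "AE x in M. x \<notin> C"
        by eventually_elim (use C(2) in \<open>auto simp: indicator_def not_less[symmetric] split: if_splits\<close>)
      thus False using C(3) AE_iff_null_sets[OF C(1)] by (simp add: null_sets_def)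
    qed
  qed (use f C in auto)
  have greater: "emeasure M C \<le> emeasure N C" if C: "C \<in> sets M" "C \<subseteq> ?b" for C
    unfolding Nm[OF C(1)] m[OF C(1)]
    by (rule nn_integral_mono_AE, rule AE_I2) (use C(2) in \<open>auto simp: indicator_def less_imp_le\<close>)
  have "measure M ?a = 0 \<or> measure M ?b = 0"
  proof (rule ccontr)
    assume "\<not> ?thesis"
    hence "0 < measure M ?a" "0 < measure M ?b" using measure_nonneg[of M] by (auto simp: less_le)
    then obtain T C where T: "T \<in> fg" "C \<in> sets M" "C \<subseteq> ?a" "0 < measure M C" "T ` C \<subseteq> ?b"
      using moving[OF ab] by blast
    have TC: "T ` C \<in> sets M" by (rule mp_image_sets[OF fgroup_mp[OF T(1)] T(2)])
    have "T -` (T ` C) \<inter> space M = C"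
      using fg_inj[OF T(1)] sets.sets_into_space[OF T(2)] by blast
    hence "emeasure N C = emeasure N (T ` C)" using inv[OF T(1) TC] by simp
    also have "\<dots> \<ge> emeasure M (T ` C)" by (rule greater[OF TC T(5)])
    finally have "emeasure M C \<le> emeasure N C" using mp_emeasure_image[OF fgroup_mp[OF T(1)] T(2)] by simp
    moreover have "emeasure M C \<noteq> 0" using T(4) by (simp add: emeasure_eq_measure)
    ultimately show False using less[OF T(2,3)] by simp
  qed
  moreover have int: "(\<integral>\<^sup>+x. f x \<partial>M) = 1" "(\<integral>\<^sup>+x. 1 \<partial>M) = 1"
  proof -
    have "(\<integral>\<^sup>+x. f x \<partial>M) = (\<integral>\<^sup>+x. f x * indicator (space M) x \<partial>M)"
      by (rule nn_integral_cong) simp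
    also have "\<dots> = 1"
      using Nm[of "space M"] N.emeasure_space_1 sets_eq_imp_space_eq[OF N(2)] by simp
    finally show "(\<integral>\<^sup>+x. f x \<partial>M) = 1" .
  qed (simp add: emeasure_space_1)
  have "AE x in M. f x = 1"
  proof -
    from calculation consider "AE x in M. 1 \<le> f x" | "AE x in M. f x \<le> 1"
    proof
      assume "measure M ?a = 0"
      hence "?a \<in> null_sets M" using ab by (simp add: null_sets_def emeasure_eq_measure)
      hence "AE x in M. 1 \<le> f x" by (rule AE_I') auto
      thus thesis using that by blast
    next
      assume "measure M ?b = 0"
      hence "?b \<in> null_sets M" using ab by (simp add: null_sets_def emeasure_eq_measure)
      hence "AE x in M. f x \<le> 1" by (rule AE_I') auto
      thus thesis using that by blast
    qed
    thus ?thesis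
    proof cases
      case 1
      have "AE x in M. f x \<le> 1"
      proof (rule ccontr)
        assume "\<not> ?thesis"
        hence "(\<integral>\<^sup>+x. 1 \<partial>M) < (\<integral>\<^sup>+x. f x \<partial>M)" by (intro nn_integral_less) (use 1 f int in auto)
        thus False using int by simp
      qed
      thus ?thesis using 1 by eventually_elim simp
    next
      case 2
      have "AE x in M. 1 \<le> f x"
      proof (rule ccontr)
        assume "\<not> ?thesis"
        hence "(\<integral>\<^sup>+x. f x \<partial>M) < (\<integral>\<^sup>+x. 1 \<partial>M)" by (intro nn_integral_less) (use 2 f int in auto)
        thus False using int by simp
      qed
      thus ?thesis using 2 by eventually_elim simp
    qed
  qed
  hence "density M f = density M (\<lambda>_. 1)" by (intro density_cong) (use f in auto)
  thus "N = M" using f(2) by (simp add: density_1)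
qed

text \<open>The head of the list acts first, so a word applied to \<open>S x\<close> is the word
  with one more letter in front applied to \<open>x\<close>; this makes the set defined by all words
  invariant.\<close>

primrec word_action :: "('a \<Rightarrow> 'a) \<Rightarrow> ('a \<Rightarrow> 'a) \<Rightarrow> bool list \<Rightarrow> 'a \<Rightarrow> 'a" where
  "word_action S S' [] x = x"
| "word_action S S' (b # w) x = word_action S S' w (if b then S x else S' x)"

text \<open>The set consists of the points none of whose translates by words in \<open>S\<close>, \<open>S'\<close> is exceptional.\<close>

lemma invariant_conull_set:
  assumes S: "mp_map M S" "mp_map M S'"
    and ae: "AE x in M. S (S' x) = x" "AE x in M. S' (S x) = x" "AE x in M. x \<in> E"
  shows "\<exists>A\<in>sets M. (AE x in M. x \<in> A) \<and> A \<subseteq> E \<and> mp_bijection (restrict_space M A) S \<and>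
    (\<forall>x\<in>A. S x \<in> A \<and> S' x \<in> A \<and> S (S' x) = x \<and> S' (S x) = x)"
proof -
  have "AE x in M. S (S' x) = x \<and> S' (S x) = x \<and> x \<in> E" using ae by eventually_elim simp
  then obtain N where N: "N \<in> null_sets M" "\<And>x. x \<in> space M - N \<Longrightarrow> S (S' x) = x \<and> S' (S x) = x \<and> x \<in> E"
    by (rule AE_E3) blast
  have NM: "N \<in> sets M" "AE x in M. x \<notin> N" using N AE_not_in by auto
  let ?w = "word_action S S'"
  have meas: "S \<in> M \<rightarrow>\<^sub>M M" "S' \<in> M \<rightarrow>\<^sub>M M" using S by (auto simp: mp_map_def)
  have w: "mp_map M (?w v)" for v
  proof (induction v)
    case Nil
    have "mp_map M (\<lambda>x. x)" by (simp add: mp_map_def)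
    thus ?case by simp
  next
    case (Cons b v)
    show ?case using mp_map_comp[OF Cons S(1)] mp_map_comp[OF Cons S(2)] by (cases b) simp_all
  qed
  define A where "A = (\<Inter>v. ?w v -` (space M - N) \<inter> space M)"
  have As: "A \<in> sets M"
    unfolding A_def
  proof (rule sets.countable_INT')
    have "?w v -` (space M - N) \<inter> space M \<in> sets M" for v
      by (rule measurable_sets[of _ M M]) (use w[of v] NM in \<open>auto simp: mp_map_def\<close>)
    thus "(\<lambda>v. ?w v -` (space M - N) \<inter> space M) ` UNIV \<subseteq> sets M" by blast
  qed auto
  have "AE x in M. ?w v x \<notin> N" for v by (rule mp_map_AE[OF w NM(2)])
  hence "AE x in M. \<forall>v. ?w v x \<notin> N" by (simp add: AE_all_countable)
  hence aeA: "AE x in M. x \<in> A" using AE_space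
  proof eventually_elim
    case (elim x)
    have "?w v x \<in> space M" for v
      using w[of v] elim(2) by (auto simp: mp_map_def dest: measurable_space)
    thus ?case using elim by (simp add: A_def)
  qed
  have AM: "A \<subseteq> space M" by (rule sets.sets_into_space[OF As])
  have SA: "S x \<in> A" "S' x \<in> A" if x: "x \<in> A" for x
  proof -
    have "?w (True # v) x \<in> space M - N" "?w (False # v) x \<in> space M - N" for v
      using x by (auto simp only: A_def)
    moreover have "S x \<in> space M" "S' x \<in> space M"
      using measurable_space[OF meas(1)] measurable_space[OF meas(2)] x AM by blast+
    ultimately show "S x \<in> A" "S' x \<in> A" by (auto simp: A_def)
  qed
  have A_good: "S (S' x) = x" "S' (S x) = x" "x \<in> E" if "x \<in> A" for x
  proof -
    have "?w [] x \<in> space M - N" using that by (auto simp only: A_def)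
    thus "S (S' x) = x" "S' (S x) = x" "x \<in> E" using N(2)[of x] by auto
  qed
  let ?R = "restrict_space M A"
  have sp: "space ?R = A" using AM by (auto simp: space_restrict_space)
  have bij: "bij_betw S A A"
    by (rule bij_betw_byWitness[of _ S']) (use SA A_good in auto)
  have mR: "f \<in> ?R \<rightarrow>\<^sub>M ?R" if "f \<in> M \<rightarrow>\<^sub>M M" "\<And>x. x \<in> A \<Longrightarrow> f x \<in> A" for f
    by (rule measurable_restrict_space2) (use that sp in \<open>auto intro: measurable_restrict_space1\<close>)
  have "distr ?R ?R S = ?R"
  proof (rule measure_eqI)
    fix B assume "B \<in> sets (distr ?R ?R S)"
    hence B: "B \<in> sets ?R" by simp
    hence B': "B \<in> sets M" "B \<subseteq> A" using As by (auto simp: sets_restrict_space_iff)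
    have p: "S -` B \<inter> A \<in> sets M" using measurable_sets[OF meas(1) B'(1)] As AM
      by (metis Int_assoc inf.absorb_iff2 sets.Int)
    have "emeasure (distr ?R ?R S) B = emeasure ?R (S -` B \<inter> A)"
      using emeasure_distr[OF mR[OF meas(1) SA(1)] B] sp by simp
    also have "\<dots> = emeasure M (S -` B \<inter> A)"
      using As AM by (subst emeasure_restrict_space) auto
    also have "\<dots> = emeasure M (S -` B \<inter> space M)"
      by (rule emeasure_eq_AE) (use p measurable_sets[OF meas(1) B'(1)] aeA AM in \<open>auto elim!: eventually_mono\<close>)
    also have "\<dots> = emeasure M B"
      using emeasure_distr[OF meas(1) B'(1)] S(1) by (simp add: mp_map_def)
    also have "\<dots> = emeasure ?R B" using B' As AM by (subst emeasure_restrict_space) auto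
    finally show "emeasure (distr ?R ?R S) B = emeasure ?R B" .
  qed simp
  moreover have "inv_into A S \<in> ?R \<rightarrow>\<^sub>M ?R"
  proof (rule measurable_cong[THEN iffD1, OF _ mR[OF meas(2) SA(2)]])
    fix x assume "x \<in> space ?R"
    hence "x \<in> A" by (simp add: sp)
    thus "S' x = inv_into A S x"
      using bij SA A_good by (intro inv_into_f_eq[symmetric]) (auto simp: bij_betw_def)
  qed
  ultimately have "mp_bijection ?R S"
    using bij mR[OF meas(1) SA(1)] by (simp add: mp_bijection_def mp_map_def sp)
  thus ?thesis using As aeA SA A_good by (intro bexI[of _ A]) auto
qed

section \<open>Isomorphisms of full groups are spatial\<close>

context ergodic_relation
begin

text \<open>\<open>T\<close> preserves the set where its square is the identity; restricted to this
  conull set and extended by the identity it becomes an involution at every point, as the results on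
  supports require.\<close>

lemma exact_involution:
  assumes T: "T \<in> fg" "AE x in M. T (T x) = x"
  obtains P where "P \<in> fg" "\<And>x. x \<in> space M \<Longrightarrow> P (P x) = x" "AE x in M. P x = T x"
proof -
  define E where "E = {x \<in> space M. (T \<star> T) x = x}"
  have E: "E \<in> sets M" unfolding E_def by (rule fixed_sets[OF fg_comp[OF T(1) T(1)]])
  have sp: "T x \<in> space M" if "x \<in> space M" for x by (rule fg_space[OF T(1) that])
  have inv: "T x \<in> E \<longleftrightarrow> x \<in> E" if "x \<in> space M" for x
    using that sp fg_inj[OF T(1), of "T (T x)" x] by (auto simp: E_def)
  obtain P where P: "P \<in> fg" "\<And>x. x \<in> space M \<Longrightarrow> P x = (if x \<in> E then T x else x)"
    by (rule fg_restrict[OF T(1) E inv]) blast+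
  have "AE x in M. P x = T x" using T(2) AE_space by eventually_elim (simp add: P(2) E_def)
  moreover have "P (P x) = x" if "x \<in> space M" for x
    using that P(2) sp inv by (auto simp: E_def)
  ultimately show thesis using that P(1) by blast
qed

text \<open>An involution whose support is \<open>a\<close> tests the inclusion: it belongs to
  \<open>supported a\<close>, and to \<open>supported b\<close> only if \<open>a\<close> is
  contained in \<open>b\<close> up to a null set.\<close>

lemma supported_subset_iff:
  assumes "a \<in> sets M" shows "supported a \<subseteq> supported b \<longleftrightarrow> (AE x in M. x \<in> a \<longrightarrow> x \<in> b)"
proof
  assume sub: "supported a \<subseteq> supported b"
  obtain P where P: "P \<in> fg" "AE x in M. x \<in> a \<longleftrightarrow> P x \<noteq> x"
    by (rule involution_support[OF assms]) blast
  have "cls P \<in> supported a" unfolding cls_supported_iff[OF P(1)] using P(2) by eventually_elim simp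
  hence "AE x in M. x \<notin> b \<longrightarrow> P x = x" using sub cls_supported_iff[OF P(1)] by blast
  thus "AE x in M. x \<in> a \<longrightarrow> x \<in> b" using P(2) by eventually_elim blast
next
  assume ab: "AE x in M. x \<in> a \<longrightarrow> x \<in> b"
  have "AE x in M. x \<notin> b \<longrightarrow> T x = x" if "AE x in M. x \<notin> a \<longrightarrow> T x = x" for T
    using that ab by eventually_elim blast
  thus "supported a \<subseteq> supported b" unfolding supported_def by blast
qed

lemma supported_eq_iff:
  assumes "a \<in> sets M" "b \<in> sets M"
  shows "supported a = supported b \<longleftrightarrow> (AE x in M. x \<in> a \<longleftrightarrow> x \<in> b)"
proof -
  have "supported a = supported b \<longleftrightarrow> (AE x in M. x \<in> a \<longrightarrow> x \<in> b) \<and> (AE x in M. x \<in> b \<longrightarrow> x \<in> a)"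
    using supported_subset_iff assms by blast
  also have "\<dots> \<longleftrightarrow> (AE x in M. x \<in> a \<longleftrightarrow> x \<in> b)"
    unfolding AE_conj_iff[symmetric] by (intro arg_cong[where f = "\<lambda>P. AE x in M. P x"]) auto
  finally show ?thesis .
qed

lemma supported_carrier: "supported a \<subseteq> carrier K"
  by (auto simp: supported_def K_carrier)

lemma supported_empty: "supported {} = {\<one>\<^bsub>K\<^esub>}"
proof -
  let ?I = "\<lambda>x\<in>space M. x"
  have "u = cls ?I" if u: "u \<in> supported {}" for u
  proof -
    obtain T where T: "T \<in> fg" "u = cls T" "AE x in M. x \<notin> {} \<longrightarrow> T x = x"
      using u unfolding supported_def by blast
    have "AE x in M. T x = ?I x" using T(3) AE_space by eventually_elim simp
    thus ?thesis using T(1,2) cls_eq_iff[OF T(1) fg_id] by simp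
  qed
  moreover have "cls ?I \<in> supported {}"
    unfolding cls_supported_iff[OF fg_id] by (rule AE_I2) simp
  ultimately show ?thesis unfolding full_group_one by blast
qed

text \<open>Conjugation by \<open>T\<close> carries the elements supported in the preimage of
  \<open>a\<close> to those supported in \<open>a\<close>. It is written as
  \<open>T u = v T\<close>, without an inverse, so that it passes directly through an
  isomorphism.\<close>

lemma supported_preimage:
  assumes T: "T \<in> fg"
  shows "supported (T -` a \<inter> space M) =
    {u \<in> carrier K. \<exists>v\<in>supported a. cls T \<otimes>\<^bsub>K\<^esub> u = v \<otimes>\<^bsub>K\<^esub> cls T}"
proof -
  have "cls U \<in> supported (T -` a \<inter> space M) \<longleftrightarrow> (\<exists>v\<in>supported a. cls T \<otimes>\<^bsub>K\<^esub> cls U = v \<otimes>\<^bsub>K\<^esub> cls T)"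
    if U: "U \<in> fg" for U
  proof
    assume "cls U \<in> supported (T -` a \<inter> space M)"
    hence ae: "AE x in M. x \<notin> T -` a \<inter> space M \<longrightarrow> U x = x" by (simp add: cls_supported_iff U)
    obtain T' where T': "T' \<in> fg" "\<And>x. x \<in> space M \<Longrightarrow> T (T' x) = x" "\<And>x. x \<in> space M \<Longrightarrow> T' (T x) = x"
      using fg_inverse[OF T] by metis
    let ?V = "T \<star> (U \<star> T')"
    have V: "?V \<in> fg" by (intro fg_comp T U T')
    have "AE y in M. y \<notin> a \<longrightarrow> ?V y = y"
      using fg_AE[OF T'(1) ae] AE_space by eventually_elim (use T'(2) in auto)
    hence "cls ?V \<in> supported a" by (simp only: cls_supported_iff[OF V])
    moreover have "cls T \<otimes>\<^bsub>K\<^esub> cls U = cls ?V \<otimes>\<^bsub>K\<^esub> cls T"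
      unfolding cls_mult_eq_iff[OF T U V T]
      by (rule AE_I2) (use T'(3) fg_space T in simp)
    ultimately show "\<exists>v\<in>supported a. cls T \<otimes>\<^bsub>K\<^esub> cls U = v \<otimes>\<^bsub>K\<^esub> cls T" by blast
  next
    assume "\<exists>v\<in>supported a. cls T \<otimes>\<^bsub>K\<^esub> cls U = v \<otimes>\<^bsub>K\<^esub> cls T"
    then obtain V where V: "V \<in> fg" "AE x in M. x \<notin> a \<longrightarrow> V x = x"
      "cls T \<otimes>\<^bsub>K\<^esub> cls U = cls V \<otimes>\<^bsub>K\<^esub> cls T" by (auto simp: supported_def)
    have "AE x in M. T (U x) = V (T x)" using V(3) cls_mult_eq_iff[OF T U V(1) T] by blast
    hence "AE x in M. x \<notin> T -` a \<inter> space M \<longrightarrow> U x = x"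
      using fg_AE[OF T V(2)] AE_space
    proof eventually_elim
      case (elim x)
      show ?case
      proof
        assume "x \<notin> T -` a \<inter> space M"
        hence "T (U x) = T x" using elim by simp
        thus "U x = x" using fg_inj[OF T fg_space[OF U elim(3)] elim(3)] by simp
      qed
    qed
    thus "cls U \<in> supported (T -` a \<inter> space M)" by (simp add: cls_supported_iff U)
  qed
  moreover have "supported (T -` a \<inter> space M) \<subseteq> cls ` fg" by (auto simp: supported_def)
  ultimately show ?thesis by (auto simp: K_carrier)
qed

end

section \<open>Transport of supports and the point map\<close>

locale full_group_iso = A: ergodic_relation M R + B: ergodic_relation M R' +
    group_iso "full_group M R" "full_group M R'" h for M :: "'a measure" and R R' h
begin

text \<open>The set \<open>a\<close> is the support of an involution \<open>P\<close>, and
  \<open>h\<close> sends its class to that of some pointwise involution \<open>Q\<close>. Since both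
  supported subgroups are given by the same group-theoretic formula, \<open>b\<close> is the support
  of \<open>Q\<close>.\<close>

lemma supported_image:
  assumes a: "a \<in> sets M" shows "\<exists>b\<in>sets M. h ` A.supported a = B.supported b"
proof -
  obtain P where P: "P \<in> A.fg" "\<And>x. x \<in> space M \<Longrightarrow> P (P x) = x" "AE x in M. x \<in> a \<longleftrightarrow> P x \<noteq> x"
    by (rule A.involution_support[OF a]) blast
  let ?s = "\<lambda>P. {x \<in> space M. P x \<noteq> x}"
  have Pc: "aut_class M P \<in> carrier A.K" using P(1) by (auto simp: A.K_carrier)
  have "h (aut_class M P) \<in> carrier B.K" using closed[OF Pc] .
  then obtain Q0 where Q0: "Q0 \<in> B.fg" "h (aut_class M P) = aut_class M Q0" by (auto simp: B.K_carrier)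
  have "aut_class M P \<otimes>\<^bsub>A.K\<^esub> aut_class M P = \<one>\<^bsub>A.K\<^esub>"
    unfolding A.cls_mult_one_iff[OF P(1) P(1)] by (rule AE_I2) (rule P(2))
  hence "aut_class M Q0 \<otimes>\<^bsub>B.K\<^esub> aut_class M Q0 = \<one>\<^bsub>B.K\<^esub>"
    using mult[OF Pc Pc] one Q0(2) by simp
  hence "AE x in M. Q0 (Q0 x) = x" unfolding B.cls_mult_one_iff[OF Q0(1) Q0(1)] .
  then obtain Q where Q: "Q \<in> B.fg" "\<And>x. x \<in> space M \<Longrightarrow> Q (Q x) = x" "AE x in M. Q x = Q0 x"
    using B.exact_involution[OF Q0(1)] by blast
  have hP: "h (aut_class M P) = aut_class M Q" using B.cls_eq_iff[OF Q(1) Q0(1)] Q(3) Q0(2) by simp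
  have s: "?s P \<in> sets M" "?s Q \<in> sets M" using A.suppP_sets[OF P(1,2)] B.suppP_sets[OF Q(1,2)] by blast+
  have "AE x in M. x \<in> a \<longleftrightarrow> x \<in> ?s P" using P(3) AE_space by eventually_elim simp
  hence "A.supported a = A.supported (?s P)" using A.supported_eq_iff[OF a s(1)] by blast
  also have "\<dots> = support_group A.K (aut_class M P)"
    by (rule A.support_group_involution[OF P(1,2), symmetric])
  finally have "h ` A.supported a = support_group B.K (aut_class M Q)"
    using support_group_iso[OF Pc] hP by simp
  also have "\<dots> = B.supported (?s Q)" by (rule B.support_group_involution[OF Q(1,2)])
  finally show ?thesis using s(2) by blast
qed

lemma image_supported_le_iff:
  assumes "a \<in> sets M" "a' \<in> sets M" "b \<in> sets M" "b' \<in> sets M"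
    and "h ` A.supported a = B.supported b" "h ` A.supported a' = B.supported b'"
  shows "(AE x in M. x \<in> a \<longrightarrow> x \<in> a') \<longleftrightarrow> (AE x in M. x \<in> b \<longrightarrow> x \<in> b')"
proof -
  have "h ` A.supported a \<subseteq> h ` A.supported a' \<longleftrightarrow> A.supported a \<subseteq> A.supported a'"
    using bij A.supported_carrier by (intro inj_on_image_subset_iff) (auto simp: bij_betw_def)
  thus ?thesis using A.supported_subset_iff B.supported_subset_iff assms by metis
qed

lemma inverse_iso: "full_group_iso M R' R (inv_into (carrier A.K) h)"
proof -
  have "inv_into (carrier A.K) h \<in> iso B.K A.K"
    by (rule K.iso_set_sym[OF iso])
  thus ?thesis
    by (intro full_group_iso.intro group_iso.intro group_iso_axioms.intro A.ergodic_relation_axioms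
        B.ergodic_relation_axioms K.group_axioms L.group_axioms)
qed

lemma inverse_image:
  assumes "b \<in> sets M" shows "\<exists>a\<in>sets M. h ` A.supported a = B.supported b"
proof -
  interpret I: full_group_iso M R' R "inv_into (carrier A.K) h" by (rule inverse_iso)
  obtain a where a: "a \<in> sets M" "inv_into (carrier A.K) h ` B.supported b = A.supported a"
    using I.supported_image[OF assms] by blast
  have "h ` inv_into (carrier A.K) h ` B.supported b = B.supported b"
    by (rule image_inv_into_cancel[OF _ B.supported_carrier]) (use bij in \<open>simp add: bij_betw_def\<close>)
  thus ?thesis using a by auto
qed

lemma point_map:
  obtains S where "S \<in> M \<rightarrow>\<^sub>M M" "\<And>a b. a \<in> sets M \<Longrightarrow> b \<in> sets M \<Longrightarrow>
    h ` A.supported a = B.supported b \<Longrightarrow> AE x in M. S x \<in> b \<longleftrightarrow> x \<in> a"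
proof -
  \<comment> \<open>\<open>\<Theta>\<close> will be the preimage operation of \<open>S\<close>, so
    it takes sets on the side of \<open>R'\<close> to sets on the side of \<open>R\<close>, against
    the direction of \<open>h\<close>.\<close>
  obtain \<Theta> where \<Theta>: "\<And>b. b \<in> sets M \<Longrightarrow> \<Theta> b \<in> sets M"
      "\<And>b. b \<in> sets M \<Longrightarrow> h ` A.supported (\<Theta> b) = B.supported b"
    using inverse_image by metis
  interpret measure_algebra_iso M \<Theta>
  proof
    show "\<Theta> b \<in> sets M" if "b \<in> sets M" for b using \<Theta>(1) that .
    show "(AE x in M. x \<in> \<Theta> b \<longrightarrow> x \<in> \<Theta> c) \<longleftrightarrow> (AE x in M. x \<in> b \<longrightarrow> x \<in> c)"
      if "b \<in> sets M" "c \<in> sets M" for b c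
      by (rule image_supported_le_iff) (use \<Theta> that in auto)
    fix a assume a: "a \<in> sets M"
    obtain b where b: "b \<in> sets M" "h ` A.supported a = B.supported b" using supported_image[OF a] by blast
    have "AE x in M. x \<in> a \<longrightarrow> x \<in> \<Theta> b" "AE x in M. x \<in> \<Theta> b \<longrightarrow> x \<in> a"
      by (subst image_supported_le_iff[of _ _ b b]; use a b \<Theta> in simp)+
    hence "AE x in M. x \<in> a \<longleftrightarrow> x \<in> \<Theta> b" by eventually_elim blast
    thus "\<exists>b\<in>sets M. AE x in M. x \<in> a \<longleftrightarrow> x \<in> \<Theta> b" using b(1) by blast
  qed
  obtain S where S: "S \<in> M \<rightarrow>\<^sub>M M" "\<And>b. b \<in> sets M \<Longrightarrow> AE x in M. S x \<in> b \<longleftrightarrow> x \<in> \<Theta> b"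
    using point_realization by blast
  show thesis
  proof (rule that[OF S(1)])
    fix a b assume ab: "a \<in> sets M" "b \<in> sets M" "h ` A.supported a = B.supported b"
    have "AE x in M. x \<in> a \<longrightarrow> x \<in> \<Theta> b" "AE x in M. x \<in> \<Theta> b \<longrightarrow> x \<in> a"
      by (subst image_supported_le_iff[of _ _ b b]; use ab \<Theta> in simp)+
    thus "AE x in M. S x \<in> b \<longleftrightarrow> x \<in> a" using S(2)[OF ab(2)] by eventually_elim blast
  qed
qed

lemma image_supported_preimage:
  assumes T: "T \<in> A.fg" "T' \<in> B.fg" "h (aut_class M T) = aut_class M T'"
    and ab: "h ` A.supported a = B.supported b"
  shows "h ` A.supported (T -` a \<inter> space M) = B.supported (T' -` b \<inter> space M)"
  unfolding A.supported_preimage[OF T(1)] B.supported_preimage[OF T(2)]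
proof (rule image_eq_if_iff[OF bij])
  fix u assume u: "u \<in> carrier A.K"
  have t: "aut_class M T \<in> carrier A.K" using T(1) by (auto simp: A.K_carrier)
  have "h (aut_class M T) \<otimes>\<^bsub>B.K\<^esub> h u = h v \<otimes>\<^bsub>B.K\<^esub> h (aut_class M T) \<longleftrightarrow>
      aut_class M T \<otimes>\<^bsub>A.K\<^esub> u = v \<otimes>\<^bsub>A.K\<^esub> aut_class M T" if "v \<in> A.supported a" for v
  proof -
    have v: "v \<in> carrier A.K" using that A.supported_carrier by blast
    show ?thesis
      using eq_iff[of "aut_class M T \<otimes>\<^bsub>A.K\<^esub> u" "v \<otimes>\<^bsub>A.K\<^esub> aut_class M T"] t u v by (simp add: mult)
  qed
  hence "(\<exists>v\<in>A.supported a. aut_class M T \<otimes>\<^bsub>A.K\<^esub> u = v \<otimes>\<^bsub>A.K\<^esub> aut_class M T) \<longleftrightarrow>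
      (\<exists>w\<in>h ` A.supported a. h (aut_class M T) \<otimes>\<^bsub>B.K\<^esub> h u = w \<otimes>\<^bsub>B.K\<^esub> h (aut_class M T))" by blast
  thus "u \<in> {u \<in> carrier A.K. \<exists>v\<in>A.supported a. aut_class M T \<otimes>\<^bsub>A.K\<^esub> u = v \<otimes>\<^bsub>A.K\<^esub> aut_class M T} \<longleftrightarrow>
      h u \<in> {u \<in> carrier B.K. \<exists>v\<in>B.supported b. aut_class M T' \<otimes>\<^bsub>B.K\<^esub> u = v \<otimes>\<^bsub>B.K\<^esub> aut_class M T'}"
    using u closed[OF u] ab T(3) by simp
qed auto

text \<open>Measure preservation is automatic: by equivariance the image measure is invariant under
  the second full group.\<close>

theorem spatial:
  obtains S where "mp_map M S"
    "\<And>a b. a \<in> sets M \<Longrightarrow> b \<in> sets M \<Longrightarrow> h ` A.supported a = B.supported b \<Longrightarrow>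
      AE x in M. S x \<in> b \<longleftrightarrow> x \<in> a"
    "\<And>T T'. T \<in> A.fg \<Longrightarrow> T' \<in> B.fg \<Longrightarrow> h (aut_class M T) = aut_class M T' \<Longrightarrow>
      AE x in M. S (T x) = T' (S x)"
proof -
  obtain S where S: "S \<in> M \<rightarrow>\<^sub>M M" and Sp: "\<And>a b. a \<in> sets M \<Longrightarrow> b \<in> sets M \<Longrightarrow>
    h ` A.supported a = B.supported b \<Longrightarrow> AE x in M. S x \<in> b \<longleftrightarrow> x \<in> a"
    by (rule point_map) (rule that)
  have Sx: "S x \<in> space M" if "x \<in> space M" for x using measurable_space[OF S that] .
  \<comment> \<open>Point maps agree once their preimages of all \<open>sep n\<close> agree; here
    both preimages are the preimage under \<open>T\<close> of the set that \<open>h\<close> matches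
    with \<open>sep n\<close>.\<close>
  have equi: "AE x in M. S (T x) = T' (S x)"
    if T: "T \<in> A.fg" "T' \<in> B.fg" "h (aut_class M T) = aut_class M T'" for T T'
  proof -
    have TM: "T -` a \<inter> space M \<in> sets M" "T' -` a \<inter> space M \<in> sets M" if "a \<in> sets M" for a
      using A.fg_preimage[OF T(1) that] B.fg_preimage[OF T(2) that] .
    show ?thesis
    proof (rule A.AE_equal_if_sep)
      show "AE x in M. S (T x) \<in> space M" "AE x in M. T' (S x) \<in> space M"
        using AE_space A.fg_space[OF T(1)] B.fg_space[OF T(2)] Sx by (auto elim!: eventually_mono)
      fix n
      obtain a where a: "a \<in> sets M" "h ` A.supported a = B.supported (A.sep n)"
        using inverse_image[OF A.sep_sets] by blast
      have "AE x in M. S (T x) \<in> A.sep n \<longleftrightarrow> T x \<in> a" by (rule A.fg_AE[OF T(1) Sp[OF a(1) A.sep_sets a(2)]])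
      moreover have "AE x in M. S x \<in> T' -` A.sep n \<inter> space M \<longleftrightarrow> x \<in> T -` a \<inter> space M"
        by (rule Sp[OF TM(1)[OF a(1)] TM(2)[OF A.sep_sets] image_supported_preimage[OF T a(2)]])
      ultimately show "AE x in M. S (T x) \<in> A.sep n \<longleftrightarrow> T' (S x) \<in> A.sep n"
        using AE_space by eventually_elim (use Sx in auto)
    qed
  qed
  have "distr M M S = M"
  proof (rule B.invariant_measure_unique)
    show "prob_space (distr M M S)" by (rule A.prob_space_distr[OF S])
    \<comment> \<open>A null set \<open>b\<close> has the trivial group as its supported subgroup,
      so \<open>h\<close> matches it with the empty set and its preimage under \<open>S\<close> is
      null.\<close>
    show "absolutely_continuous M (distr M M S)"
      unfolding absolutely_continuous_def
    proof
      fix b assume b: "b \<in> null_sets M"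
      hence bM: "b \<in> sets M" by auto
      have "AE x in M. x \<in> {} \<longleftrightarrow> x \<in> b" using AE_not_in[OF b] by eventually_elim simp
      hence "h ` A.supported {} = B.supported b"
        using B.supported_eq_iff[OF sets.empty_sets bM] by (simp add: A.supported_empty B.supported_empty one)
      from Sp[OF sets.empty_sets bM this] have "AE x in M. S x \<notin> b" by eventually_elim simp
      hence "emeasure M (S -` b \<inter> space M) = 0"
        using AE_iff_measurable[OF measurable_sets[OF S bM], of "\<lambda>x. S x \<notin> b"] by auto
      thus "b \<in> null_sets (distr M M S)" using bM S by (simp add: null_sets_def emeasure_distr)
    qed
    fix T' b assume T': "T' \<in> B.fg" and b: "b \<in> sets M"
    \<comment> \<open>Surjectivity of \<open>h\<close> supplies a partner \<open>T\<close> of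
      \<open>T'\<close>; equivariance reduces invariance of the image measure under
      \<open>T'\<close> to invariance of the measure under \<open>T\<close>.\<close>
    have "aut_class M T' \<in> h ` carrier A.K" using bij T' by (auto simp: bij_betw_def B.K_carrier)
    then obtain T where T: "T \<in> A.fg" "h (aut_class M T) = aut_class M T'" by (auto simp: A.K_carrier)
    have mT: "T \<in> M \<rightarrow>\<^sub>M M" "T' \<in> M \<rightarrow>\<^sub>M M" using mp_measurable fgroup_mp T(1) T' by blast+
    have Tb: "T' -` b \<inter> space M \<in> sets M" by (rule measurable_sets[OF mT(2) b])
    have "emeasure (distr M M S) (T' -` b \<inter> space M) = emeasure M (S -` (T' -` b \<inter> space M) \<inter> space M)"
      by (rule emeasure_distr[OF S Tb])
    also have "\<dots> = emeasure M (T -` (S -` b \<inter> space M) \<inter> space M)"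
    proof (rule emeasure_eq_AE)
      show "AE x in M. x \<in> S -` (T' -` b \<inter> space M) \<inter> space M \<longleftrightarrow> x \<in> T -` (S -` b \<inter> space M) \<inter> space M"
        using equi[OF T(1) T' T(2)] AE_space by eventually_elim (use Sx A.fg_space[OF T(1)] in auto)
      show "S -` (T' -` b \<inter> space M) \<inter> space M \<in> sets M" by (rule measurable_sets[OF S Tb])
      show "T -` (S -` b \<inter> space M) \<inter> space M \<in> sets M"
        by (rule measurable_sets[OF mT(1) measurable_sets[OF S b]])
    qed
    also have "\<dots> = emeasure M (S -` b \<inter> space M)"
      by (rule mp_emeasure_preimage[OF fgroup_mp[OF T(1)] measurable_sets[OF S b]])
    also have "\<dots> = emeasure (distr M M S) b" by (rule emeasure_distr[OF S b, symmetric])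
    finally show "emeasure (distr M M S) (T' -` b \<inter> space M) = emeasure (distr M M S) b" .
  qed simp
  hence "mp_map M S" using S by (simp add: mp_map_def)
  thus thesis using that Sp equi by blast
qed

text \<open>\<open>S'\<close> is the point map of the inverse isomorphism. Under both composites the
  preimage of every \<open>sep n\<close> is \<open>sep n\<close> again up to a null set, hence they
  are the identity almost everywhere.\<close>

lemma spatial_inverse:
  obtains S S' where "mp_map M S" "mp_map M S'" "AE x in M. S (S' x) = x" "AE x in M. S' (S x) = x"
    "\<And>T T'. T \<in> A.fg \<Longrightarrow> T' \<in> B.fg \<Longrightarrow> h (aut_class M T) = aut_class M T' \<Longrightarrow>
      AE x in M. S (T x) = T' (S x)"
    "\<And>T T'. T \<in> A.fg \<Longrightarrow> T' \<in> B.fg \<Longrightarrow> h (aut_class M T) = aut_class M T' \<Longrightarrow>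
      AE x in M. S' (T' x) = T (S' x)"
proof -
  let ?h' = "inv_into (carrier A.K) h"
  interpret I: full_group_iso M R' R ?h' by (rule inverse_iso)
  obtain S where S: "mp_map M S"
    and Sp: "\<And>a b. a \<in> sets M \<Longrightarrow> b \<in> sets M \<Longrightarrow> h ` A.supported a = B.supported b \<Longrightarrow>
      AE x in M. S x \<in> b \<longleftrightarrow> x \<in> a"
    and Se: "\<And>T T'. T \<in> A.fg \<Longrightarrow> T' \<in> B.fg \<Longrightarrow> h (aut_class M T) = aut_class M T' \<Longrightarrow>
      AE x in M. S (T x) = T' (S x)"
    by (rule spatial) (rule that)
  obtain S' where S': "mp_map M S'"
    and Sp': "\<And>a b. a \<in> sets M \<Longrightarrow> b \<in> sets M \<Longrightarrow> ?h' ` B.supported b = A.supported a \<Longrightarrow>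
      AE x in M. S' x \<in> a \<longleftrightarrow> x \<in> b"
    and Se': "\<And>T T'. T' \<in> B.fg \<Longrightarrow> T \<in> A.fg \<Longrightarrow> ?h' (aut_class M T') = aut_class M T \<Longrightarrow>
      AE x in M. S' (T' x) = T (S' x)"
    by (rule I.spatial) (rule that)
  have inv: "?h' ` B.supported b = A.supported a" if "h ` A.supported a = B.supported b" for a b
    unfolding that[symmetric]
    by (rule inv_into_image_cancel[OF _ A.supported_carrier]) (use bij in \<open>simp add: bij_betw_def\<close>)
  have meas: "S \<in> M \<rightarrow>\<^sub>M M" "S' \<in> M \<rightarrow>\<^sub>M M" using S S' by (auto simp: mp_map_def)
  have sp: "AE x in M. S (S' x) \<in> space M" "AE x in M. S' (S x) \<in> space M"
    using AE_space measurable_space[OF meas(1)] measurable_space[OF meas(2)]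
    by (auto elim!: eventually_mono)
  have "AE x in M. S (S' x) = x"
  proof (rule A.AE_equal_if_sep[OF sp(1) AE_space])
    fix n
    obtain a where a: "a \<in> sets M" "h ` A.supported a = B.supported (A.sep n)"
      using inverse_image[OF A.sep_sets] by blast
    show "AE x in M. S (S' x) \<in> A.sep n \<longleftrightarrow> x \<in> A.sep n"
      using mp_map_AE[OF S' Sp[OF a(1) A.sep_sets a(2)]] Sp'[OF a(1) A.sep_sets inv[OF a(2)]] by eventually_elim simp
  qed
  moreover have "AE x in M. S' (S x) = x"
  proof (rule A.AE_equal_if_sep[OF sp(2) AE_space])
    fix n
    obtain b where b: "b \<in> sets M" "h ` A.supported (A.sep n) = B.supported b"
      using supported_image[OF A.sep_sets] by blast
    show "AE x in M. S' (S x) \<in> A.sep n \<longleftrightarrow> x \<in> A.sep n"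
      using mp_map_AE[OF S Sp'[OF A.sep_sets b(1) inv[OF b(2)]]] Sp[OF A.sep_sets b] by eventually_elim simp
  qed
  moreover have "AE x in M. S' (T' x) = T (S' x)"
    if T: "T \<in> A.fg" "T' \<in> B.fg" "h (aut_class M T) = aut_class M T'" for T T'
  proof (rule Se'[OF T(2,1)])
    show "?h' (aut_class M T') = aut_class M T"
      using bij T(1) by (auto simp: T(3)[symmetric] bij_betw_def A.K_carrier intro!: inv_into_f_f)
  qed
  ultimately show thesis using that[OF S S'] Se by blast
qed

end

section \<open>Orbit equivalence\<close>

context pmp_ergodic_action
begin

lemma action_mp_group: "g \<in> carrier G \<Longrightarrow> \<phi> g \<in> carrier (mp_group M)"
proof -
  assume g: "g \<in> carrier G"
  have ext: "\<phi> g \<in> extensional (space M)"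
    using group_hom.hom_closed[OF group_hom g] by (simp add: BijGroup_def Bij_def)
  have b: "bij_betw (\<phi> g) (space M) (space M)"
    using bij_prop0[OF g] by (simp add: Bij_def)
  have mp: "mp_map M (\<phi> k)" if "k \<in> carrier G" for k by (rule measure_preserving[OF that])
  have "inv_into (space M) (\<phi> g) x = \<phi> (inv g) x" if x: "x \<in> space M" for x
  proof (rule inv_into_f_eq)
    show "inj_on (\<phi> g) (space M)" using b by (simp add: bij_betw_def)
    show "\<phi> (inv g) x \<in> space M" using element_image[of "inv g" x] g x by blast
    show "\<phi> g (\<phi> (inv g) x) = x"
      using composition_rule[OF x g, of "inv g"] g x fun_cong[OF id_eq_one, of x] by simp
  qed
  hence "inv_into (space M) (\<phi> g) \<in> M \<rightarrow>\<^sub>M M \<longleftrightarrow> \<phi> (inv g) \<in> M \<rightarrow>\<^sub>M M" by (rule measurable_cong)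
  hence "inv_into (space M) (\<phi> g) \<in> M \<rightarrow>\<^sub>M M" using mp[of "inv g"] g by (simp add: mp_map_def)
  thus ?thesis using ext b mp[OF g] by (simp add: mp_carrier mp_bijection_def)
qed

lemma action_fgroup: "g \<in> carrier G \<Longrightarrow> \<phi> g \<in> fgroup M (orbit_rel G M \<phi>)"
  using action_mp_group by (auto simp: fgroup_def orbit_rel_def orbit_def intro!: AE_I2)

lemma ergodic_relation_orbit_rel: "ergodic_relation M (orbit_rel G M \<phi>)"
proof -
  obtain \<nu> where "haar_action G \<tau> M \<phi> \<nu>" using haar_action_exists by blast
  then interpret haar_action G \<tau> M \<phi> \<nu> .
  show ?thesis
  proof
    show "equiv (space M) (orbit_rel G M \<phi>)" by (rule equiv_orbit_rel) simp
    fix a b assume ab: "a \<in> sets M" "b \<in> sets M" "0 < measure M a" "0 < measure M b"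
    obtain g where g: "g \<in> carrier G" "0 < measure M {x \<in> a. \<phi> g x \<in> b}"
      using moving_element[OF ab(2,1,4,3)] by blast
    have "{x \<in> a. \<phi> g x \<in> b} = a \<inter> (\<phi> g -` b \<inter> space M)"
      using sets.sets_into_space[OF ab(1)] by auto
    moreover have "\<phi> g -` b \<inter> space M \<in> sets M"
      by (rule measurable_sets[OF mp_measurable[OF action_mp_group[OF g(1)]] ab(2)])
    ultimately have "{x \<in> a. \<phi> g x \<in> b} \<in> sets M" using ab(1) by simp
    thus "\<exists>T\<in>fgroup M (orbit_rel G M \<phi>). \<exists>C\<in>sets M. C \<subseteq> a \<and> 0 < measure M C \<and> T ` C \<subseteq> b"
      using g action_fgroup[OF g(1)] by (intro bexI[of _ "\<phi> g"] bexI[of _ "{x \<in> a. \<phi> g x \<in> b}"]) auto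
  qed
qed

lemma orbit_rel_measurable: "orbit_rel G M \<phi> \<in> sets (M \<Otimes>\<^sub>M M)"
proof -
  obtain \<nu> where "haar_action G \<tau> M \<phi> \<nu>" using haar_action_exists by blast
  thus ?thesis by (rule haar_action.orbit_rel_sets)
qed

text \<open>Each \<open>\<phi> g\<close> belongs to the full group, so \<open>S (\<phi> g x)\<close>
  equals \<open>T' (S x)\<close> for some \<open>T'\<close> in the second full group and is related
  to \<open>S x\<close>, with a null set depending on \<open>g\<close>. The passage to one conull
  set is \<open>AE_uniform_on_orbits\<close>.\<close>

lemma intertwiner_maps_orbits:
  assumes R': "R' \<in> sets (M \<Otimes>\<^sub>M M)" "equiv (space M) R'" and S: "mp_map M S"
    and equi: "\<And>T. T \<in> fgroup M (orbit_rel G M \<phi>) \<Longrightarrow> \<exists>T'\<in>fgroup M R'. AE x in M. S (T x) = T' (S x)"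
  shows "\<exists>A. (AE x in M. x \<in> A) \<and> (\<forall>x\<in>A. \<forall>y\<in>A. (x, y) \<in> orbit_rel G M \<phi> \<longrightarrow> (S x, S y) \<in> R')"
proof -
  obtain \<nu> where "haar_action G \<tau> M \<phi> \<nu>" using haar_action_exists by blast
  then interpret haar_action G \<tau> M \<phi> \<nu> .
  show ?thesis
  proof (rule AE_uniform_on_orbits[OF R'])
    show "S \<in> M \<rightarrow>\<^sub>M M" using S by (simp add: mp_map_def)
    fix g assume "g \<in> carrier G"
    then obtain T' where T': "T' \<in> fgroup M R'" "AE x in M. S (\<phi> g x) = T' (S x)"
      using equi action_fgroup by blast
    have "AE x in M. (x, T' x) \<in> R'" using T'(1) by (simp add: fgroup_def)
    from mp_map_AE[OF S this] T'(2) show "AE x in M. (S x, S (\<phi> g x)) \<in> R'" by eventually_elim simp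
  qed
qed

end

theorem theorem3p26:
  fixes G :: "('g, 'm) monoid_scheme" and H :: "('h, 'n) monoid_scheme"
    and \<tau>\<^sub>G :: "'g topology" and \<tau>\<^sub>H :: "'h topology"
    and M :: "'a measure"
    and \<phi> :: "'g \<Rightarrow> 'a \<Rightarrow> 'a" and \<theta> :: "'h \<Rightarrow> 'a \<Rightarrow> 'a"
    and \<psi> :: "('a \<Rightarrow> 'a) set \<Rightarrow> ('a \<Rightarrow> 'a) set"
  assumes "pmp_ergodic_action G \<tau>\<^sub>G M \<phi>"
    and "pmp_ergodic_action H \<tau>\<^sub>H M \<theta>"
    and "\<psi> \<in> iso (full_group M (orbit_rel G M \<phi>)) (full_group M (orbit_rel H M \<theta>))"
  shows "\<exists>A S. orbit_equivalence M (orbit_rel G M \<phi>) (orbit_rel H M \<theta>) A S \<and>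
    (\<forall>T \<in> carrier (full_group M (orbit_rel G M \<phi>)).
       \<psi> T = aut_class M S \<otimes>\<^bsub>aut_group M\<^esub> T \<otimes>\<^bsub>aut_group M\<^esub> inv\<^bsub>aut_group M\<^esub> (aut_class M S))"
proof -
  interpret G: pmp_ergodic_action G \<tau>\<^sub>G M \<phi> by fact
  interpret H: pmp_ergodic_action H \<tau>\<^sub>H M \<theta> by fact
  let ?R = "orbit_rel G M \<phi>" and ?R' = "orbit_rel H M \<theta>"
  interpret A: ergodic_relation M ?R by (rule G.ergodic_relation_orbit_rel)
  interpret B: ergodic_relation M ?R' by (rule H.ergodic_relation_orbit_rel)
  interpret full_group_iso M ?R ?R' \<psi>
    by (intro full_group_iso.intro group_iso.intro group_iso_axioms.intro A.ergodic_relation_axioms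
        B.ergodic_relation_axioms A.group_K B.group_K assms(3))
  interpret Aut: group "aut_group M" by (rule group_aut_group)
  obtain S S' where S: "mp_map M S" "mp_map M S'"
    and inv: "AE x in M. S (S' x) = x" "AE x in M. S' (S x) = x"
    and equi: "\<And>T T'. T \<in> A.fg \<Longrightarrow> T' \<in> B.fg \<Longrightarrow> \<psi> (aut_class M T) = aut_class M T' \<Longrightarrow>
      AE x in M. S (T x) = T' (S x)"
    and equi': "\<And>T T'. T \<in> A.fg \<Longrightarrow> T' \<in> B.fg \<Longrightarrow> \<psi> (aut_class M T) = aut_class M T' \<Longrightarrow>
      AE x in M. S' (T' x) = T (S' x)"
    by (rule spatial_inverse) (rule that)
  have ex: "\<exists>T'\<in>B.fg. \<psi> (aut_class M T) = aut_class M T'" if "T \<in> A.fg" for T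
  proof -
    have "\<psi> (aut_class M T) \<in> carrier B.K" by (rule closed) (use that in \<open>simp add: A.K_carrier\<close>)
    thus ?thesis by (auto simp: B.K_carrier)
  qed
  have ex': "\<exists>T\<in>A.fg. \<psi> (aut_class M T) = aut_class M T'" if "T' \<in> B.fg" for T'
  proof -
    have "aut_class M T' \<in> \<psi> ` carrier A.K" using bij that by (simp add: bij_betw_def B.K_carrier)
    thus ?thesis by (auto simp: A.K_carrier)
  qed
  have eq: "\<exists>T'\<in>B.fg. AE x in M. S (T x) = T' (S x)" if "T \<in> A.fg" for T
    using ex[OF that] equi[OF that] by blast
  have eq': "\<exists>T\<in>A.fg. AE x in M. S' (T' x) = T (S' x)" if "T' \<in> B.fg" for T'
    using ex'[OF that] equi'[OF _ that] by blast
  obtain E1 where E1: "AE x in M. x \<in> E1" "\<And>x y. x \<in> E1 \<Longrightarrow> y \<in> E1 \<Longrightarrow> (x, y) \<in> ?R \<Longrightarrow> (S x, S y) \<in> ?R'"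
    using G.intertwiner_maps_orbits[OF H.orbit_rel_measurable B.equiv S(1) eq] by blast
  obtain E2 where E2: "AE x in M. x \<in> E2" "\<And>x y. x \<in> E2 \<Longrightarrow> y \<in> E2 \<Longrightarrow> (x, y) \<in> ?R' \<Longrightarrow> (S' x, S' y) \<in> ?R"
    using H.intertwiner_maps_orbits[OF G.orbit_rel_measurable A.equiv S(2) eq'] by blast
  \<comment> \<open>\<open>E1\<close> controls \<open>S\<close> and \<open>E2\<close> controls
    \<open>S'\<close>; an invariant set inside both gives the two implications of the orbit
    equivalence, the second one by applying \<open>S'\<close> to \<open>S x\<close> and
    \<open>S y\<close>.\<close>
  have "AE x in M. x \<in> E1 \<inter> E2"
    using E1(1) E2(1) by eventually_elim blast
  from invariant_conull_set[OF S inv this] obtain A where A: "A \<in> sets M" "AE x in M. x \<in> A" "A \<subseteq> E1 \<inter> E2"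
      "mp_bijection (restrict_space M A) S"
      "\<And>x. x \<in> A \<Longrightarrow> S x \<in> A \<and> S' x \<in> A \<and> S (S' x) = x \<and> S' (S x) = x"
    by (elim bexE conjE) (rule that, assumption+, erule (1) bspec)
  have "(x, y) \<in> ?R \<longleftrightarrow> (S x, S y) \<in> ?R'" if "x \<in> A" "y \<in> A" for x y
  proof
    show "(S x, S y) \<in> ?R'" if "(x, y) \<in> ?R" using E1(2) that \<open>x \<in> A\<close> \<open>y \<in> A\<close> A(3) by blast
    assume "(S x, S y) \<in> ?R'"
    hence "(S' (S x), S' (S y)) \<in> ?R" using E2(2) that A(3,5) by blast
    thus "(x, y) \<in> ?R" using A(5) that by simp
  qed
  moreover have "emeasure M A = emeasure M (space M)"
  proof (rule emeasure_eq_AE)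
    show "AE x in M. x \<in> A \<longleftrightarrow> x \<in> space M" using A(2) AE_space by eventually_elim simp
  qed (use A(1) in auto)
  ultimately have oe: "orbit_equivalence M ?R ?R' A S"
    using A(1,4) by (simp add: orbit_equivalence_def)
  \<comment> \<open>The map \<open>S\<close> itself is known to be bijective on \<open>A\<close>
    only; \<open>U\<close> is the representative that is extensional and a bijection of the whole
    space, so that products of classes can be computed with it.\<close>
  define U where "U = (\<lambda>x\<in>space M. if x \<in> A then S x else x)"
  have "mp_bijection M U"
    using mp_bijection_extend[OF A(1,2,4)] mp_bijection_cong[of M U "\<lambda>x. if x \<in> A then S x else x"]
    by (simp add: U_def)
  hence U: "U \<in> carrier (mp_group M)" by (simp add: mp_carrier U_def)
  have US: "AE x in M. U x = S x" using A(2) AE_space by eventually_elim (simp add: U_def)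
  have "AE x in M. V x = S x \<longleftrightarrow> V x = U x" for V using US by eventually_elim simp
  hence "(AE x in M. V x = S x) \<longleftrightarrow> (AE x in M. V x = U x)" for V
    by (rule eventually_subst)
  hence clsS: "aut_class M S = aut_class M U" by (simp add: aut_class_def)
  have "\<psi> t = aut_class M S \<otimes>\<^bsub>aut_group M\<^esub> t \<otimes>\<^bsub>aut_group M\<^esub> inv\<^bsub>aut_group M\<^esub> (aut_class M S)"
    if t: "t \<in> carrier A.K" for t
  proof -
    obtain T where T: "T \<in> A.fg" "t = aut_class M T" using t by (auto simp: A.K_carrier)
    obtain T' where T': "T' \<in> B.fg" "\<psi> (aut_class M T) = aut_class M T'" using ex[OF T(1)] by blast
    have c: "T \<in> carrier (mp_group M)" "T' \<in> carrier (mp_group M)"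
      using T(1) T'(1) fgroup_mp by blast+
    have cls: "aut_class M V \<in> carrier (aut_group M)" if "V \<in> carrier (mp_group M)" for V
      using that by (simp add: aut_group_carrier)
    have "AE x in M. T' (U x) = U (T x)"
      using equi[OF T(1) T'] US mp_AE[OF c(1) US] by eventually_elim simp
    hence "aut_class M T' \<otimes>\<^bsub>aut_group M\<^esub> aut_class M U = aut_class M U \<otimes>\<^bsub>aut_group M\<^esub> aut_class M T"
      unfolding aut_class_mult[OF c(2) U] aut_class_mult[OF U c(1)]
        aut_class_eq_iff[OF mcomp_carrier[OF c(2) U] mcomp_carrier[OF U c(1)]]
      using AE_space by eventually_elim simp
    hence "aut_class M T' = aut_class M U \<otimes>\<^bsub>aut_group M\<^esub> aut_class M T \<otimes>\<^bsub>aut_group M\<^esub> inv\<^bsub>aut_group M\<^esub> (aut_class M U)"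
      using cls[OF c(1)] cls[OF c(2)] cls[OF U] by (metis Aut.inv_closed Aut.m_assoc Aut.r_inv Aut.r_one)
    thus ?thesis using T(2) T'(2) clsS by simp
  qed
  thus ?thesis using oe by blast
qed

end
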